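(* Let $p\ge 2$ and let $\mathcal X_{0h}$, $\mathcal Y_h$, $a_1$ and the fully discrete scheme be as defined in the context. For every $m=1,\dots,N$ the scheme: find $(\mathbf u_h^m,\mathbf B_h^m)\in \mathcal X_{0h}\times\mathcal Y_h$ such that for all $(\mathbf v_h,\mathbf w_h)\in\mathcal X_{0h}\times\mathcal Y_h$ $$\Big(\tfrac{\mathbf u_h^m-\mathbf u_h^{m-1}}{\Delta t},\mathbf v_h\Big)+a_1(\mathbf u_h^{m-1},\mathbf u_h^m,\mathbf v_h)+\frac{\nu}{\rho}\big(|\nabla\mathbf u_h^m|^{p-2}\nabla\mathbf u_h^m,\nabla\mathbf v_h\big)+\frac1{\mu\rho}\big(\mathbf B_h^{m-1}\times(\nabla\times\mathbf B_h^m),\mathbf v_h\big)=(\mathbf g^m,\mathbf v_h),$$ $$\Big(\tfrac{\mathbf B_h^m-\mathbf B_h^{m-1}}{\Delta t},\mathbf w_h\Big)+\frac1{\mu\sigma}(\nabla\times\mathbf B_h^m,\nabla\times\mathbf w_h)-(\mathbf u_h^m\times\mathbf B_h^{m-1},\nabla\times\mathbf w_h)=(\mathbf f^m,\mathbf w_h),$$ admits a unique solution $(\mathbf u_h^m,\mathbf B_h^m)\in\mathcal X_{0h}\times\mathcal Y_h$. This holds for arbitrary $\Delta t>0$ and $h>0$; in particular, no coupling condition between the time-step and the mesh-size is required.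
   Context: $\mathbb D\subset\mathbb R^3$ is a bounded Lipschitz polyhedral domain, $T>0$, and $\nu,\rho,\mu,\sigma>0$ are constants. $(\cdot,\cdot)$ is the $L^2(\mathbb D)$ inner product for scalar, vector and matrix fields. $\mathcal X=W^{1,p}_0(\mathbb D)^3$, $Q=L^2_0(\mathbb D)$ (zero-mean $L^2$ functions), $\mathcal Y=\mathbf H(\mathbf{curl};\mathbb D)$. $\mathcal T_h$ is a regular quasi-uniform tetrahedral triangulation of $\mathbb D$ with mesh size $h$; $k\ge1$; $P_k(K)$ are polynomials of degree at most $k$ on $K$ and $\tilde P_k(K)$ homogeneous polynomials of degree $k$ (scalar- or vector-valued according to context). $\mathcal X_h\subset\{\mathbf v_h\in\mathcal X:\mathbf v_h|_K\in P_k(K)\ \forall K\in\mathcal T_h\}$ and $Q_h\subset\{q_h\in Q: q_h|_K\in P_k(K)\ \forall K\}$ are a pair of finite element spaces satisfying the Babuška–Brezzi (discrete inf-sup) condition. $\mathcal X_{0h}=\{\mathbf v_h\in\mathcal X_h:(\operatorname{div}\mathbf v_h,q_h)=0\ \forall q_h\in Q_h\}$. $\mathcal Y_h=\{\mathbf A_h\in\mathcal Y:\mathbf A_h|_K\in\mathcal N_k(K)\ \forall K\}$ with $\mathcal N_k(K)=P_{k-1}(K)\oplus\{\mathbf q\in\tilde P_k(K):\mathbf q(\mathbf x)\cdot\mathbf x=0\}$ (Nédélec edge elements). $$a_1(\mathbf u,\mathbf w,\mathbf v)=\tfrac12\Big\{\int_{\mathbb D}((\mathbf u\cdot\nabla)\mathbf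 w)\cdot\mathbf v\,dx-\int_{\mathbb D}((\mathbf u\cdot\nabla)\mathbf v)\cdot\mathbf w\,dx\Big\}.$$ $\Delta t=T/N$ is the time step. The initial values $(\mathbf u_h^0,\mathbf B_h^0)\in\mathcal X_{0h}\times\mathcal Y_h$ and the discrete sources $\mathbf g^m,\mathbf f^m\in L^2(\mathbb D)^3$ are given; at step $m$ the pair $(\mathbf u_h^{m-1},\mathbf B_h^{m-1})$ is known. *)

theory Defs
  imports "HOL-Analysis.Analysis"
begin

text \<open>
  Elements of Lebesgue and Sobolev spaces are represented by functions on all of \<open>real^3\<close>; only
  their values on the domain \<open>D\<close> up to null sets matter. Equality of two such elements is therefore
  equality almost everywhere with respect to \<open>lebesgue_on D\<close>.
\<close>

section \<open>Lebesgue and Sobolev spaces\<close>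

definition Lp :: "(real^3) set \<Rightarrow> real \<Rightarrow> (real^3 \<Rightarrow> 'b::euclidean_space) set" where
  "Lp D p = {f. f \<in> borel_measurable (lebesgue_on D) \<and>
                integrable (lebesgue_on D) (\<lambda>x. norm (f x) powr p)}"

definition Lp_norm :: "(real^3) set \<Rightarrow> real \<Rightarrow> (real^3 \<Rightarrow> 'b::euclidean_space) \<Rightarrow> real" where
  "Lp_norm D p f = (LINT x|lebesgue_on D. norm (f x) powr p) powr (1 / p)"

text \<open>For matrix fields, \<open>\<bullet>\<close> and \<open>norm\<close> on \<open>real^3^3\<close> are the Frobenius product and norm.\<close>

definition L2_inner :: "(real^3) set \<Rightarrow> (real^3 \<Rightarrow> 'b::euclidean_space) \<Rightarrow> (real^3 \<Rightarrow> 'b) \<Rightarrow> real" where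
  "L2_inner D f g = (LINT x|lebesgue_on D. f x \<bullet> g x)"

definition L2_zero_mean :: "(real^3) set \<Rightarrow> (real^3 \<Rightarrow> real) set" where
  "L2_zero_mean D = {q \<in> Lp D 2. (LINT x|lebesgue_on D. q x) = 0}"

definition locally_integrable :: "(real^3) set \<Rightarrow> (real^3 \<Rightarrow> 'b::euclidean_space) \<Rightarrow> bool" where
  "locally_integrable D f \<longleftrightarrow> (\<forall>C. compact C \<and> C \<subseteq> D \<longrightarrow> set_integrable lebesgue C f)"

primrec C_k :: "nat \<Rightarrow> (real^3 \<Rightarrow> 'b::euclidean_space) \<Rightarrow> bool" where
  "C_k 0 f \<longleftrightarrow> continuous_on UNIV f"
| "C_k (Suc n) f \<longleftrightarrow> (\<forall>x. f differentiable (at x)) \<and>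
     (\<forall>i. C_k n (\<lambda>x. frechet_derivative f (at x) (axis i 1)))"

definition test_functions :: "(real^3) set \<Rightarrow> (real^3 \<Rightarrow> 'b::euclidean_space) set" where
  "test_functions D = {\<phi>. (\<forall>n. C_k n \<phi>) \<and> (\<exists>C. compact C \<and> C \<subseteq> D \<and> (\<forall>x. x \<notin> C \<longrightarrow> \<phi> x = 0))}"

text \<open>The entry \<open>G x $ i $ j\<close> is the weak derivative of the \<open>i\<close>-th component in direction \<open>j\<close>.\<close>

definition has_weak_grad :: "(real^3) set \<Rightarrow> (real^3 \<Rightarrow> real^3) \<Rightarrow> (real^3 \<Rightarrow> real^3^3) \<Rightarrow> bool" where
  "has_weak_grad D u G \<longleftrightarrow> locally_integrable D u \<and> locally_integrable D G \<and>
     (\<forall>\<phi> \<in> test_functions D. \<forall>i j.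
        (LINT x|lebesgue_on D. u x $ i * frechet_derivative \<phi> (at x) (axis j 1)) =
        - (LINT x|lebesgue_on D. G x $ i $ j * \<phi> x))"

definition curl_of_jacobian :: "real^3^3 \<Rightarrow> real^3" where
  "curl_of_jacobian J = vector [J$3$2 - J$2$3, J$1$3 - J$3$1, J$2$1 - J$1$2]"

definition has_weak_curl :: "(real^3) set \<Rightarrow> (real^3 \<Rightarrow> real^3) \<Rightarrow> (real^3 \<Rightarrow> real^3) \<Rightarrow> bool" where
  "has_weak_curl D u C \<longleftrightarrow> locally_integrable D u \<and> locally_integrable D C \<and>
     (\<forall>\<phi> \<in> test_functions D.
        L2_inner D u (\<lambda>x. curl_of_jacobian (jacobian \<phi> (at x))) = L2_inner D C \<phi>)"

text \<open>Weak derivatives are unique only almost everywhere on \<open>D\<close>; a representative is chosen.\<close>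

definition weak_grad :: "(real^3) set \<Rightarrow> (real^3 \<Rightarrow> real^3) \<Rightarrow> real^3 \<Rightarrow> real^3^3" where
  "weak_grad D u = (SOME G. has_weak_grad D u G)"

definition weak_curl :: "(real^3) set \<Rightarrow> (real^3 \<Rightarrow> real^3) \<Rightarrow> real^3 \<Rightarrow> real^3" where
  "weak_curl D u = (SOME C. has_weak_curl D u C)"

definition weak_div :: "(real^3) set \<Rightarrow> (real^3 \<Rightarrow> real^3) \<Rightarrow> real^3 \<Rightarrow> real" where
  "weak_div D u = (\<lambda>x. trace (weak_grad D u x))"

definition W1p :: "(real^3) set \<Rightarrow> real \<Rightarrow> (real^3 \<Rightarrow> real^3) set" where
  "W1p D p = {u \<in> Lp D p. \<exists>G \<in> Lp D p. has_weak_grad D u G}"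

definition W1p_norm :: "(real^3) set \<Rightarrow> real \<Rightarrow> (real^3 \<Rightarrow> real^3) \<Rightarrow> real" where
  "W1p_norm D p u = (Lp_norm D p u powr p + Lp_norm D p (weak_grad D u) powr p) powr (1 / p)"

text \<open>The closure of the test functions in the Sobolev norm.\<close>

definition W1p_0 :: "(real^3) set \<Rightarrow> real \<Rightarrow> (real^3 \<Rightarrow> real^3) set" where
  "W1p_0 D p = {u \<in> W1p D p. \<exists>\<phi>. (\<forall>n::nat. \<phi> n \<in> test_functions D) \<and>
     (\<lambda>n. W1p_norm D p (\<lambda>x. \<phi> n x - u x)) \<longlonglongrightarrow> 0}"

definition Hcurl :: "(real^3) set \<Rightarrow> (real^3 \<Rightarrow> real^3) set" where
  "Hcurl D = {A \<in> Lp D 2. \<exists>C \<in> Lp D 2. has_weak_curl D A C}"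

section \<open>Domain and triangulations\<close>

text \<open>
  Near each boundary point, in a Cartesian frame with vertical unit vector \<open>e\<close>, the domain is the
  strict epigraph of a Lipschitz function on the plane orthogonal to \<open>e\<close>.
\<close>

definition lipschitz_boundary :: "(real^3) set \<Rightarrow> bool" where
  "lipschitz_boundary D \<longleftrightarrow> (\<forall>z \<in> frontier D. \<exists>r>0. \<exists>e L \<gamma>. norm e = 1 \<and>
     L-lipschitz_on {y. y \<bullet> e = 0} \<gamma> \<and>
     D \<inter> ball z r = {x \<in> ball z r. \<gamma> (x - (x \<bullet> e) *\<^sub>R e) < x \<bullet> e})"

text \<open>Polyhedral: the boundary consists of finitely many planar polygons.\<close>

definition lipschitz_polyhedral_domain :: "(real^3) set \<Rightarrow> bool" where
  "lipschitz_polyhedral_domain D \<longleftrightarrow>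
     D \<noteq> {} \<and> open D \<and> connected D \<and> bounded D \<and> lipschitz_boundary D \<and>
     (\<exists>F. finite F \<and> (\<forall>P \<in> F. polytope P \<and> aff_dim P = 2) \<and> frontier D = \<Union>F)"

definition tetrahedral_mesh :: "(real^3) set \<Rightarrow> (real^3) set set \<Rightarrow> bool" where
  "tetrahedral_mesh D \<T> \<longleftrightarrow> triangulation \<T> \<and> (\<forall>K \<in> \<T>. 3 simplex K) \<and> \<Union>\<T> = closure D"

definition inradius :: "(real^3) set \<Rightarrow> real" where
  "inradius K = Sup {r. \<exists>c. cball c r \<subseteq> K}"

text \<open>
  The family is indexed by the set \<open>H\<close> of mesh sizes; \<open>\<kappa>\<close> (shape regularity) and \<open>\<theta>\<close>
  (quasi-uniformity) do not depend on \<open>h\<close>.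
\<close>

definition regular_quasi_uniform_family ::
  "(real^3) set \<Rightarrow> real set \<Rightarrow> (real \<Rightarrow> (real^3) set set) \<Rightarrow> bool" where
  "regular_quasi_uniform_family D H \<T> \<longleftrightarrow>
     (\<forall>h \<in> H. h > 0 \<and> tetrahedral_mesh D (\<T> h) \<and> h = Max (diameter ` \<T> h)) \<and>
     (\<exists>\<kappa>>0. \<forall>h \<in> H. \<forall>K \<in> \<T> h. diameter K \<le> \<kappa> * inradius K) \<and>
     (\<exists>\<theta>>0. \<forall>h \<in> H. \<forall>K \<in> \<T> h. \<theta> * h \<le> diameter K)"

section \<open>Finite element spaces\<close>

text \<open>Polynomials in three variables as functions; \<open>\<alpha>\<close> ranges over multi-indices.\<close>

definition poly_le :: "nat \<Rightarrow> (real^3 \<Rightarrow> 'b::euclidean_space) set" where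
  "poly_le k = {q. \<exists>c. \<forall>x. q x =
     (\<Sum>\<alpha> | (\<Sum>i\<in>UNIV. \<alpha> i) \<le> k. (\<Prod>i\<in>UNIV. x $ i ^ \<alpha> i) *\<^sub>R c (\<alpha> :: 3 \<Rightarrow> nat))}"

definition poly_hom :: "nat \<Rightarrow> (real^3 \<Rightarrow> 'b::euclidean_space) set" where
  "poly_hom k = {q. \<exists>c. \<forall>x. q x =
     (\<Sum>\<alpha> | (\<Sum>i\<in>UNIV. \<alpha> i) = k. (\<Prod>i\<in>UNIV. x $ i ^ \<alpha> i) *\<^sub>R c (\<alpha> :: 3 \<Rightarrow> nat))}"

definition nedelec :: "nat \<Rightarrow> (real^3 \<Rightarrow> real^3) set" where
  "nedelec k = {\<lambda>x. a x + b x | a b. a \<in> poly_le (k - 1) \<and> b \<in> poly_hom k \<and> (\<forall>x. b x \<bullet> x = 0)}"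

text \<open>The restriction to each cell is taken in the almost-everywhere sense, so values on faces are free.\<close>

definition piecewise ::
  "(real^3) set set \<Rightarrow> (real^3 \<Rightarrow> 'b::euclidean_space) set \<Rightarrow> (real^3 \<Rightarrow> 'b) set" where
  "piecewise \<T> P = {v. \<forall>K \<in> \<T>. \<exists>q \<in> P. AE x in lebesgue_on K. v x = q x}"

definition fun_subspace :: "(real^3 \<Rightarrow> 'b::euclidean_space) set \<Rightarrow> bool" where
  "fun_subspace V \<longleftrightarrow> (\<lambda>x. 0) \<in> V \<and> (\<forall>f \<in> V. \<forall>g \<in> V. (\<lambda>x. f x + g x) \<in> V) \<and>
     (\<forall>c. \<forall>f \<in> V. (\<lambda>x. c *\<^sub>R f x) \<in> V)"

text \<open>
  The inf-sup constant \<open>\<beta>\<close> is independent of \<open>h\<close>; velocities are measured in \<open>W\<^sup>1\<^sup>,\<^sup>p\<close> and pressures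
  in the norm of the dual exponent \<open>p / (p - 1)\<close>, which is the usual \<open>H\<^sup>1\<close>--\<open>L\<^sup>2\<close> condition if \<open>p = 2\<close>.
\<close>

definition inf_sup_condition ::
  "(real^3) set \<Rightarrow> real \<Rightarrow> real set \<Rightarrow> (real \<Rightarrow> (real^3 \<Rightarrow> real^3) set) \<Rightarrow> (real \<Rightarrow> (real^3 \<Rightarrow> real) set) \<Rightarrow> bool"
  where
  "inf_sup_condition D p H X Q \<longleftrightarrow> (\<exists>\<beta>>0. \<forall>h \<in> H.
     ereal \<beta> \<le> (INF q \<in> {q \<in> Q h. Lp_norm D (p / (p - 1)) q \<noteq> 0}.
                SUP v \<in> {v \<in> X h. W1p_norm D p v \<noteq> 0}.
                  ereal (L2_inner D (weak_div D v) q / (W1p_norm D p v * Lp_norm D (p / (p - 1)) q))))"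

definition velocity_pressure_pair ::
  "(real^3) set \<Rightarrow> real \<Rightarrow> nat \<Rightarrow> real set \<Rightarrow> (real \<Rightarrow> (real^3) set set) \<Rightarrow>
   (real \<Rightarrow> (real^3 \<Rightarrow> real^3) set) \<Rightarrow> (real \<Rightarrow> (real^3 \<Rightarrow> real) set) \<Rightarrow> bool" where
  "velocity_pressure_pair D p k H \<T> X Q \<longleftrightarrow>
     (\<forall>h \<in> H. fun_subspace (X h) \<and> X h \<subseteq> W1p_0 D p \<inter> piecewise (\<T> h) (poly_le k) \<and>
              fun_subspace (Q h) \<and> Q h \<subseteq> L2_zero_mean D \<inter> piecewise (\<T> h) (poly_le k)) \<and>
     inf_sup_condition D p H X Q"

definition discretely_div_free ::
  "(real^3) set \<Rightarrow> (real^3 \<Rightarrow> real^3) set \<Rightarrow> (real^3 \<Rightarrow> real) set \<Rightarrow> (real^3 \<Rightarrow> real^3) set" where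
  "discretely_div_free D Xh Qh = {v \<in> Xh. \<forall>q \<in> Qh. L2_inner D (weak_div D v) q = 0}"

definition edge_space :: "(real^3) set \<Rightarrow> (real^3) set set \<Rightarrow> nat \<Rightarrow> (real^3 \<Rightarrow> real^3) set" where
  "edge_space D \<T> k = Hcurl D \<inter> piecewise \<T> (nedelec k)"

section \<open>The fully discrete scheme\<close>

definition a1 :: "(real^3) set \<Rightarrow> (real^3 \<Rightarrow> real^3) \<Rightarrow> (real^3 \<Rightarrow> real^3) \<Rightarrow> (real^3 \<Rightarrow> real^3) \<Rightarrow> real" where
  "a1 D u w v = 1/2 * ((LINT x|lebesgue_on D. (weak_grad D w x *v u x) \<bullet> v x)
                     - (LINT x|lebesgue_on D. (weak_grad D v x *v u x) \<bullet> w x))"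

text \<open>
  \<open>scheme_step \<dots> u' B' u B\<close>: the pair \<open>(u, B)\<close> in \<open>X0 \<times> Y\<close> solves one step of the scheme with
  previous pair \<open>(u', B')\<close>. For \<open>p = 2\<close> the convention \<open>0 powr 0 = 0\<close> is harmless because the
  factor multiplies the zero gradient.
\<close>

definition scheme_step ::
  "(real^3) set \<Rightarrow> real \<Rightarrow> real \<Rightarrow> real \<Rightarrow> real \<Rightarrow> real \<Rightarrow> real \<Rightarrow>
   (real^3 \<Rightarrow> real^3) set \<Rightarrow> (real^3 \<Rightarrow> real^3) set \<Rightarrow>
   (real^3 \<Rightarrow> real^3) \<Rightarrow> (real^3 \<Rightarrow> real^3) \<Rightarrow>
   (real^3 \<Rightarrow> real^3) \<Rightarrow> (real^3 \<Rightarrow> real^3) \<Rightarrow>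
   (real^3 \<Rightarrow> real^3) \<Rightarrow> (real^3 \<Rightarrow> real^3) \<Rightarrow> bool" where
  "scheme_step D p \<nu> \<rho> \<mu> \<sigma> dt X0 Y g f u' B' u B \<longleftrightarrow> u \<in> X0 \<and> B \<in> Y \<and>
     (\<forall>v \<in> X0. \<forall>w \<in> Y.
        L2_inner D (\<lambda>x. (1 / dt) *\<^sub>R (u x - u' x)) v
        + a1 D u' u v
        + \<nu> / \<rho> * L2_inner D (\<lambda>x. (norm (weak_grad D u x) powr (p - 2)) *\<^sub>R weak_grad D u x) (weak_grad D v)
        + 1 / (\<mu> * \<rho>) * L2_inner D (\<lambda>x. cross3 (B' x) (weak_curl D B x)) v
        = L2_inner D g v
      \<and>
        L2_inner D (\<lambda>x. (1 / dt) *\<^sub>R (B x - B' x)) w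
        + 1 / (\<mu> * \<sigma>) * L2_inner D (weak_curl D B) (weak_curl D w)
        - L2_inner D (\<lambda>x. cross3 (u x) (B' x)) (weak_curl D w)
        = L2_inner D f w)"

end

theory Submission
  imports Defs "HOL-Homology.Invariance_of_Domain"
begin

text \<open>
  Add \<open>1 / (\<mu> * \<rho>)\<close> times the induction equation to the momentum equation and test with the
  difference of two states: the convective form is skew-symmetric, the Lorentz force cancels against
  the induction term, and the \<open>p\<close>-Laplacian is monotone. So the combined residual is strongly
  monotone in \<open>L\<^sup>2\<close>, whatever the time step and the mesh are, and uniqueness follows. The discrete
  spaces are finite-dimensional up to null sets; in coordinates with respect to an
  \<open>L\<^sup>2\<close>-orthonormal basis the residual is a continuous strongly monotone map of \<open>\<real>\<^sup>n\<close>. Its image is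
  open by invariance of domain and closed because the inverse is Lipschitz, so the map is onto and
  the residual has a zero. That weak derivatives are linear up to null sets rests on their
  uniqueness, hence on the fundamental lemma of the calculus of variations.
\<close>

text \<open>Overloads the limit arrow and would make every limit below ambiguous.\<close>

no_notation exact_seq_arrow (\<open>(\<open>indent=3 notation=\<open>mixfix exact_seq\<close>\<close>_ / \<longlongrightarrow>\<index> _)\<close> [1000, 60])

section \<open>The fundamental lemma of the calculus of variations\<close>

text \<open>Two obstacles shape the proof. First, \<open>weak_grad\<close> and
  \<open>weak_curl\<close> pick a representative for each field separately, so they are not linear
  on functions, and a discrete space need not be finite-dimensional as a set of functions. Linearity
  is therefore stated for fields that equal a combination almost everywhere, and a basis spans only
  up to null sets. The weight \<open>1 / (\<mu> * \<rho>)\<close> is the coefficient of the Lorentz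
  force: with it both coupling terms carry the same factor and the cyclic triple product cancels
  them. Adding the equations loses nothing, since their test functions vary independently. The
  strong monotonicity comes from the discrete time derivative, with constant \<open>1 / dt\<close>
  for the velocity and \<open>1 / (\<mu> * \<rho>) * (1 / dt)\<close> for the magnetic field;
  viscous and resistive terms add nonnegative amounts.\<close>

lemma C_k_Suc_I:
  fixes f :: "real^3 \<Rightarrow> 'b::euclidean_space"
  assumes "\<And>x. (f has_derivative f' x) (at x)" "\<And>i. C_k n (\<lambda>x. f' x (axis i 1))"
  shows "C_k (Suc n) f"
proof -
  have "frechet_derivative f (at x) = f' x" for x
    using assms(1) by (metis frechet_derivative_at)
  moreover have "f differentiable (at x)" for x
    using assms(1) by (rule differentiableI)
  ultimately show ?thesis
    using assms(2) by simp
qed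

text \<open>Not immediate from the recursion, which speaks only of the partial derivatives of
  \<open>f\<close>; the base case is that differentiability implies continuity. The Leibniz rule in
  \<open>C_k_mult\<close> needs it, because each summand keeps one factor undifferentiated.\<close>

lemma C_k_Suc_D: "C_k (Suc n) f \<Longrightarrow> C_k n f"
proof (induction n arbitrary: f)
  case 0
  then have "\<forall>x. f differentiable (at x)" by simp
  then show ?case
    using differentiable_imp_continuous_on[of f UNIV] by (simp add: differentiable_on_def)
next
  case (Suc n)
  have "\<forall>x. f differentiable (at x)"
    and *: "C_k (Suc n) (\<lambda>x. frechet_derivative f (at x) (axis i 1))" for i
    using Suc.prems C_k.simps(2)[of "Suc n" f] by simp_all
  then show ?case
    using Suc.IH[OF *] by simp
qed

lemma C_k_has_derivative:
  "C_k (Suc n) f \<Longrightarrow> (f has_derivative frechet_derivative f (at x)) (at x)"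
  by (simp add: frechet_derivative_works)

lemma C_k_const: "C_k n (\<lambda>x. c)"
  by (induction n arbitrary: c) (auto simp: frechet_derivative_const)

lemma C_k_bounded_linear:
  assumes "bounded_linear L" "C_k n f"
  shows "C_k n (\<lambda>x. L (f x))"
  using assms(2)
proof (induction n arbitrary: f)
  case 0
  then show ?case
    using bounded_linear.continuous_on[OF assms(1)] by simp
next
  case (Suc n)
  show ?case
  proof (rule C_k_Suc_I)
    show "((\<lambda>x. L (f x)) has_derivative (\<lambda>h. L (frechet_derivative f (at x) h))) (at x)" for x
      by (rule bounded_linear.has_derivative[OF assms(1) C_k_has_derivative[OF Suc.prems]])
    show "C_k n (\<lambda>x. L (frechet_derivative f (at x) (axis i 1)))" for i
      using Suc by simp
  qed
qed

lemma C_k_add: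
  assumes "C_k n f" "C_k n g"
  shows "C_k n (\<lambda>x. f x + g x)"
  using assms
proof (induction n arbitrary: f g)
  case 0
  then show ?case by (simp add: continuous_on_add)
next
  case (Suc n)
  show ?case
  proof (rule C_k_Suc_I)
    show "((\<lambda>x. f x + g x) has_derivative
        (\<lambda>h. frechet_derivative f (at x) h + frechet_derivative g (at x) h)) (at x)" for x
      using Suc.prems by (intro has_derivative_add C_k_has_derivative)
    show "C_k n (\<lambda>x. frechet_derivative f (at x) (axis i 1) + frechet_derivative g (at x) (axis i 1))" for i
      using Suc by simp
  qed
qed

lemma C_k_mult:
  fixes f g :: "real^3 \<Rightarrow> real"
  assumes "C_k n f" "C_k n g"
  shows "C_k n (\<lambda>x. f x * g x)"
  using assms
proof (induction n arbitrary: f g)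
  case 0
  then show ?case by (simp add: continuous_on_mult)
next
  case (Suc n)
  show ?case
  proof (rule C_k_Suc_I)
    show "((\<lambda>x. f x * g x) has_derivative
        (\<lambda>h. f x * frechet_derivative g (at x) h + frechet_derivative f (at x) h * g x)) (at x)" for x
      using Suc.prems by (intro has_derivative_mult C_k_has_derivative)
    show "C_k n (\<lambda>x. f x * frechet_derivative g (at x) (axis i 1) + frechet_derivative f (at x) (axis i 1) * g x)" for i
      using Suc.prems by (intro C_k_add Suc.IH C_k_Suc_D[OF Suc.prems(1)] C_k_Suc_D[OF Suc.prems(2)]) simp_all
  qed
qed

lemma C_k_prod:
  fixes f :: "'i \<Rightarrow> real^3 \<Rightarrow> real"
  assumes "finite I" "\<And>i. i \<in> I \<Longrightarrow> C_k n (f i)"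
  shows "C_k n (\<lambda>x. \<Prod>i\<in>I. f i x)"
  using assms
proof (induction I rule: finite_induct)
  case empty
  show ?case
    by (simp only: prod.empty C_k_const)
next
  case (insert i I)
  then have "C_k n (\<lambda>x. f i x * (\<Prod>i\<in>I. f i x))"
    by (intro C_k_mult) blast+
  then show ?case
    using insert.hyps by (simp only: prod.insert not_False_eq_True)
qed

section \<open>Smooth bump functions supported in boxes\<close>

definition flat_exp :: "real poly \<Rightarrow> real \<Rightarrow> real" where
  "flat_exp q t = (if t > 0 then poly q (1 / t) * exp (- 1 / t) else 0)"

text \<open>The extra power \<open>s ^ k\<close> makes the induction work: \<open>pCons a q\<close>
  evaluates to \<open>a + s * q(s)\<close>, and the new factor \<open>s\<close> is absorbed by
  passing from \<open>k\<close> to \<open>k + 1\<close>.\<close>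

lemma poly_times_exp_minus_tendsto_0:
  fixes q :: "real poly"
  shows "((\<lambda>s. s ^ k * (poly q s * exp (- s))) \<longlongrightarrow> 0) at_top"
proof (induction q arbitrary: k)
  case 0
  then show ?case by simp
next
  case (pCons a q)
  have "((\<lambda>s. a * (s ^ k / exp s) + s ^ Suc k * (poly q s * exp (- s))) \<longlongrightarrow> a * 0 + 0) at_top"
    by (intro tendsto_add tendsto_mult tendsto_const tendsto_power_div_exp_0 pCons.IH)
  then show ?case
    by (simp add: exp_minus field_simps)
qed

text \<open>The reason for carrying a polynomial in \<open>flat_exp\<close>: differentiating
  \<open>q(1/t) * exp(-1/t)\<close> gives \<open>(1/t)^2 * (q - q')(1/t) * exp(-1/t)\<close>, again
  of the same form, so smoothness of all orders follows by induction with \<open>q\<close>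
  arbitrary.\<close>

lemma flat_exp_has_derivative:
  "(flat_exp q has_real_derivative flat_exp ([:0, 0, 1:] * (q - pderiv q)) t) (at t)"
proof -
  consider "t > 0" | "t < 0" | "t = 0" by linarith
  then show ?thesis
  proof cases
    case 1
    have "((\<lambda>t::real. 1 / t) has_real_derivative - (1 / t\<^sup>2)) (at t)"
      using 1 by (auto intro!: derivative_eq_intros simp: power2_eq_square)
    then have "((\<lambda>t. poly q (1 / t) * exp (- (1 / t))) has_real_derivative
        (poly (pderiv q) (1 / t) * - (1 / t\<^sup>2)) * exp (- (1 / t)) +
        (exp (- (1 / t)) * - (- (1 / t\<^sup>2))) * poly q (1 / t)) (at t)"
      by (intro DERIV_mult DERIV_chain2[OF poly_DERIV] DERIV_fun_exp DERIV_minus)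
    moreover have "(poly (pderiv q) (1 / t) * - (1 / t\<^sup>2)) * exp (- (1 / t)) +
        (exp (- (1 / t)) * - (- (1 / t\<^sup>2))) * poly q (1 / t) = flat_exp ([:0, 0, 1:] * (q - pderiv q)) t"
      using 1 by (simp add: flat_exp_def algebra_simps power2_eq_square)
    ultimately have "((\<lambda>t. poly q (1 / t) * exp (- 1 / t)) has_real_derivative
        flat_exp ([:0, 0, 1:] * (q - pderiv q)) t) (at t)"
      by simp
    moreover have "\<forall>\<^sub>F s in nhds t. flat_exp q s = poly q (1 / s) * exp (- 1 / s)"
      using eventually_nhds_in_open[OF open_greaterThan, of t 0] 1
      by (auto simp: flat_exp_def elim: eventually_mono)
    ultimately show ?thesis
      by (rule DERIV_cong_ev[THEN iffD2, OF refl _ refl, rotated])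
  next
    case 2
    have "((\<lambda>t. 0) has_real_derivative flat_exp ([:0, 0, 1:] * (q - pderiv q)) t) (at t)"
      using 2 by (simp add: flat_exp_def)
    moreover have "\<forall>\<^sub>F s in nhds t. flat_exp q s = 0"
      using eventually_nhds_in_open[OF open_lessThan, of t 0] 2
      by (auto simp: flat_exp_def elim: eventually_mono)
    ultimately show ?thesis
      by (rule DERIV_cong_ev[THEN iffD2, OF refl _ refl, rotated])
  next
    case 3
    have "((\<lambda>h. flat_exp q h / h) \<longlongrightarrow> 0) (at 0)"
    proof (rule filterlim_split_at)
      show "((\<lambda>h. flat_exp q h / h) \<longlongrightarrow> 0) (at_left 0)"
        by (rule tendsto_eventually) (auto simp: flat_exp_def eventually_at_left_field intro!: exI[of _ "-1"])
      \<comment> \<open>With \<open>s = 1/h\<close> the difference quotient at 0 is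
        \<open>s * q(s) * exp(-s)\<close>; dividing by \<open>h\<close> is what produces the power
        1.\<close>
      have "((\<lambda>h. (1/h) ^ 1 * (poly q (1/h) * exp (- (1/h)))) \<longlongrightarrow> 0) (at_right 0)"
        by (rule filterlim_compose[OF poly_times_exp_minus_tendsto_0])
           (auto simp: filterlim_inverse_at_top_right divide_inverse)
      then show "((\<lambda>h. flat_exp q h / h) \<longlongrightarrow> 0) (at_right 0)"
        by (rule Lim_transform_eventually)
           (auto simp: flat_exp_def eventually_at_right_field intro!: exI[of _ 1])
    qed
    then show ?thesis
      using 3 by (simp add: DERIV_def flat_exp_def)
  qed
qed

text \<open>The affine argument covers both ends of an interval at once: positive \<open>s\<close>
  for the left end, negative \<open>s\<close> for the right one.\<close>

lemma C_k_flat_exp: "C_k n (\<lambda>x. flat_exp q (s * x $ i + c))"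
proof (induction n arbitrary: q)
  case 0
  have "continuous_on UNIV (flat_exp q)"
    using flat_exp_has_derivative DERIV_isCont continuous_at_imp_continuous_on by blast
  then have "continuous_on UNIV (\<lambda>x::real^3. flat_exp q (s * x $ i + c))"
    by (rule continuous_on_compose2) (auto intro!: continuous_on_add continuous_on_mult continuous_on_const continuous_on_component continuous_on_id)
  then show ?case by simp
next
  case (Suc n)
  let ?q = "[:0, 0, 1:] * (q - pderiv q)"
  show ?case
  proof (rule C_k_Suc_I)
    have "((\<lambda>x::real^3. x $ i) has_derivative (\<lambda>h. h $ i)) (at x)" for x
      by (rule bounded_linear_imp_has_derivative[OF bounded_linear_vec_nth])
    then have "((\<lambda>x::real^3. s * x $ i + c) has_derivative (\<lambda>h. s * h $ i)) (at x)" for x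
      by (intro has_derivative_add_const has_derivative_mult_right)
    from has_derivative_compose[OF this flat_exp_has_derivative[unfolded has_field_derivative_def]]
    show "((\<lambda>x. flat_exp q (s * x $ i + c)) has_derivative
        (\<lambda>h. flat_exp ?q (s * x $ i + c) * (s * h $ i))) (at x)" for x :: "real^3" .
    show "C_k n (\<lambda>x. flat_exp ?q (s * x $ i + c) * (s * axis j 1 $ i))" for j
      by (rule C_k_mult[OF Suc.IH C_k_const])
  qed
qed

text \<open>The parameter \<open>s\<close> is a steepness. For every \<open>s > 0\<close> the
  function vanishes outside the open box and stays in [0, 1], while \<open>exp(-1/(s t))\<close>
  tends to 1 as \<open>s\<close> grows. So the indicator of the box is a bounded pointwise limit of
  smooth functions, without any mollification.\<close>

definition box_bump :: "real^3 \<Rightarrow> real^3 \<Rightarrow> real \<Rightarrow> real^3 \<Rightarrow> real" where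
  "box_bump a b s x = (\<Prod>i\<in>UNIV. flat_exp 1 (s * (x $ i - a $ i)) * flat_exp 1 (s * (b $ i - x $ i)))"

lemma flat_exp_1_bounds: "0 \<le> flat_exp 1 t" "flat_exp 1 t \<le> 1"
  by (auto simp: flat_exp_def)

lemma box_bump_bounds: "0 \<le> box_bump a b s x" "box_bump a b s x \<le> 1"
  unfolding box_bump_def
  by (simp_all add: prod_nonneg prod_le_1 mult_le_one flat_exp_1_bounds)

lemma C_k_box_bump: "C_k n (box_bump a b s)"
proof -
  have left: "C_k n (\<lambda>x. flat_exp 1 (s * (x $ i - a $ i)))" for i
    using C_k_flat_exp[of n 1 s i "- (s * a $ i)"] by (simp only: right_diff_distrib add_uminus_conv_diff)
  have right: "C_k n (\<lambda>x. flat_exp 1 (s * (b $ i - x $ i)))" for i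
    using C_k_flat_exp[of n 1 "- s" i "s * b $ i"]
    by (simp only: right_diff_distrib mult_minus_left uminus_add_conv_diff)
  show ?thesis
    unfolding box_bump_def[abs_def] by (rule C_k_prod[OF finite C_k_mult[OF left right]])
qed

lemma box_bump_eq_0:
  assumes "s > 0" "x \<notin> box a b"
  shows "box_bump a b s x = 0"
proof -
  obtain i where "x $ i \<le> a $ i \<or> b $ i \<le> x $ i"
    using assms(2) by (auto simp: mem_box_cart not_less)
  then have "s * (x $ i - a $ i) \<le> 0 \<or> s * (b $ i - x $ i) \<le> 0"
    using assms(1) by (auto simp: mult_le_0_iff)
  then have "flat_exp 1 (s * (x $ i - a $ i)) * flat_exp 1 (s * (b $ i - x $ i)) = 0"
    by (auto simp: flat_exp_def)
  then show ?thesis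
    unfolding box_bump_def by (intro prod_zero bexI[of _ i]) simp_all
qed

lemma flat_exp_1_tendsto:
  assumes "t > 0"
  shows "(\<lambda>m. flat_exp 1 (real (Suc m) * t)) \<longlonglongrightarrow> 1"
proof -
  have "(\<lambda>m. exp (- (inverse (real (Suc m)) * (1 / t)))) \<longlonglongrightarrow> exp (- (0 * (1 / t)))"
    by (intro tendsto_intros LIMSEQ_inverse_real_of_nat)
  moreover have "flat_exp 1 (real (Suc m) * t) = exp (- (inverse (real (Suc m)) * (1 / t)))" for m
  proof -
    have "0 < real (Suc m) * t"
      using assms by (intro mult_pos_pos) simp_all
    then show ?thesis
      unfolding flat_exp_def by (simp only: if_True poly_1) (simp add: divide_inverse)
  qed
  ultimately show ?thesis
    by (simp only: mult_zero_left minus_zero exp_zero)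
qed

lemma box_bump_tendsto:
  "(\<lambda>m. box_bump a b (real (Suc m)) x) \<longlonglongrightarrow> indicator (box a b) x"
proof (cases "x \<in> box a b")
  case True
  have "(\<lambda>m. \<Prod>i\<in>UNIV. flat_exp 1 (real (Suc m) * (x $ i - a $ i)) * flat_exp 1 (real (Suc m) * (b $ i - x $ i)))
      \<longlonglongrightarrow> (\<Prod>i\<in>(UNIV::3 set). 1 * 1)"
    using True by (intro tendsto_prod tendsto_mult flat_exp_1_tendsto) (auto simp: mem_box_cart)
  then show ?thesis
    using True unfolding box_bump_def by (simp only: mult_1 prod.neutral_const indicator_simps)
next
  case False
  then have "box_bump a b (real (Suc m)) x = 0" for m
    by (intro box_bump_eq_0) simp_all
  then show ?thesis
    using False tendsto_const[of 0] by (simp only: indicator_simps not_False_eq_True if_False)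
qed

lemma box_bump_test_function:
  assumes "s > 0" "box a b \<subseteq> C" "compact C" "C \<subseteq> D"
  shows "box_bump a b s \<in> test_functions D"
proof -
  have "box_bump a b s x = 0" if "x \<notin> C" for x
    using that assms(2) by (intro box_bump_eq_0 assms(1)) auto
  then have "\<exists>C. compact C \<and> C \<subseteq> D \<and> (\<forall>x. x \<notin> C \<longrightarrow> box_bump a b s x = 0)"
    using assms(3,4) by (intro exI[of _ C]) simp
  then show ?thesis
    unfolding test_functions_def using C_k_box_bump by blast
qed

lemma test_functions_scaleR:
  fixes e :: "'b::euclidean_space"
  assumes "\<phi> \<in> test_functions D"
  shows "(\<lambda>x. \<phi> x *\<^sub>R e) \<in> test_functions D"
proof -
  obtain C where C: "compact C" "C \<subseteq> D" "\<forall>x. x \<notin> C \<longrightarrow> \<phi> x = 0" and smooth: "\<And>n. C_k n \<phi>"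
    using assms unfolding test_functions_def by blast
  have "C_k n (\<lambda>x. \<phi> x *\<^sub>R e)" for n
    by (rule C_k_bounded_linear[OF bounded_linear_scaleR_left smooth])
  moreover have "\<exists>C. compact C \<and> C \<subseteq> D \<and> (\<forall>x. x \<notin> C \<longrightarrow> \<phi> x *\<^sub>R e = 0)"
    using C by (intro exI[of _ C]) simp
  ultimately show ?thesis
    unfolding test_functions_def by blast
qed

text \<open>The positive and negative parts of a Borel version of \<open>f\<close> are densities of
  two measures that agree on open boxes. These form an intersection-stable generator of the Borel
  sets, so the measures and then their densities agree, which forces both parts to vanish.\<close>

lemma AE_zero_if_box_integrals_zero:
  fixes f :: "'a::euclidean_space \<Rightarrow> real"
  assumes f: "integrable lebesgue f"
    and box: "\<And>a b. (LINT x|lebesgue. indicator (box a b) x * f x) = 0"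
  shows "AE x in lebesgue. f x = 0"
proof -
  obtain f' where f'[measurable]: "f' \<in> borel_measurable lborel" and ff': "AE x in lborel. f x = f' x"
    using completion_ex_borel_measurable_real[OF borel_measurable_integrable[OF f]] by blast
  have ff'_leb: "AE x in lebesgue. f x = f' x"
    using ff' by (rule AE_completion)
  have f'_leb[measurable]: "f' \<in> borel_measurable lebesgue"
    by (rule measurable_completion) (rule f')
  have "integrable lebesgue f'"
    using integrable_cong_AE[OF borel_measurable_integrable[OF f] f'_leb ff'_leb] f by simp
  then have int: "integrable lborel f'"
    by (simp add: integrable_completion)
  have int': "integrable lborel (\<lambda>x. indicator B x * f' x)" if "B \<in> sets borel" for B
    using integrable_mult_indicator[of B lborel f'] int that by simp
  have zero: "(LINT x|lborel. indicator (box a b) x * f' x) = 0" for a b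
  proof -
    have "(LINT x|lborel. indicator (box a b) x * f' x) = (LINT x|lebesgue. indicator (box a b) x * f' x)"
      by (rule integral_completion[symmetric]) simp
    also have "\<dots> = (LINT x|lebesgue. indicator (box a b) x * f x)"
      using ff'_leb f by (intro integral_cong_AE) (auto intro!: borel_measurable_times borel_measurable_indicator)
    finally show ?thesis using box by simp
  qed
  \<comment> \<open>Since \<open>ennreal\<close> sends negative numbers to 0, \<open>P 1\<close> has
    the positive part of \<open>f'\<close> as density and \<open>P (- 1)\<close> the negative
    part.\<close>
  define P where "P s = density lborel (\<lambda>x. ennreal (s * f' x))" for s
  have em: "emeasure (P s) B = ennreal (LINT x|lborel. max 0 (s * (indicator B x * f' x)))"
    if B[measurable]: "B \<in> sets borel" for B s
  proof -
    have "emeasure (P s) B = (\<integral>\<^sup>+ x. ennreal (max 0 (s * (indicator B x * f' x))) \<partial>lborel)"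
      unfolding P_def by (subst emeasure_density) (auto intro!: nn_integral_cong split: split_indicator simp: max_def ennreal_neg)
    also have "\<dots> = ennreal (LINT x|lborel. max 0 (s * (indicator B x * f' x)))"
      using int'[OF B] by (intro nn_integral_eq_integral integrable_max) auto
    finally show ?thesis .
  qed
  have "P 1 = P (- 1)"
  proof (rule measure_eqI_generator_eq)
    let ?E = "range (\<lambda>(a, b). box a b::'a set)"
    show "Int_stable ?E"
      by (auto simp: Int_stable_def box_Int_box)
    show "?E \<subseteq> Pow UNIV" "sets (P 1) = sigma_sets UNIV ?E" "sets (P (- 1)) = sigma_sets UNIV ?E"
      by (simp_all add: P_def borel_eq_box)
    let ?A = "\<lambda>n::nat. box (- (real n *\<^sub>R One)) (real n *\<^sub>R One) :: 'a set"
    show "range ?A \<subseteq> ?E" "(\<Union>i. ?A i) = UNIV"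
      unfolding UN_box_eq_UNIV by auto
    show "emeasure (P 1) (?A i) \<noteq> \<infinity>" for i
      by (simp add: em)
    show "emeasure (P 1) B = emeasure (P (- 1)) B" if "B \<in> ?E" for B
    proof -
      obtain a b where B: "B = box a b"
        using \<open>B \<in> ?E\<close> by auto
      let ?g = "\<lambda>x. indicator B x * f' x"
      have g: "integrable lborel ?g"
        by (rule int') (simp add: B)
      have "(LINT x|lborel. max 0 (?g x)) - (LINT x|lborel. max 0 (- ?g x))
          = (LINT x|lborel. max 0 (?g x) - max 0 (- ?g x))"
        using g by (intro Bochner_Integration.integral_diff[symmetric] integrable_max) auto
      also have "\<dots> = (LINT x|lborel. ?g x)"
        by (intro Bochner_Integration.integral_cong) auto
      also have "\<dots> = 0"
        using zero by (simp add: B)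
      finally show ?thesis
        using em[of B 1] em[of B "- 1"] by (simp add: B)
    qed
  qed
  then have "AE x in lborel. ennreal (1 * f' x) = ennreal (- 1 * f' x)"
    unfolding P_def by (intro sigma_finite_measure.density_unique[OF sigma_finite_lborel]) auto
  then have "AE x in lborel. f' x = 0"
  proof eventually_elim
    case (elim x)
    then show ?case
      by (cases "f' x \<ge> 0") (auto simp: ennreal_neg ennreal_eq_0_iff dest: sym)
  qed
  then have "AE x in lebesgue. f' x = 0"
    by (rule AE_completion)
  with ff'_leb show ?thesis
    by eventually_elim simp
qed

lemma borel_measurable_lebesgue_continuous:
  "continuous_on UNIV \<psi> \<Longrightarrow> \<psi> \<in> borel_measurable lebesgue"
  by (rule measurable_completion) (simp add: borel_measurable_continuous_onI)

text \<open>Ensures that the integrals in the definitions of weak gradient and weak curl exist, as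
  is required before splitting them over a linear combination.\<close>

lemma integrable_inner_compact_support:
  fixes f \<psi> :: "real^3 \<Rightarrow> 'b::euclidean_space"
  assumes "open D" "locally_integrable D f" "compact C" "C \<subseteq> D"
    and "continuous_on UNIV \<psi>" "\<And>x. x \<notin> C \<Longrightarrow> \<psi> x = 0"
  shows "integrable (lebesgue_on D) (\<lambda>x. f x \<bullet> \<psi> x)"
proof -
  obtain m where m: "\<And>x. x \<in> C \<Longrightarrow> norm (\<psi> x) \<le> m"
    using compact_imp_bounded[OF compact_continuous_image[OF continuous_on_subset[OF assms(5) subset_UNIV] assms(3)]]
    unfolding bounded_iff by auto
  have f: "integrable lebesgue (\<lambda>x. indicator C x *\<^sub>R f x)"
    using assms(2-4) unfolding locally_integrable_def set_integrable_def by blast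
  have [measurable]: "\<psi> \<in> borel_measurable lebesgue"
    using assms(5) by (rule borel_measurable_lebesgue_continuous)
  have "integrable lebesgue (\<lambda>x. (indicator C x *\<^sub>R f x) \<bullet> \<psi> x)"
  proof (rule Bochner_Integration.integrable_bound)
    show "integrable lebesgue (\<lambda>x. m * norm (indicator C x *\<^sub>R f x))"
      using f by (intro integrable_mult_right integrable_norm)
    show "(\<lambda>x. (indicator C x *\<^sub>R f x) \<bullet> \<psi> x) \<in> borel_measurable lebesgue"
      using f by (intro borel_measurable_inner) auto
    have "norm ((indicator C x *\<^sub>R f x) \<bullet> \<psi> x) \<le> norm (m * norm (indicator C x *\<^sub>R f x))" for x
    proof (cases "x \<in> C")
      case True
      have "\<bar>f x \<bullet> \<psi> x\<bar> \<le> norm (f x) * norm (\<psi> x)"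
        by (rule Cauchy_Schwarz_ineq2)
      also have "\<dots> \<le> norm (f x) * m"
        using m[OF True] by (intro mult_left_mono) auto
      also have "\<dots> \<le> norm (f x) * \<bar>m\<bar>"
        by (intro mult_left_mono) auto
      finally show ?thesis
        using True by (simp add: mult.commute abs_mult)
    qed simp
    then show "AE x in lebesgue. norm ((indicator C x *\<^sub>R f x) \<bullet> \<psi> x) \<le> norm (m * norm (indicator C x *\<^sub>R f x))"
      by simp
  qed
  moreover have "indicator D x *\<^sub>R (f x \<bullet> \<psi> x) = (indicator C x *\<^sub>R f x) \<bullet> \<psi> x" for x
    using assms(4,6) by (cases "x \<in> C") (auto simp: indicator_def)
  ultimately have "integrable lebesgue (\<lambda>x. indicator D x *\<^sub>R (f x \<bullet> \<psi> x))"
    by (simp only:)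
  then show ?thesis
    using assms(1) by (subst integrable_restrict_space) simp_all
qed

text \<open>Testing with box bumps and letting the steepness tend to infinity gives, by dominated
  convergence, zero integrals over boxes lying in a compact part of \<open>D\<close>. The box
  criterion then applies on each closed box inside \<open>D\<close>, and countably many such boxes
  exhaust the open set.\<close>

lemma fundamental_lemma:
  fixes f :: "real^3 \<Rightarrow> real"
  assumes "open D" "locally_integrable D f"
    and test: "\<And>\<phi>. \<phi> \<in> test_functions D \<Longrightarrow> (LINT x|lebesgue_on D. f x * \<phi> x) = 0"
  shows "AE x in lebesgue_on D. f x = 0"
proof -
  have D[measurable]: "D \<in> sets lebesgue" using assms(1) by simp
  have box0: "(LINT x|lebesgue. indicator (box u v) x * f x) = 0"
    if C: "box u v \<subseteq> C" "compact C" "C \<subseteq> D" for u v C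
  proof -
    have f: "integrable lebesgue (\<lambda>x. indicator C x *\<^sub>R f x)"
      using assms(2) C unfolding locally_integrable_def set_integrable_def by blast
    let ?b = "\<lambda>m. box_bump u v (real (Suc m))"
    have b: "?b m \<in> test_functions D" for m
      using C by (intro box_bump_test_function) auto
    have b0: "?b m x = 0" if "x \<notin> C" for m x
      using C that by (intro box_bump_eq_0) auto
    have b_meas: "?b m \<in> borel_measurable lebesgue" for m
      using C_k_box_bump[of 0] by (intro borel_measurable_lebesgue_continuous) simp
    have eq: "(LINT x|lebesgue_on D. f x * ?b m x) = (LINT x|lebesgue. (indicator C x *\<^sub>R f x) * ?b m x)" for m
    proof -
      have "(LINT x|lebesgue_on D. f x * ?b m x) = (LINT x|lebesgue. indicator D x *\<^sub>R (f x * ?b m x))"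
        by (rule integral_restrict_space) simp
      also have "\<dots> = (LINT x|lebesgue. (indicator C x *\<^sub>R f x) * ?b m x)"
        using C(3) b0 by (intro Bochner_Integration.integral_cong) (auto simp: indicator_def)
      finally show ?thesis .
    qed
    have "(\<lambda>m. LINT x|lebesgue. (indicator C x *\<^sub>R f x) * ?b m x)
        \<longlonglongrightarrow> (LINT x|lebesgue. (indicator C x *\<^sub>R f x) * indicator (box u v) x)"
    proof (rule integral_dominated_convergence)
      show "integrable lebesgue (\<lambda>x. norm (indicator C x *\<^sub>R f x))"
        using f by (rule integrable_norm)
      show "AE x in lebesgue. (\<lambda>m. (indicator C x *\<^sub>R f x) * ?b m x)
          \<longlonglongrightarrow> (indicator C x *\<^sub>R f x) * indicator (box u v) x"
        by (intro AE_I2 tendsto_mult_left box_bump_tendsto)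
      have "norm ((indicator C x *\<^sub>R f x) * ?b m x) \<le> norm (indicator C x *\<^sub>R f x)" for x m
        using box_bump_bounds[of u v "real (Suc m)" x] by (simp add: abs_mult mult_left_le)
      then show "AE x in lebesgue. norm ((indicator C x *\<^sub>R f x) * ?b m x) \<le> norm (indicator C x *\<^sub>R f x)" for m
        by blast
    qed (use borel_measurable_integrable[OF f] b_meas in
        \<open>intro borel_measurable_times borel_measurable_indicator; simp\<close>)+
    then have "(LINT x|lebesgue. (indicator C x *\<^sub>R f x) * indicator (box u v) x) = 0"
      using test[OF b] by (simp only: eq LIMSEQ_const_iff)
    moreover have "(indicator C x *\<^sub>R f x) * indicator (box u v) x = indicator (box u v) x * f x" for x
      using C(1) by (auto simp: indicator_def)
    ultimately show ?thesis by (simp only:)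
  qed
  \<comment> \<open>The box criterion wants a function integrable on the whole space, whereas
    \<open>f\<close> is only locally integrable; it is applied to \<open>f\<close> cut off to the
    open box. Boxes intersect in boxes, and the faces form a null set.\<close>
  have *: "AE x in lebesgue. x \<in> cbox a b \<longrightarrow> f x = 0" if ab: "cbox a b \<subseteq> D" for a b
  proof -
    have f: "integrable lebesgue (\<lambda>x. indicator (cbox a b) x *\<^sub>R f x)"
      using assms(2)[unfolded locally_integrable_def set_integrable_def, rule_format, of "cbox a b"] ab by simp
    have "integrable lebesgue (\<lambda>x. indicator (box a b) x *\<^sub>R (indicator (cbox a b) x *\<^sub>R f x))"
      by (rule integrable_mult_indicator[OF _ f]) simp
    moreover have "indicator (box a b) x *\<^sub>R (indicator (cbox a b) x *\<^sub>R f x) = indicator (box a b) x * f x" for x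
      using box_subset_cbox[of a b] by (auto simp: indicator_def)
    ultimately have "integrable lebesgue (\<lambda>x. indicator (box a b) x * f x)"
      by (simp only:)
    moreover have "(LINT x|lebesgue. indicator (box c d) x * (indicator (box a b) x * f x)) = 0" for c d
    proof -
      obtain u v where uv: "box c d \<inter> box a b = box u v"
        using box_Int_box by blast
      have "indicator (box c d) x * (indicator (box a b) x * f x) = indicator (box u v) x * f x" for x
        unfolding uv[symmetric] by (simp add: indicator_inter_arith)
      moreover have "box u v \<subseteq> cbox a b"
        using uv box_subset_cbox[of a b] by blast
      ultimately show ?thesis
        using box0[of u v "cbox a b"] ab by (simp only: compact_cbox)
    qed
    ultimately have "AE x in lebesgue. indicator (box a b) x * f x = 0"
      by (rule AE_zero_if_box_integrals_zero)
    moreover have "AE x in lebesgue. x \<notin> cbox a b - box a b"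
      using negligible_frontier_interval[of a b] unfolding negligible_iff_null_sets by (rule AE_not_in)
    ultimately show ?thesis
      by eventually_elim (auto simp: indicator_def split: if_splits)
  qed
  obtain \<D> where \<D>: "countable \<D>" "\<D> \<subseteq> Pow D" "\<And>X. X \<in> \<D> \<Longrightarrow> \<exists>a b. X = cbox a b" "\<Union>\<D> = D"
    using open_countable_Union_open_cbox[OF assms(1)] by metis
  have "AE x in lebesgue. \<forall>X\<in>\<D>. x \<in> X \<longrightarrow> f x = 0"
    using \<D>(2,3) * by (intro AE_ball_countable'[OF _ \<D>(1)]) blast
  then have "AE x in lebesgue. x \<in> D \<longrightarrow> f x = 0"
    by eventually_elim (use \<D>(4) in blast)
  then show ?thesis
    by (simp add: AE_restrict_space_iff)
qed

section \<open>Weak gradient and weak curl\<close>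

lemma locally_integrable_bounded_linear:
  assumes "bounded_linear L" "locally_integrable D f"
  shows "locally_integrable D (\<lambda>x. L (f x))"
  unfolding locally_integrable_def set_integrable_def
proof (intro allI impI)
  fix C assume "compact C \<and> C \<subseteq> D"
  then have "integrable lebesgue (\<lambda>x. indicator C x *\<^sub>R f x)"
    using assms(2) unfolding locally_integrable_def set_integrable_def by blast
  from integrable_bounded_linear[OF assms(1) this]
  show "integrable lebesgue (\<lambda>x. indicator C x *\<^sub>R L (f x))"
    by (simp add: linear_cmul[OF bounded_linear.linear[OF assms(1)]])
qed

lemma locally_integrable_lincomb:
  assumes "locally_integrable D f" "locally_integrable D g"
  shows "locally_integrable D (\<lambda>x. a *\<^sub>R f x + b *\<^sub>R g x)"
  unfolding locally_integrable_def
proof (intro allI impI)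
  fix C assume "compact C \<and> C \<subseteq> D"
  then have "set_integrable lebesgue C f" "set_integrable lebesgue C g"
    using assms unfolding locally_integrable_def by blast+
  then show "set_integrable lebesgue C (\<lambda>x. a *\<^sub>R f x + b *\<^sub>R g x)"
    by (intro set_integral_add set_integrable_scaleR_right) auto
qed

lemma integrable_imp_locally_integrable:
  assumes "D \<in> sets lebesgue" "integrable (lebesgue_on D) f"
  shows "locally_integrable D f"
  unfolding locally_integrable_def
proof (intro allI impI)
  fix C assume C: "compact C \<and> C \<subseteq> D"
  have "set_integrable lebesgue D f"
    using assms unfolding set_integrable_def by (subst (asm) integrable_restrict_space) simp_all
  then show "set_integrable lebesgue C f"
    by (rule set_integrable_subset) (use C in \<open>auto intro: lmeasurable_compact fmeasurableD\<close>)
qed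

lemma test_functions_derivative:
  fixes \<phi> :: "real^3 \<Rightarrow> 'b::euclidean_space"
  assumes "\<phi> \<in> test_functions D"
  shows "\<exists>C. compact C \<and> C \<subseteq> D \<and> continuous_on UNIV \<phi> \<and> (\<forall>x. x \<notin> C \<longrightarrow> \<phi> x = 0) \<and>
    (\<forall>i. continuous_on UNIV (\<lambda>x. frechet_derivative \<phi> (at x) (axis i 1))) \<and>
    (\<forall>x. x \<notin> C \<longrightarrow> frechet_derivative \<phi> (at x) = (\<lambda>h. 0))"
proof -
  obtain C where C: "compact C" "C \<subseteq> D" "\<forall>x. x \<notin> C \<longrightarrow> \<phi> x = 0" and smooth: "\<And>n. C_k n \<phi>"
    using assms unfolding test_functions_def by blast
  have "frechet_derivative \<phi> (at x) = (\<lambda>h. 0)" if "x \<notin> C" for x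
  proof -
    have "(\<phi> has_derivative (\<lambda>h. 0)) (at x)"
      by (rule has_derivative_transform_within_open[of "\<lambda>x. 0" _ _ _ "- C"])
        (use C that in \<open>auto simp: open_Compl compact_imp_closed\<close>)
    then show ?thesis
      by (rule frechet_derivative_at[symmetric])
  qed
  moreover have "continuous_on UNIV \<phi>" "\<And>i. continuous_on UNIV (\<lambda>x. frechet_derivative \<phi> (at x) (axis i 1))"
    using smooth[of 0] smooth[of 1] by simp_all
  ultimately show ?thesis
    using C by blast
qed

text \<open>The almost-everywhere form serves two purposes: with \<open>w = 0\<close>,
  \<open>u = v\<close> and coefficients 1 and -1 it gives uniqueness of weak gradients, and it later
  applies to fields that are known only up to null sets.\<close>

lemma has_weak_grad_lincomb:
  assumes "open D" "has_weak_grad D u G" "has_weak_grad D v H" "locally_integrable D w"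
    and ae: "AE x in lebesgue_on D. w x = a *\<^sub>R u x + b *\<^sub>R v x"
  shows "has_weak_grad D w (\<lambda>x. a *\<^sub>R G x + b *\<^sub>R H x)"
  unfolding has_weak_grad_def
proof (intro conjI ballI allI)
  have loc: "locally_integrable D u" "locally_integrable D v" "locally_integrable D G" "locally_integrable D H"
    using assms(2,3) unfolding has_weak_grad_def by blast+
  show "locally_integrable D w" by fact
  show "locally_integrable D (\<lambda>x. a *\<^sub>R G x + b *\<^sub>R H x)"
    using loc by (intro locally_integrable_lincomb)
  fix \<phi> :: "real^3 \<Rightarrow> real" and i j assume \<phi>: "\<phi> \<in> test_functions D"
  let ?d = "\<lambda>x. frechet_derivative \<phi> (at x) (axis j 1)"
  obtain C where C: "compact C" "C \<subseteq> D" "continuous_on UNIV \<phi>" "\<And>x. x \<notin> C \<Longrightarrow> \<phi> x = 0"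
    "\<And>j. continuous_on UNIV (\<lambda>x. frechet_derivative \<phi> (at x) (axis j 1))"
    and d0: "\<And>x. x \<notin> C \<Longrightarrow> frechet_derivative \<phi> (at x) = (\<lambda>h. 0)"
    using test_functions_derivative[OF \<phi>] by metis
  then have C6: "\<And>x. x \<notin> C \<Longrightarrow> ?d x = 0"
    by simp
  have int_vec: "integrable (lebesgue_on D) (\<lambda>x. z x $ i * ?d x)" if "locally_integrable D z" for z :: "real^3 \<Rightarrow> real^3"
    using integrable_inner_compact_support[OF assms(1) _ C(1,2,5) C6,
        OF locally_integrable_bounded_linear[OF bounded_linear_vec_nth that]] by simp
  have int_mat: "integrable (lebesgue_on D) (\<lambda>x. z x $ i $ j * \<phi> x)" if "locally_integrable D z" for z :: "real^3 \<Rightarrow> real^3^3"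
    using integrable_inner_compact_support[OF assms(1) _ C(1,2,3,4),
        OF locally_integrable_bounded_linear[OF bounded_linear_compose[OF bounded_linear_vec_nth bounded_linear_vec_nth] that]]
    by simp
  have "(LINT x|lebesgue_on D. w x $ i * ?d x) =
      (LINT x|lebesgue_on D. a * (u x $ i * ?d x) + b * (v x $ i * ?d x))"
  proof (rule integral_cong_AE)
    show "AE x in lebesgue_on D. w x $ i * ?d x = a * (u x $ i * ?d x) + b * (v x $ i * ?d x)"
      using ae by eventually_elim (simp add: algebra_simps)
  qed (use int_vec loc assms(4) in \<open>auto intro!: borel_measurable_integrable Bochner_Integration.integrable_add integrable_mult_right\<close>)
  also have "\<dots> = a * (LINT x|lebesgue_on D. u x $ i * ?d x) + b * (LINT x|lebesgue_on D. v x $ i * ?d x)"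
    using int_vec loc by simp
  also have "\<dots> = - (a * (LINT x|lebesgue_on D. G x $ i $ j * \<phi> x) + b * (LINT x|lebesgue_on D. H x $ i $ j * \<phi> x))"
    using assms(2,3) \<phi> unfolding has_weak_grad_def by simp
  also have "a * (LINT x|lebesgue_on D. G x $ i $ j * \<phi> x) + b * (LINT x|lebesgue_on D. H x $ i $ j * \<phi> x) =
      (LINT x|lebesgue_on D. a * (G x $ i $ j * \<phi> x) + b * (H x $ i $ j * \<phi> x))"
    using int_mat loc by simp
  also have "\<dots> = (LINT x|lebesgue_on D. (a *\<^sub>R G x + b *\<^sub>R H x) $ i $ j * \<phi> x)"
    by (intro Bochner_Integration.integral_cong) (auto simp: algebra_simps)
  finally show "(LINT x|lebesgue_on D. w x $ i * ?d x) = - (LINT x|lebesgue_on D. (a *\<^sub>R G x + b *\<^sub>R H x) $ i $ j * \<phi> x)" .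
qed

lemma has_weak_curl_lincomb:
  assumes "open D" "has_weak_curl D u G" "has_weak_curl D v H" "locally_integrable D w"
    and ae: "AE x in lebesgue_on D. w x = a *\<^sub>R u x + b *\<^sub>R v x"
  shows "has_weak_curl D w (\<lambda>x. a *\<^sub>R G x + b *\<^sub>R H x)"
  unfolding has_weak_curl_def
proof (intro conjI ballI)
  have loc: "locally_integrable D u" "locally_integrable D v" "locally_integrable D G" "locally_integrable D H"
    using assms(2,3) unfolding has_weak_curl_def by blast+
  show "locally_integrable D w" by fact
  show "locally_integrable D (\<lambda>x. a *\<^sub>R G x + b *\<^sub>R H x)"
    using loc by (intro locally_integrable_lincomb)
  fix \<phi> :: "real^3 \<Rightarrow> real^3" assume \<phi>: "\<phi> \<in> test_functions D"
  let ?c = "\<lambda>x. curl_of_jacobian (jacobian \<phi> (at x))"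
  obtain C where C: "compact C" "C \<subseteq> D" "continuous_on UNIV \<phi>" "\<And>x. x \<notin> C \<Longrightarrow> \<phi> x = 0"
    "\<And>i. continuous_on UNIV (\<lambda>x. frechet_derivative \<phi> (at x) (axis i 1))"
    "\<And>x. x \<notin> C \<Longrightarrow> frechet_derivative \<phi> (at x) = (\<lambda>h. 0)"
    using test_functions_derivative[OF \<phi>] by metis
  have jac: "jacobian \<phi> (at x) $ i $ j = frechet_derivative \<phi> (at x) (axis j 1) $ i" for x i j
    by (simp add: jacobian_def matrix_def)
  have "continuous_on UNIV (\<lambda>x. ?c x $ i)" for i
    unfolding curl_of_jacobian_def jac
    using exhaust_3[of i] by (elim disjE) (simp_all add: jac continuous_on_diff continuous_on_component C(5))
  then have "continuous_on UNIV (\<lambda>x. \<chi> i. ?c x $ i)"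
    by (rule continuous_on_vec_lambda)
  then have "continuous_on UNIV ?c"
    by simp
  moreover have "?c x = 0" if "x \<notin> C" for x
    unfolding curl_of_jacobian_def jac C(6)[OF that] by (simp add: vec_eq_iff forall_3)
  ultimately have int_c: "integrable (lebesgue_on D) (\<lambda>x. z x \<bullet> ?c x)" if "locally_integrable D z" for z
    using integrable_inner_compact_support[OF assms(1) that C(1,2)] by blast
  have int_\<phi>: "integrable (lebesgue_on D) (\<lambda>x. z x \<bullet> \<phi> x)" if "locally_integrable D z" for z
    using integrable_inner_compact_support[OF assms(1) that C(1-4)] .
  have "(LINT x|lebesgue_on D. w x \<bullet> ?c x) =
      (LINT x|lebesgue_on D. a * (u x \<bullet> ?c x) + b * (v x \<bullet> ?c x))"
  proof (rule integral_cong_AE)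
    show "AE x in lebesgue_on D. w x \<bullet> ?c x = a * (u x \<bullet> ?c x) + b * (v x \<bullet> ?c x)"
      using ae by eventually_elim (simp add: inner_simps)
  qed (use int_c loc assms(4) in \<open>auto intro!: borel_measurable_integrable Bochner_Integration.integrable_add integrable_mult_right\<close>)
  also have "\<dots> = a * L2_inner D u ?c + b * L2_inner D v ?c"
    unfolding L2_inner_def using int_c loc by simp
  also have "\<dots> = a * L2_inner D G \<phi> + b * L2_inner D H \<phi>"
    using assms(2,3) \<phi> unfolding has_weak_curl_def by simp
  also have "\<dots> = (LINT x|lebesgue_on D. a * (G x \<bullet> \<phi> x) + b * (H x \<bullet> \<phi> x))"
    unfolding L2_inner_def using int_\<phi> loc by simp
  also have "\<dots> = L2_inner D (\<lambda>x. a *\<^sub>R G x + b *\<^sub>R H x) \<phi>"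
    unfolding L2_inner_def by (intro Bochner_Integration.integral_cong) (auto simp: inner_simps)
  finally show "L2_inner D w ?c = L2_inner D (\<lambda>x. a *\<^sub>R G x + b *\<^sub>R H x) \<phi>"
    unfolding L2_inner_def .
qed

lemma AE_vec_zeroI:
  fixes f :: "'a \<Rightarrow> ('b::zero)^('n::finite)"
  assumes "\<And>i::'n. AE x in M. f x $ i = 0"
  shows "AE x in M. f x = 0"
  using AE_finite_allI[of UNIV "\<lambda>i x. f x $ i = 0" M] assms by (simp add: vec_eq_iff)

text \<open>The difference of two weak gradients is a weak gradient of the zero field, so each of
  its entries integrates to zero against every test function.\<close>

lemma has_weak_grad_unique:
  assumes "open D" "has_weak_grad D u G" "has_weak_grad D u H"
  shows "AE x in lebesgue_on D. G x = H x"
proof -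
  have z: "has_weak_grad D (\<lambda>x. 0) (\<lambda>x. 1 *\<^sub>R G x + (- 1) *\<^sub>R H x)"
    using assms by (intro has_weak_grad_lincomb[where u = u and v = u])
      (auto simp: locally_integrable_def set_integrable_def)
  let ?K = "\<lambda>x. 1 *\<^sub>R G x + (- 1) *\<^sub>R H x"
  have "AE x in lebesgue_on D. ?K x $ i $ j = 0" for i j
  proof (rule fundamental_lemma[OF assms(1)])
    show "locally_integrable D (\<lambda>x. ?K x $ i $ j)"
      using z unfolding has_weak_grad_def
      by (intro locally_integrable_bounded_linear[OF bounded_linear_compose[OF bounded_linear_vec_nth bounded_linear_vec_nth]]) blast
    show "(LINT x|lebesgue_on D. ?K x $ i $ j * \<phi> x) = 0" if "\<phi> \<in> test_functions D" for \<phi>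
      using z that unfolding has_weak_grad_def by fastforce
  qed
  then have "AE x in lebesgue_on D. ?K x = 0"
    by (intro AE_vec_zeroI)
  then show ?thesis
    by eventually_elim simp
qed

lemma has_weak_curl_unique:
  assumes "open D" "has_weak_curl D u G" "has_weak_curl D u H"
  shows "AE x in lebesgue_on D. G x = H x"
proof -
  have z: "has_weak_curl D (\<lambda>x. 0) (\<lambda>x. 1 *\<^sub>R G x + (- 1) *\<^sub>R H x)"
    using assms by (intro has_weak_curl_lincomb[where u = u and v = u])
      (auto simp: locally_integrable_def set_integrable_def)
  let ?K = "\<lambda>x. 1 *\<^sub>R G x + (- 1) *\<^sub>R H x"
  have "AE x in lebesgue_on D. ?K x $ i = 0" for i
  proof (rule fundamental_lemma[OF assms(1)])
    show "locally_integrable D (\<lambda>x. ?K x $ i)"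
      using z unfolding has_weak_curl_def
      by (intro locally_integrable_bounded_linear[OF bounded_linear_vec_nth]) blast
    show "(LINT x|lebesgue_on D. ?K x $ i * \<phi> x) = 0" if "\<phi> \<in> test_functions D" for \<phi>
    proof -
      \<comment> \<open>The weak curl is tested with vector fields; a scalar test function times a
        unit vector isolates one component for the scalar fundamental lemma.\<close>
      have "L2_inner D ?K (\<lambda>x. \<phi> x *\<^sub>R axis i 1) = 0"
        using z test_functions_scaleR[OF that, of "axis i 1 :: real^3"]
        unfolding has_weak_curl_def by (fastforce simp: L2_inner_def)
      then show ?thesis
        by (simp add: L2_inner_def inner_axis mult.commute)
    qed
  qed
  then have "AE x in lebesgue_on D. ?K x = 0"
    by (intro AE_vec_zeroI)
  then show ?thesis
    by eventually_elim simp
qed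

lemma has_weak_grad_weak_grad: "has_weak_grad D u G \<Longrightarrow> has_weak_grad D u (weak_grad D u)"
  unfolding weak_grad_def by (rule someI[where P = "has_weak_grad D u"])

lemma has_weak_curl_weak_curl: "has_weak_curl D u C \<Longrightarrow> has_weak_curl D u (weak_curl D u)"
  unfolding weak_curl_def by (rule someI[where P = "has_weak_curl D u"])

text \<open>The choice in \<open>weak_grad\<close> is made for each field on its own, so linearity
  is a consequence of uniqueness: both sides are weak gradients of \<open>w\<close>.\<close>

lemma weak_grad_lincomb:
  assumes "open D" "has_weak_grad D u G" "has_weak_grad D v H" "has_weak_grad D w K"
    and "AE x in lebesgue_on D. w x = a *\<^sub>R u x + b *\<^sub>R v x"
  shows "AE x in lebesgue_on D. weak_grad D w x = a *\<^sub>R weak_grad D u x + b *\<^sub>R weak_grad D v x"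
proof (rule has_weak_grad_unique[OF assms(1)])
  show "has_weak_grad D w (weak_grad D w)"
    using assms(4) by (rule has_weak_grad_weak_grad)
  have "locally_integrable D w"
    using assms(4) unfolding has_weak_grad_def by blast
  then show "has_weak_grad D w (\<lambda>x. a *\<^sub>R weak_grad D u x + b *\<^sub>R weak_grad D v x)"
    using has_weak_grad_lincomb[OF assms(1) has_weak_grad_weak_grad has_weak_grad_weak_grad]
      assms(2,3,5) by blast
qed

lemma weak_curl_lincomb:
  assumes "open D" "has_weak_curl D u G" "has_weak_curl D v H" "has_weak_curl D w K"
    and "AE x in lebesgue_on D. w x = a *\<^sub>R u x + b *\<^sub>R v x"
  shows "AE x in lebesgue_on D. weak_curl D w x = a *\<^sub>R weak_curl D u x + b *\<^sub>R weak_curl D v x"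
proof (rule has_weak_curl_unique[OF assms(1)])
  show "has_weak_curl D w (weak_curl D w)"
    using assms(4) by (rule has_weak_curl_weak_curl)
  have "locally_integrable D w"
    using assms(4) unfolding has_weak_curl_def by blast
  then show "has_weak_curl D w (\<lambda>x. a *\<^sub>R weak_curl D u x + b *\<^sub>R weak_curl D v x)"
    using has_weak_curl_lincomb[OF assms(1) has_weak_curl_weak_curl has_weak_curl_weak_curl]
      assms(2,3,5) by blast
qed

section \<open>Strongly monotone equations in finite-dimensional spaces\<close>

lemma tendsto_fun_iff:
  fixes x :: "nat \<Rightarrow> 'i \<Rightarrow> 'b::topological_space"
  shows "x \<longlonglongrightarrow> l \<longleftrightarrow> (\<forall>i. (\<lambda>k. x k i) \<longlonglongrightarrow> l i)"
proof -
  have "x \<longlonglongrightarrow> l \<longleftrightarrow> limitin (product_topology (\<lambda>i. euclidean) UNIV) x l sequentially"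
    by (simp add: euclidean_product_topology)
  then show ?thesis
    by (simp add: limitin_componentwise)
qed

text \<open>Stated on sequences because the dimension \<open>n\<close> is a number produced inside
  the proof, not a type. The space \<open>Euclidean_space n\<close> consists of the sequences
  vanishing from index \<open>n\<close> on, here \<open>S\<close>; truncating \<open>F\<close> to
  \<open>f\<close> makes it a map of \<open>S\<close> into itself.\<close>

lemma strongly_monotone_surjective:
  fixes F :: "(nat \<Rightarrow> real) \<Rightarrow> nat \<Rightarrow> real"
  assumes cont: "\<And>i. i < n \<Longrightarrow> continuous_on UNIV (\<lambda>x. F x i)"
    and "c > 0"
    and mono: "\<And>x y. c * (\<Sum>i<n. (x i - y i)\<^sup>2) \<le> (\<Sum>i<n. (F x i - F y i) * (x i - y i))"
  shows "\<exists>x. \<forall>i<n. F x i = b i"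
proof -
  define E where "E = Euclidean_space n"
  define S where "S = {x::nat \<Rightarrow> real. \<forall>i\<ge>n. x i = 0}"
  have topE: "topspace E = S"
    by (simp add: E_def S_def topspace_Euclidean_space)
  define f where "f x = (\<lambda>i. if i < n then F x i else 0)" for x
  have f_cont: "continuous_on UNIV f"
  proof (rule continuous_on_coordinatewise_then_product)
    show "continuous_on UNIV (\<lambda>x. f x i)" for i
      using cont by (cases "i < n") (simp_all add: f_def)
  qed
  have fS: "f x \<in> S" for x
    by (simp add: f_def S_def)
  have bound: "c\<^sup>2 * (\<Sum>i<n. (x i - y i)\<^sup>2) \<le> (\<Sum>i<n. (F x i - F y i)\<^sup>2)" for x y
  proof -
    \<comment> \<open>Expanding this square and inserting \<open>mono\<close> into the mixed term
      shows that \<open>F\<close> expands distances by at least the factor \<open>c\<close>, with no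
      appeal to Cauchy-Schwarz.\<close>
    have "0 \<le> (\<Sum>i<n. ((F x i - F y i) - c * (x i - y i))\<^sup>2)"
      by (intro sum_nonneg) simp
    also have "\<dots> = (\<Sum>i<n. (F x i - F y i)\<^sup>2 - 2 * c * ((F x i - F y i) * (x i - y i)) + c\<^sup>2 * (x i - y i)\<^sup>2)"
      by (intro sum.cong) (auto simp: power2_eq_square algebra_simps)
    also have "\<dots> = (\<Sum>i<n. (F x i - F y i)\<^sup>2) - 2 * c * (\<Sum>i<n. (F x i - F y i) * (x i - y i))
        + c\<^sup>2 * (\<Sum>i<n. (x i - y i)\<^sup>2)"
      by (simp only: sum.distrib sum_subtractf sum_distrib_left)
    also have "2 * c * (\<Sum>i<n. (F x i - F y i) * (x i - y i)) \<ge> 2 * c * (c * (\<Sum>i<n. (x i - y i)\<^sup>2))"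
      using mono[of x y] \<open>c > 0\<close> by (intro mult_left_mono) auto
    ultimately show ?thesis
      by (simp add: power2_eq_square algebra_simps)
  qed
  have inj: "inj_on f S"
  proof (rule inj_onI)
    fix x y assume xy: "x \<in> S" "y \<in> S" "f x = f y"
    have "F x i = F y i" if "i < n" for i
      using fun_cong[OF xy(3), of i] that by (simp add: f_def)
    then have "c\<^sup>2 * (\<Sum>i<n. (x i - y i)\<^sup>2) \<le> 0"
      using bound[of x y] by simp
    then have "(\<Sum>i<n. (x i - y i)\<^sup>2) = 0"
      using \<open>c > 0\<close> by (simp add: mult_le_0_iff sum_nonneg antisym)
    then have "\<forall>i<n. x i = y i"
      by (subst (asm) sum_nonneg_eq_0_iff) auto
    then show "x = y"
      using xy(1,2) by (intro ext) (metis (mono_tags, lifting) S_def mem_Collect_eq not_less)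
  qed
  have "openin E (f ` S)"
    unfolding E_def
  proof (rule invariance_of_domain_Euclidean_space)
    show "openin (Euclidean_space n) S"
      using topE openin_topspace[of E] by (simp add: E_def)
    show "continuous_map (subtopology (Euclidean_space n) S) (Euclidean_space n) f"
      unfolding cm_Euclidean_space_iff_continuous_on
      using f_cont fS topE by (auto simp: E_def intro: continuous_on_subset)
  qed (rule inj)
  moreover have "closedin E (f ` S)"
    unfolding E_def closedin_Euclidean_space_iff
  proof
    show "f ` S \<subseteq> topspace (Euclidean_space n)"
      using fS topE by (auto simp: E_def)
    show "closed (f ` S)"
      unfolding closed_sequential_limits
    proof (intro allI impI)
      fix y l assume *: "(\<forall>k. y k \<in> f ` S) \<and> y \<longlonglongrightarrow> l"
      then have "\<forall>k. \<exists>x. x \<in> S \<and> y k = f x"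
        by blast
      then obtain x where x: "\<And>k. x k \<in> S" "\<And>k. y k = f (x k)"
        unfolding choice_iff by blast
      have lim: "(\<lambda>k. F (x k) i) \<longlonglongrightarrow> l i" if "i < n" for i
        using * that unfolding tendsto_fun_iff[of y] by (auto simp: x(2) f_def dest: spec[of _ i])
      have l0: "l i = 0" if "i \<ge> n" for i
      proof -
        have "(\<lambda>k. f (x k) i) \<longlonglongrightarrow> l i"
          using * unfolding tendsto_fun_iff[of y] by (simp add: x(2))
        then show ?thesis
          using that by (simp add: f_def LIMSEQ_const_iff)
      qed
      have "Cauchy (\<lambda>k. x k j)" if j: "j < n" for j
      proof (rule CauchyI)
        fix e :: real assume "e > 0"
        \<comment> \<open>Chosen so that \<open>n\<close> squares of size at most
          \<open>d\<^sup>2\<close> sum to strictly less than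
          \<open>(n + 1)\<^sup>2 * d\<^sup>2 = c\<^sup>2 * e\<^sup>2\<close>; the added 1 makes the
          inequality strict.\<close>
        define d where "d = c * e / (real n + 1)"
        have "d > 0" using \<open>e > 0\<close> \<open>c > 0\<close> by (simp add: d_def)
        have "\<exists>M. \<forall>m\<ge>M. \<forall>k\<ge>M. norm (F (x m) i - F (x k) i) < d" if "i < n" for i
          using CauchyD[OF LIMSEQ_imp_Cauchy[OF lim[OF that]] \<open>d > 0\<close>] .
        then obtain M where M: "\<And>i m k. i < n \<Longrightarrow> m \<ge> M i \<Longrightarrow> k \<ge> M i \<Longrightarrow> norm (F (x m) i - F (x k) i) < d"
          by metis
        show "\<exists>N. \<forall>m\<ge>N. \<forall>k\<ge>N. norm (x m j - x k j) < e"
        proof (intro exI[of _ "\<Sum>i<n. M i"] allI impI)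
          fix m k assume mk: "m \<ge> (\<Sum>i<n. M i)" "k \<ge> (\<Sum>i<n. M i)"
          have M_le: "M i \<le> (\<Sum>i<n. M i)" if "i < n" for i
            using that by (intro member_le_sum) auto
          have "(F (x m) i - F (x k) i)\<^sup>2 \<le> d\<^sup>2" if "i < n" for i
            using M[OF that, of m k] M_le[OF that] mk by (intro power2_le_iff_abs_le[THEN iffD2]) (use \<open>d > 0\<close> in auto)
          then have "(\<Sum>i<n. (F (x m) i - F (x k) i)\<^sup>2) \<le> (\<Sum>i<n. d\<^sup>2)"
            by (intro sum_mono) auto
          also have "\<dots> = real n * d\<^sup>2"
            by simp
          also have "\<dots> < (real n + 1)\<^sup>2 * d\<^sup>2"
            using \<open>d > 0\<close> by (intro mult_strict_right_mono) (auto simp: power2_eq_square algebra_simps add_strict_increasing)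
          also have "\<dots> = c\<^sup>2 * e\<^sup>2"
            by (simp add: d_def power_mult_distrib power_divide)
          finally have "c\<^sup>2 * (\<Sum>i<n. (x m i - x k i)\<^sup>2) < c\<^sup>2 * e\<^sup>2"
            using bound[of "x m" "x k"] by simp
          then have "(\<Sum>i<n. (x m i - x k i)\<^sup>2) < e\<^sup>2"
            using \<open>c > 0\<close> by simp
          moreover have "(x m j - x k j)\<^sup>2 \<le> (\<Sum>i<n. (x m i - x k i)\<^sup>2)"
            using j by (intro member_le_sum[of j "{..<n}" "\<lambda>i. (x m i - x k i)\<^sup>2"]) auto
          ultimately show "norm (x m j - x k j) < e"
            using \<open>e > 0\<close> by (simp add: abs_square_less_1 power2_less_imp_less[of "\<bar>x m j - x k j\<bar>" e])
        qed
      qed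
      then have "\<exists>z. (\<lambda>k. x k j) \<longlonglongrightarrow> z" if "j < n" for j
        using that by (simp add: Cauchy_convergent_iff convergent_def)
      then obtain z where z: "\<And>j. j < n \<Longrightarrow> (\<lambda>k. x k j) \<longlonglongrightarrow> z j"
        by metis
      define z' where "z' = (\<lambda>i. if i < n then z i else 0)"
      have "(\<lambda>k. x k j) \<longlonglongrightarrow> z' j" for j
        using z x(1) by (cases "j < n") (auto simp: z'_def S_def)
      then have "x \<longlonglongrightarrow> z'"
        by (simp add: tendsto_fun_iff)
      then have "(\<lambda>k. f (x k)) \<longlonglongrightarrow> f z'"
        using f_cont by (simp add: continuous_on_eq_continuous_within isCont_tendsto_compose)
      then have "l = f z'"
        using * x(2) LIMSEQ_unique by (metis (no_types, lifting) ext)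
      moreover have "z' \<in> S"
        by (simp add: z'_def S_def)
      ultimately show "l \<in> f ` S" by blast
    qed
  qed
  ultimately have "f ` S = {} \<or> f ` S = topspace E"
    using connected_Euclidean_space[of n] unfolding E_def connected_space_clopen_in by blast
  moreover have "S \<noteq> {}"
    by (auto simp: S_def)
  ultimately have "f ` S = S"
    by (simp add: topE)
  moreover have "(\<lambda>i. if i < n then b i else 0) \<in> S"
    by (simp add: S_def)
  ultimately obtain x where "f x = (\<lambda>i. if i < n then b i else 0)"
    by (metis (no_types, lifting) imageE)
  then have "F x i = b i" if "i < n" for i
    using that by (metis f_def)
  then show ?thesis by blast
qed

section \<open>Lebesgue spaces and Galerkin approximation\<close>

lemma Lp_2_iff:
  "f \<in> Lp D 2 \<longleftrightarrow> f \<in> borel_measurable (lebesgue_on D) \<and> integrable (lebesgue_on D) (\<lambda>x. (norm (f x))\<^sup>2)"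
  by (simp add: Lp_def)

lemma L2_inner_commute: "L2_inner D f g = L2_inner D g f"
  by (simp add: L2_inner_def inner_commute)

lemma integrable_L2_inner:
  assumes "f \<in> Lp D 2" "g \<in> Lp D 2"
  shows "integrable (lebesgue_on D) (\<lambda>x. f x \<bullet> g x)"
proof (rule Bochner_Integration.integrable_bound)
  show "integrable (lebesgue_on D) (\<lambda>x. (norm (f x))\<^sup>2 + (norm (g x))\<^sup>2)"
    using assms by (simp add: Lp_2_iff)
  show "(\<lambda>x. f x \<bullet> g x) \<in> borel_measurable (lebesgue_on D)"
    using assms by (intro borel_measurable_inner) (simp_all add: Lp_2_iff)
  have "norm (f x \<bullet> g x) \<le> norm ((norm (f x))\<^sup>2 + (norm (g x))\<^sup>2)" for x
  proof -
    have "\<bar>f x \<bullet> g x\<bar> \<le> norm (f x) * norm (g x)"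
      by (rule Cauchy_Schwarz_ineq2)
    also have "\<dots> \<le> 2 * norm (f x) * norm (g x)"
      by simp
    also have "\<dots> \<le> (norm (f x))\<^sup>2 + (norm (g x))\<^sup>2"
      by (rule sum_squares_bound)
    finally show ?thesis by simp
  qed
  then show "AE x in lebesgue_on D. norm (f x \<bullet> g x) \<le> norm ((norm (f x))\<^sup>2 + (norm (g x))\<^sup>2)"
    by simp
qed

text \<open>From \<open>s + t <= max (2 s) (2 t)\<close> follows
  \<open>(s + t)^p <= (2 s)^p + (2 t)^p\<close>, a crude substitute for Minkowski's inequality that
  is enough for membership.\<close>

lemma Lp_lincomb:
  fixes f g :: "real^3 \<Rightarrow> 'b::euclidean_space"
  assumes "p > 0" "f \<in> Lp D p" "g \<in> Lp D p"
  shows "(\<lambda>x. a *\<^sub>R f x + b *\<^sub>R g x) \<in> Lp D p"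
  unfolding Lp_def mem_Collect_eq
proof
  show meas: "(\<lambda>x. a *\<^sub>R f x + b *\<^sub>R g x) \<in> borel_measurable (lebesgue_on D)"
    using assms by (intro borel_measurable_add borel_measurable_scaleR) (simp_all add: Lp_def)
  let ?h = "\<lambda>x. (2 * \<bar>a\<bar>) powr p * norm (f x) powr p + (2 * \<bar>b\<bar>) powr p * norm (g x) powr p"
  have bound: "norm (a *\<^sub>R f x + b *\<^sub>R g x) powr p \<le> ?h x" for x
  proof -
    have "norm (a *\<^sub>R f x + b *\<^sub>R g x) \<le> \<bar>a\<bar> * norm (f x) + \<bar>b\<bar> * norm (g x)"
      using norm_triangle_ineq[of "a *\<^sub>R f x" "b *\<^sub>R g x"] by simp
    also have "\<dots> \<le> max (2 * \<bar>a\<bar> * norm (f x)) (2 * \<bar>b\<bar> * norm (g x))"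
      by linarith
    finally have "norm (a *\<^sub>R f x + b *\<^sub>R g x) powr p \<le> max (2 * \<bar>a\<bar> * norm (f x)) (2 * \<bar>b\<bar> * norm (g x)) powr p"
      using assms(1) by (intro powr_mono2) auto
    also have "\<dots> \<le> (2 * \<bar>a\<bar> * norm (f x)) powr p + (2 * \<bar>b\<bar> * norm (g x)) powr p"
      by (simp add: max_def)
    also have "\<dots> = ?h x"
      by (simp add: powr_mult)
    finally show ?thesis .
  qed
  show "integrable (lebesgue_on D) (\<lambda>x. norm (a *\<^sub>R f x + b *\<^sub>R g x) powr p)"
  proof (rule Bochner_Integration.integrable_bound)
    show "integrable (lebesgue_on D) ?h"
      using assms by (intro Bochner_Integration.integrable_add integrable_mult_right) (simp_all add: Lp_def)
    show "(\<lambda>x. norm (a *\<^sub>R f x + b *\<^sub>R g x) powr p) \<in> borel_measurable (lebesgue_on D)"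
      using meas by measurable
    show "AE x in lebesgue_on D. norm (norm (a *\<^sub>R f x + b *\<^sub>R g x) powr p) \<le> norm (?h x)"
      using bound by (intro AE_I2) (simp add: order_trans[OF _ abs_ge_self])
  qed
qed

lemma Lp_zero: "(\<lambda>x. 0) \<in> Lp D p"
  by (simp add: Lp_def)

lemma Lp_sum:
  assumes "p > 0" "\<And>i. i \<in> I \<Longrightarrow> e i \<in> Lp D p"
  shows "(\<lambda>x. \<Sum>i\<in>I. c i *\<^sub>R e i x) \<in> Lp D p"
  using assms(2)
proof (induction I rule: infinite_finite_induct)
  case (insert i I)
  then have "(\<lambda>x. c i *\<^sub>R e i x + 1 *\<^sub>R (\<Sum>i\<in>I. c i *\<^sub>R e i x)) \<in> Lp D p"
    by (intro Lp_lincomb[OF assms(1)]) auto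
  then show ?case using insert.hyps by simp
qed (simp_all add: Lp_zero)

text \<open>Rests on the completeness of Lebesgue measure, reached from \<open>D\<close> by
  extending both functions by zero.\<close>

lemma borel_measurable_lebesgue_on_cong_AE:
  fixes f g :: "'a::euclidean_space \<Rightarrow> 'b::euclidean_space"
  assumes "D \<in> sets lebesgue" "f \<in> borel_measurable (lebesgue_on D)" "AE x in lebesgue_on D. f x = g x"
  shows "g \<in> borel_measurable (lebesgue_on D)"
proof -
  have "(\<lambda>x. if x \<in> D then f x else 0) \<in> borel_measurable lebesgue"
    using assms(1,2) by (simp add: borel_measurable_if)
  moreover have "AE x in lebesgue. (if x \<in> D then f x else 0) = (if x \<in> D then g x else 0)"
    using assms(1,3) by (auto simp: AE_restrict_space_iff elim: eventually_mono)
  ultimately have "(\<lambda>x. if x \<in> D then g x else 0) \<in> borel_measurable lebesgue"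
    by (rule borel_measurable_AE)
  then show ?thesis
    using assms(1) by (simp add: borel_measurable_if)
qed

lemma Lp_cong_AE:
  assumes "D \<in> sets lebesgue" "f \<in> Lp D p" "AE x in lebesgue_on D. f x = g x"
  shows "g \<in> Lp D p"
proof -
  have f: "f \<in> borel_measurable (lebesgue_on D)" "integrable (lebesgue_on D) (\<lambda>x. norm (f x) powr p)"
    using assms(2) by (simp_all add: Lp_def)
  have g: "g \<in> borel_measurable (lebesgue_on D)"
    using assms(1) f(1) assms(3) by (rule borel_measurable_lebesgue_on_cong_AE)
  moreover have "integrable (lebesgue_on D) (\<lambda>x. norm (g x) powr p)"
  proof (rule integrable_cong_AE_imp[OF f(2)])
    show "(\<lambda>x. norm (g x) powr p) \<in> borel_measurable (lebesgue_on D)"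
      using g by measurable
    show "AE x in lebesgue_on D. norm (f x) powr p = norm (g x) powr p"
      using assms(3) by eventually_elim simp
  qed
  ultimately show ?thesis
    by (simp add: Lp_def)
qed

lemma L2_inner_cong_AE:
  assumes "f \<in> Lp D 2" "f' \<in> Lp D 2" "g \<in> Lp D 2" "g' \<in> Lp D 2"
    and "AE x in lebesgue_on D. f x = f' x" "AE x in lebesgue_on D. g x = g' x"
  shows "L2_inner D f g = L2_inner D f' g'"
  unfolding L2_inner_def
proof (rule integral_cong_AE)
  show "AE x in lebesgue_on D. f x \<bullet> g x = f' x \<bullet> g' x"
    using assms(5,6) by eventually_elim simp
qed (use assms in \<open>auto intro: borel_measurable_integrable integrable_L2_inner\<close>)

lemma L2_inner_lincomb_left:
  assumes "f \<in> Lp D 2" "g \<in> Lp D 2" "h \<in> Lp D 2"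
  shows "L2_inner D (\<lambda>x. a *\<^sub>R f x + b *\<^sub>R g x) h = a * L2_inner D f h + b * L2_inner D g h"
proof -
  have "L2_inner D (\<lambda>x. a *\<^sub>R f x + b *\<^sub>R g x) h = (LINT x|lebesgue_on D. a * (f x \<bullet> h x) + b * (g x \<bullet> h x))"
    unfolding L2_inner_def by (simp add: inner_add_left)
  then show ?thesis
    using integrable_L2_inner[OF assms(1,3)] integrable_L2_inner[OF assms(2,3)]
    by (simp add: L2_inner_def)
qed

lemma L2_inner_lincomb_right:
  assumes "f \<in> Lp D 2" "g \<in> Lp D 2" "h \<in> Lp D 2"
  shows "L2_inner D h (\<lambda>x. a *\<^sub>R f x + b *\<^sub>R g x) = a * L2_inner D h f + b * L2_inner D h g"
  using L2_inner_lincomb_left[OF assms] by (simp add: L2_inner_commute[of D h])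

lemma L2_inner_AE_lincomb_left:
  assumes "f \<in> Lp D 2" "g \<in> Lp D 2" "k \<in> Lp D 2" "h \<in> Lp D 2"
    and "AE x in lebesgue_on D. k x = a *\<^sub>R f x + b *\<^sub>R g x"
  shows "L2_inner D k h = a * L2_inner D f h + b * L2_inner D g h"
  using L2_inner_cong_AE[OF assms(3) Lp_lincomb[OF _ assms(1,2)] assms(4,4,5)] L2_inner_lincomb_left[OF assms(1,2,4)]
  by simp

lemma L2_inner_AE_lincomb_right:
  assumes "f \<in> Lp D 2" "g \<in> Lp D 2" "k \<in> Lp D 2" "h \<in> Lp D 2"
    and "AE x in lebesgue_on D. k x = a *\<^sub>R f x + b *\<^sub>R g x"
  shows "L2_inner D h k = a * L2_inner D h f + b * L2_inner D h g"
  using L2_inner_AE_lincomb_left[OF assms] by (simp add: L2_inner_commute[of D h])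

lemma L2_inner_zero [simp]: "L2_inner D (\<lambda>x. 0) g = 0" "L2_inner D f (\<lambda>x. 0) = 0"
  by (simp_all add: L2_inner_def)

lemma L2_inner_sum_left:
  assumes "\<And>i. i \<in> I \<Longrightarrow> e i \<in> Lp D 2" "h \<in> Lp D 2"
  shows "L2_inner D (\<lambda>x. \<Sum>i\<in>I. c i *\<^sub>R e i x) h = (\<Sum>i\<in>I. c i * L2_inner D (e i) h)"
  using assms(1)
proof (induction I rule: infinite_finite_induct)
  case (insert i I)
  have "L2_inner D (\<lambda>x. c i *\<^sub>R e i x + 1 *\<^sub>R (\<Sum>i\<in>I. c i *\<^sub>R e i x)) h
      = c i * L2_inner D (e i) h + 1 * L2_inner D (\<lambda>x. \<Sum>i\<in>I. c i *\<^sub>R e i x) h"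
    using insert.prems assms(2) by (intro L2_inner_lincomb_left Lp_sum) auto
  then show ?case using insert by simp
qed simp_all

lemma L2_inner_self_nonneg: "0 \<le> L2_inner D f f"
  unfolding L2_inner_def by (rule Bochner_Integration.integral_nonneg) simp

lemma L2_inner_self_eq_0:
  assumes "f \<in> Lp D 2" "L2_inner D f f = 0"
  shows "AE x in lebesgue_on D. f x = 0"
proof -
  have "AE x in lebesgue_on D. f x \<bullet> f x = 0"
    using assms(2) integral_nonneg_eq_0_iff_AE[OF integrable_L2_inner[OF assms(1) assms(1)]]
    by (simp add: L2_inner_def)
  then show ?thesis by eventually_elim simp
qed

section \<open>Function subspaces, orthonormal bases up to null sets, and Galerkin's method\<close>

lemma fun_subspace_lincomb:
  assumes "fun_subspace V" "f \<in> V" "g \<in> V"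
  shows "(\<lambda>x. a *\<^sub>R f x + b *\<^sub>R g x) \<in> V"
proof -
  have f: "(\<lambda>x. a *\<^sub>R f x) \<in> V" and g: "(\<lambda>x. b *\<^sub>R g x) \<in> V"
    using assms unfolding fun_subspace_def by blast+
  have "\<forall>f\<in>V. \<forall>g\<in>V. (\<lambda>x. f x + g x) \<in> V"
    using assms(1) unfolding fun_subspace_def by blast
  from bspec[OF bspec[OF this f] g] show ?thesis .
qed

lemma fun_subspaceI:
  assumes "(\<lambda>x. 0) \<in> V" "\<And>a b f g. f \<in> V \<Longrightarrow> g \<in> V \<Longrightarrow> (\<lambda>x. a *\<^sub>R f x + b *\<^sub>R g x) \<in> V"
  shows "fun_subspace V"
  unfolding fun_subspace_def
proof (intro conjI ballI allI)
  show "(\<lambda>x. f x + g x) \<in> V" if "f \<in> V" "g \<in> V" for f g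
    using assms(2)[OF that, of 1 1] by simp
  show "(\<lambda>x. c *\<^sub>R f x) \<in> V" if "f \<in> V" for f c
    using assms(2)[OF that that, of c 0] by simp
qed (rule assms(1))

lemma fun_subspace_sum:
  assumes "fun_subspace V" "\<And>i. i \<in> I \<Longrightarrow> e i \<in> V"
  shows "(\<lambda>x. \<Sum>i\<in>I. c i *\<^sub>R e i x) \<in> V"
  using assms(2)
proof (induction I rule: infinite_finite_induct)
  case (insert i I)
  then have "(\<lambda>x. c i *\<^sub>R e i x + 1 *\<^sub>R (\<Sum>i\<in>I. c i *\<^sub>R e i x)) \<in> V"
    by (intro fun_subspace_lincomb assms(1)) auto
  then show ?case using insert.hyps by simp
qed (use assms(1) in \<open>simp_all add: fun_subspace_def\<close>)

text \<open>A subspace may contain every modification of its elements on null sets and then has no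
  finite basis in the literal sense. This is the form of finite dimension that remains.\<close>

definition ae_spanned ::
  "(real^3) set \<Rightarrow> (real^3 \<Rightarrow> 'b::euclidean_space) set \<Rightarrow> 'i set \<Rightarrow> ('i \<Rightarrow> real^3 \<Rightarrow> 'b) \<Rightarrow> bool" where
  "ae_spanned D V I e \<longleftrightarrow> (\<forall>v\<in>V. \<exists>c. AE x in lebesgue_on D. v x = (\<Sum>i\<in>I. c i *\<^sub>R e i x))"

text \<open>
  The spanning functions \<open>e i\<close> need not lie in \<open>V\<close>, nor even be measurable; the proof by
  Gram--Schmidt removes them one at a time, with \<open>V'\<close> the part of \<open>V\<close> that does not need \<open>e j\<close>.
\<close>

lemma ex_orthonormal_basis:
  fixes V :: "(real^3 \<Rightarrow> 'b::euclidean_space) set"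
  assumes "finite I" "fun_subspace V" "V \<subseteq> Lp D 2" "ae_spanned D V I e"
  shows "\<exists>n b. (\<forall>i<n. b i \<in> V) \<and> (\<forall>i<n. \<forall>j<n. L2_inner D (b i) (b j) = (if i = j then 1 else 0)) \<and>
    ae_spanned D V {..<n::nat} b"
  using assms
proof (induction I arbitrary: V rule: finite_induct)
  case empty
  then show ?case
    by (intro exI[of _ 0] exI[of _ "\<lambda>_. undefined"]) (simp add: ae_spanned_def)
next
  case (insert j I)
  note V = \<open>fun_subspace V\<close> \<open>V \<subseteq> Lp D 2\<close>
  define V' where "V' = {v \<in> V. \<exists>c. AE x in lebesgue_on D. v x = (\<Sum>i\<in>I. c i *\<^sub>R e i x)}"
  have sub': "fun_subspace V'"
  proof (rule fun_subspaceI)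
    show "(\<lambda>x. 0) \<in> V'"
      using V(1) by (auto simp: V'_def fun_subspace_def intro!: exI[of _ "\<lambda>_. 0"])
    fix a b :: real and f g assume "f \<in> V'" "g \<in> V'"
    then obtain c d where fg: "f \<in> V" "g \<in> V"
      and c: "AE x in lebesgue_on D. f x = (\<Sum>i\<in>I. c i *\<^sub>R e i x)"
      and d: "AE x in lebesgue_on D. g x = (\<Sum>i\<in>I. d i *\<^sub>R e i x)"
      unfolding V'_def by blast
    have "AE x in lebesgue_on D. a *\<^sub>R f x + b *\<^sub>R g x = (\<Sum>i\<in>I. (a * c i + b * d i) *\<^sub>R e i x)"
      using c d by eventually_elim (simp add: scaleR_add_left scaleR_sum_right sum.distrib)
    with fun_subspace_lincomb[OF V(1) fg, of a b]
    show "(\<lambda>x. a *\<^sub>R f x + b *\<^sub>R g x) \<in> V'"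
      unfolding V'_def mem_Collect_eq by (intro conjI exI)
  qed
  have V'V: "V' \<subseteq> V" by (auto simp: V'_def)
  have "ae_spanned D V' I e"
    by (auto simp: ae_spanned_def V'_def)
  from insert.IH[OF sub' subset_trans[OF V'V V(2)] this]
  obtain n :: nat and b where b: "\<forall>i<n. b i \<in> V'"
    and ortho_b: "\<forall>i<n. \<forall>k<n. L2_inner D (b i) (b k) = (if i = k then 1 else 0)"
    and span': "ae_spanned D V' {..<n} b"
    by blast
  note ortho = ortho_b[rule_format]
  have bV: "b i \<in> V" "b i \<in> Lp D 2" if "i < n" for i
    using b that V'V V(2) by auto
  show ?case
  proof (cases "V \<subseteq> V'")
    case True
    then have "V' = V" using V'V by blast
    then show ?thesis
      using b ortho_b span' by (intro exI[of _ n] exI[of _ b]) simp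
  next
    case False
    then obtain v where v: "v \<in> V" "v \<notin> V'" by blast
    have vL: "v \<in> Lp D 2" using v V(2) by blast
    obtain c where c: "AE x in lebesgue_on D. v x = (\<Sum>i\<in>insert j I. c i *\<^sub>R e i x)"
      using insert.prems(3) v(1) unfolding ae_spanned_def by blast
    have "c j \<noteq> 0"
    proof
      assume "c j = 0"
      then have "AE x in lebesgue_on D. v x = (\<Sum>i\<in>I. c i *\<^sub>R e i x)"
        using c insert.hyps by simp
      then show False using v unfolding V'_def by blast
    qed
    \<comment> \<open>The orthogonal projection of \<open>v\<close> onto the part already spanned.
      The remainder \<open>r\<close> cannot have norm zero, since otherwise \<open>v\<close> would
      agree almost everywhere with an element that does without \<open>e j\<close>.\<close>
    define P where "P = (\<lambda>x. \<Sum>i<n. L2_inner D v (b i) *\<^sub>R b i x)"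
    have PV': "P \<in> V'"
      unfolding P_def using b by (intro fun_subspace_sum sub') auto
    then have PV: "P \<in> V" "P \<in> Lp D 2" using V'V V(2) by auto
    define r where "r = (\<lambda>x. 1 *\<^sub>R v x + (- 1) *\<^sub>R P x)"
    have rV: "r \<in> V" "r \<in> Lp D 2"
      unfolding r_def using fun_subspace_lincomb[OF V(1) v(1) PV(1), of 1 "- 1"]
      Lp_lincomb[OF _ vL PV(2), of 1 "- 1"] by simp_all
    have r_orth: "L2_inner D r (b k) = 0" if k: "k < n" for k
    proof -
      have "L2_inner D P (b k) = (\<Sum>i<n. L2_inner D v (b i) * L2_inner D (b i) (b k))"
        unfolding P_def using bV k by (intro L2_inner_sum_left) auto
      also have "\<dots> = (\<Sum>i<n. if i = k then L2_inner D v (b i) else 0)"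
        using ortho k by (intro sum.cong) auto
      also have "\<dots> = L2_inner D v (b k)"
        using k by simp
      finally show ?thesis
        unfolding r_def using L2_inner_lincomb_left[OF vL PV(2) bV(2)[OF k], of 1 "- 1"] by simp
    qed
    have "L2_inner D r r \<noteq> 0"
    proof
      assume "L2_inner D r r = 0"
      then have "AE x in lebesgue_on D. r x = 0"
        by (rule L2_inner_self_eq_0[OF rV(2)])
      then have "AE x in lebesgue_on D. v x = P x"
        by eventually_elim (simp add: r_def)
      moreover obtain d where "AE x in lebesgue_on D. P x = (\<Sum>i\<in>I. d i *\<^sub>R e i x)"
        using PV' unfolding V'_def by blast
      ultimately have "AE x in lebesgue_on D. v x = (\<Sum>i\<in>I. d i *\<^sub>R e i x)"
        by eventually_elim simp
      then show False using v unfolding V'_def by blast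
    qed
    then have r_pos: "L2_inner D r r > 0"
      using L2_inner_self_nonneg[of D r] by simp
    define s where "s = 1 / sqrt (L2_inner D r r)"
    have s: "s > 0" "s * s * L2_inner D r r = 1"
      using r_pos by (simp_all add: s_def)
    \<comment> \<open>The zero summand puts the normalised remainder into the two-term shape that
      the lemmas on linear combinations expect.\<close>
    define b' where "b' = b(n := \<lambda>x. s *\<^sub>R r x + 0 *\<^sub>R r x)"
    have b'_n: "b' n x = s *\<^sub>R r x" for x by (simp add: b'_def)
    have b'_less: "b' i = b i" if "i < n" for i using that by (simp add: b'_def)
    have "b' n \<in> V"
      using fun_subspace_lincomb[OF V(1) rV(1) rV(1), of s 0] by (simp add: b'_def)
    then have b'V: "b' i \<in> V" if "i < Suc n" for i
      using that bV b'_less by (cases "i = n") auto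
    have n_orth: "L2_inner D (b' n) (b k) = 0" if "k < n" for k
      using L2_inner_lincomb_left[OF rV(2) rV(2) bV(2)[OF that], of s 0] r_orth[OF that] by (simp add: b'_def)
    have n_n: "L2_inner D (b' n) (b' n) = 1"
      using L2_inner_lincomb_left[OF rV(2) rV(2) rV(2), of s 0] s(2)
        L2_inner_lincomb_right[OF rV(2) rV(2), of "\<lambda>x. s *\<^sub>R r x + 0 *\<^sub>R r x" s 0]
        Lp_lincomb[OF _ rV(2) rV(2), of s 0]
      by (simp add: b'_def)
    have ortho': "L2_inner D (b' i) (b' k) = (if i = k then 1 else 0)" if "i < Suc n" "k < Suc n" for i k
      using that ortho[of i k] n_orth[of i] n_orth[of k] n_n b'_less[of i] b'_less[of k]
      by (cases "i = n"; cases "k = n") (auto simp: L2_inner_commute[of D "b i" "b' n"])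
    have "ae_spanned D V {..<Suc n} b'"
      unfolding ae_spanned_def
    proof
      fix w assume w: "w \<in> V"
      then obtain d where d: "AE x in lebesgue_on D. w x = (\<Sum>i\<in>insert j I. d i *\<^sub>R e i x)"
        using insert.prems(3) unfolding ae_spanned_def by blast
      \<comment> \<open>The multiple of \<open>v\<close> whose subtraction cancels the
        \<open>e j\<close> coefficient of \<open>w\<close>, so that \<open>w - t v\<close> lies in
        \<open>V'\<close>.\<close>
      define t where "t = d j / c j"
      have "AE x in lebesgue_on D. 1 *\<^sub>R w x + (- t) *\<^sub>R v x = (\<Sum>i\<in>I. (d i - t * c i) *\<^sub>R e i x)"
        using c d
        by eventually_elim (use insert.hyps \<open>c j \<noteq> 0\<close> in
          \<open>simp add: t_def scaleR_diff_left scaleR_sum_right sum_subtractf sum_negf algebra_simps\<close>)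
      with fun_subspace_lincomb[OF V(1) w v(1), of 1 "- t"]
      have "(\<lambda>x. 1 *\<^sub>R w x + (- t) *\<^sub>R v x) \<in> V'"
        unfolding V'_def mem_Collect_eq by (intro conjI exI)
      from bspec[OF span'[unfolded ae_spanned_def] this]
      obtain g where g: "AE x in lebesgue_on D. 1 *\<^sub>R w x + (- t) *\<^sub>R v x = (\<Sum>i<n. g i *\<^sub>R b i x)"
        by blast
      \<comment> \<open>Read off from \<open>w = (w - t v) + t P + t r\<close>, where
        \<open>r\<close> is the new basis element divided by \<open>s\<close>.\<close>
      define k where "k i = (if i = n then t / s else g i + t * L2_inner D v (b i))" for i
      have "AE x in lebesgue_on D. w x = (\<Sum>i<Suc n. k i *\<^sub>R b' i x)"
        using g
      proof eventually_elim
        case (elim x)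
        have "(\<Sum>i<Suc n. k i *\<^sub>R b' i x) = (\<Sum>i<n. (g i + t * L2_inner D v (b i)) *\<^sub>R b i x) + t *\<^sub>R r x"
          using s(1) by (simp add: k_def b'_less b'_n)
        also have "\<dots> = (\<Sum>i<n. g i *\<^sub>R b i x) + t *\<^sub>R P x + t *\<^sub>R r x"
          by (simp add: P_def scaleR_add_left sum.distrib scaleR_sum_right)
        also have "\<dots> = w x"
          using elim by (simp add: r_def algebra_simps)
        finally show ?case by simp
      qed
      then show "\<exists>c. AE x in lebesgue_on D. w x = (\<Sum>i<Suc n. c i *\<^sub>R b' i x)" by blast
    qed
    then show ?thesis
      using b'V ortho' by (intro exI[of _ "Suc n"] exI[of _ b']) simp
  qed
qed

text \<open>In an orthonormal basis the squared L2 norm becomes the Euclidean one, so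
  \<open>mono\<close> is exactly the hypothesis of \<open>strongly_monotone_surjective\<close> for
  the coordinate map \<open>F\<close>. Continuity is asked only along finite combinations because
  the function space carries no topology. The almost-everywhere clause in \<open>lin\<close> lets a
  test function be replaced by its basis expansion.\<close>

lemma galerkin_existence:
  fixes \<Phi> :: "(real^3 \<Rightarrow> 'b::euclidean_space) \<Rightarrow> (real^3 \<Rightarrow> 'b) \<Rightarrow> real"
  assumes V: "fun_subspace V" "V \<subseteq> Lp D 2" and span: "finite I" "ae_spanned D V I e"
    and lin: "\<And>z v w y a b. z \<in> V \<Longrightarrow> v \<in> V \<Longrightarrow> w \<in> V \<Longrightarrow> y \<in> V \<Longrightarrow>
        (AE x in lebesgue_on D. y x = a *\<^sub>R v x + b *\<^sub>R w x) \<Longrightarrow> \<Phi> z y = a * \<Phi> z v + b * \<Phi> z w"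
    and "c > 0"
    and mono: "\<And>z z'. z \<in> V \<Longrightarrow> z' \<in> V \<Longrightarrow>
        c * L2_inner D (\<lambda>x. 1 *\<^sub>R z x + (- 1) *\<^sub>R z' x) (\<lambda>x. 1 *\<^sub>R z x + (- 1) *\<^sub>R z' x)
        \<le> \<Phi> z (\<lambda>x. 1 *\<^sub>R z x + (- 1) *\<^sub>R z' x) - \<Phi> z' (\<lambda>x. 1 *\<^sub>R z x + (- 1) *\<^sub>R z' x)"
    and cont: "\<And>(n::nat) b v. (\<forall>i<n. b i \<in> V) \<Longrightarrow> v \<in> V \<Longrightarrow>
        continuous_on UNIV (\<lambda>x::nat \<Rightarrow> real. \<Phi> (\<lambda>y. \<Sum>i<n. x i *\<^sub>R b i y) v)"
  shows "\<exists>z\<in>V. \<forall>v\<in>V. \<Phi> z v = 0"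
proof -
  from ex_orthonormal_basis[OF span(1) V span(2)] obtain n :: nat and b
    where b: "\<forall>i<n. b i \<in> V"
      and ortho: "\<forall>i<n. \<forall>j<n. L2_inner D (b i) (b j) = (if i = j then 1 else 0)"
      and spanned: "ae_spanned D V {..<n} b"
    by blast
  define z where "z x = (\<lambda>y. \<Sum>i<n. x i *\<^sub>R b i y)" for x :: "nat \<Rightarrow> real"
  have bL: "b i \<in> Lp D 2" if "i < n" for i
    using b V(2) that by blast
  have zV: "z x \<in> V" for x
    unfolding z_def using b by (intro fun_subspace_sum V) auto
  have zL: "z x \<in> Lp D 2" for x
    using zV V(2) by blast
  have lin0: "\<Phi> v (\<lambda>x. 0) = 0" if "v \<in> V" for v
    using lin[OF that, of "\<lambda>x. 0" "\<lambda>x. 0" "\<lambda>x. 0" 0 0] V(1) by (simp add: fun_subspace_def)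
  have lin_sum: "\<Phi> v (\<lambda>y. \<Sum>i<m. x i *\<^sub>R b i y) = (\<Sum>i<m. x i * \<Phi> v (b i))" if v: "v \<in> V" and m: "m \<le> n" for v x m
    using m
  proof (induction m)
    case 0
    then show ?case using lin0[OF v] by simp
  next
    case (Suc m)
    have "(\<lambda>y. \<Sum>i<k. x i *\<^sub>R b i y) \<in> V" if "k \<le> n" for k
      using b that by (intro fun_subspace_sum V) auto
    note sums = this
    have "\<Phi> v (\<lambda>y. \<Sum>i<Suc m. x i *\<^sub>R b i y) = 1 * \<Phi> v (\<lambda>y. \<Sum>i<m. x i *\<^sub>R b i y) + x m * \<Phi> v (b m)"
      using Suc.prems b by (intro lin[OF v sums _ sums]) auto
    then show ?case
      using Suc by simp
  qed
  have norm_z: "L2_inner D (z x) (z x) = (\<Sum>i<n. (x i)\<^sup>2)" for x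
  proof -
    have "L2_inner D (z x) (z x) = (\<Sum>i<n. x i * L2_inner D (b i) (z x))"
      unfolding z_def[of x] using bL zL[of x] by (intro L2_inner_sum_left) (auto simp: z_def)
    also have "\<dots> = (\<Sum>i<n. x i * x i)"
    proof (intro sum.cong refl)
      fix i assume i: "i \<in> {..<n}"
      have "L2_inner D (b i) (z x) = (\<Sum>j<n. x j * L2_inner D (b j) (b i))"
        unfolding z_def L2_inner_commute[of D "b i"] using bL i by (intro L2_inner_sum_left) auto
      also have "\<dots> = (\<Sum>j<n. if j = i then x j else 0)"
        using ortho i by (intro sum.cong) auto
      also have "\<dots> = x i"
        using i by simp
      finally show "x i * L2_inner D (b i) (z x) = x i * x i" by simp
    qed
    finally show ?thesis by (simp add: power2_eq_square)
  qed
  have z_diff: "(\<lambda>y. 1 *\<^sub>R z s y + (- 1) *\<^sub>R z t y) = z (\<lambda>i. s i - t i)" for s t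
    by (simp add: z_def scaleR_diff_left sum_subtractf)
  define F where "F x i = \<Phi> (z x) (b i)" for x i
  have "\<exists>x. \<forall>i<n. F x i = 0"
  proof (rule strongly_monotone_surjective[OF _ \<open>c > 0\<close>])
    show "continuous_on UNIV (\<lambda>x. F x i)" if "i < n" for i
      unfolding F_def z_def using cont[of n b "b i"] b that by simp
    fix s t :: "nat \<Rightarrow> real"
    have "\<Phi> (z x) (z (\<lambda>i. s i - t i)) = (\<Sum>i<n. (s i - t i) * F x i)" for x
      unfolding z_def[of "\<lambda>i. s i - t i"] F_def by (rule lin_sum[OF zV]) simp
    then show "c * (\<Sum>i<n. (s i - t i)\<^sup>2) \<le> (\<Sum>i<n. (F s i - F t i) * (s i - t i))"
      using mono[OF zV[of s] zV[of t]] unfolding z_diff norm_z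
      by (simp add: sum_subtractf[symmetric] algebra_simps)
  qed
  then obtain x where x: "\<forall>i<n. F x i = 0" by blast
  have "\<Phi> (z x) v = 0" if v: "v \<in> V" for v
  proof -
    from bspec[OF spanned[unfolded ae_spanned_def] v]
    obtain d where d: "AE y in lebesgue_on D. v y = (\<Sum>i<n. d i *\<^sub>R b i y)"
      by blast
    \<comment> \<open>A degenerate combination: in this shape \<open>lin\<close> says that the value
      of \<open>\<Phi>\<close> does not change when the test function is altered on a null
      set.\<close>
    then have "AE y in lebesgue_on D. v y = 1 *\<^sub>R z d y + 0 *\<^sub>R z d y"
      by (simp add: z_def)
    then have "\<Phi> (z x) v = 1 * \<Phi> (z x) (z d) + 0 * \<Phi> (z x) (z d)"
      by (rule lin[OF zV zV zV v])
    also have "\<dots> = (\<Sum>i<n. d i * F x i)"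
      unfolding z_def[of d] F_def using lin_sum[OF zV, of n] by simp
    also have "\<dots> = 0"
      using x by simp
    finally show ?thesis .
  qed
  then show ?thesis
    using zV by blast
qed

section \<open>Piecewise polynomials\<close>

lemma lebesgue_AE_on_cells:
  assumes "finite \<T>" "\<And>K. K \<in> \<T> \<Longrightarrow> K \<in> sets lebesgue" "D \<in> sets lebesgue"
    and "\<And>K. K \<in> \<T> \<Longrightarrow> AE x in lebesgue_on K. P K x"
  shows "AE x in lebesgue_on D. \<forall>K\<in>\<T>. x \<in> K \<longrightarrow> P K x"
proof -
  have "AE x in lebesgue. x \<in> K \<longrightarrow> P K x" if "K \<in> \<T>" for K
    using assms(2,4)[OF that] by (simp add: AE_restrict_space_iff)
  then have "AE x in lebesgue. \<forall>K\<in>\<T>. x \<in> K \<longrightarrow> P K x"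
    by (intro AE_finite_allI assms(1))
  then show ?thesis
    using assms(3) by (auto simp: AE_restrict_space_iff elim: eventually_mono)
qed

lemma finite_multi_indices: "finite {\<alpha> :: 'n::finite \<Rightarrow> nat. (\<Sum>i\<in>UNIV. \<alpha> i) \<le> k}"
proof (rule finite_subset)
  show "{\<alpha> :: 'n \<Rightarrow> nat. (\<Sum>i\<in>UNIV. \<alpha> i) \<le> k} \<subseteq> PiE UNIV (\<lambda>_. {..k})"
  proof
    fix \<alpha> :: "'n \<Rightarrow> nat" assume "\<alpha> \<in> {\<alpha>. (\<Sum>i\<in>UNIV. \<alpha> i) \<le> k}"
    then have "\<alpha> i \<le> k" for i
      using member_le_sum[of i UNIV \<alpha>] by simp
    then show "\<alpha> \<in> PiE UNIV (\<lambda>_. {..k})"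
      by auto
  qed
  show "finite (PiE (UNIV::'n set) (\<lambda>_. {..k}))"
    by (rule finite_PiE) simp_all
qed

lemma monomial_sum_extend:
  fixes c :: "'i \<Rightarrow> 'b::real_vector"
  assumes "finite B" "A \<subseteq> B"
  shows "(\<Sum>\<alpha>\<in>A. m \<alpha> *\<^sub>R c \<alpha>) = (\<Sum>\<alpha>\<in>B. m \<alpha> *\<^sub>R (if \<alpha> \<in> A then c \<alpha> else 0))"
  using assms by (intro sum.mono_neutral_cong_left) auto

text \<open>Reduces edge elements to full polynomials, so that a single spanning family and a single
  boundedness argument serve velocity and magnetic field alike.\<close>

lemma nedelec_subset_poly_le: "nedelec k \<subseteq> poly_le k"
proof
  fix q :: "real^3 \<Rightarrow> real^3" assume "q \<in> nedelec k"
  then obtain a b where q: "q = (\<lambda>x. a x + b x)" and ab: "a \<in> poly_le (k - 1)" "b \<in> poly_hom k"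
    unfolding nedelec_def by blast
  let ?m = "\<lambda>x \<alpha>. \<Prod>i\<in>UNIV. (x::real^3) $ i ^ \<alpha> i"
  let ?A = "{\<alpha> :: 3 \<Rightarrow> nat. (\<Sum>i\<in>UNIV. \<alpha> i) \<le> k - 1}"
  let ?B = "{\<alpha> :: 3 \<Rightarrow> nat. (\<Sum>i\<in>UNIV. \<alpha> i) = k}"
  let ?C = "{\<alpha> :: 3 \<Rightarrow> nat. (\<Sum>i\<in>UNIV. \<alpha> i) \<le> k}"
  obtain c where c: "\<forall>x. a x = (\<Sum>\<alpha>\<in>?A. ?m x \<alpha> *\<^sub>R c \<alpha>)"
    using ab(1) unfolding poly_le_def by blast
  obtain d where d: "\<forall>x. b x = (\<Sum>\<alpha>\<in>?B. ?m x \<alpha> *\<^sub>R d \<alpha>)"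
    using ab(2) unfolding poly_hom_def by blast
  have fin: "finite ?C" by (rule finite_multi_indices)
  have "a x = (\<Sum>\<alpha>\<in>?C. ?m x \<alpha> *\<^sub>R (if \<alpha> \<in> ?A then c \<alpha> else 0))" for x
    unfolding c[rule_format] by (rule monomial_sum_extend[OF fin]) auto
  moreover have "b x = (\<Sum>\<alpha>\<in>?C. ?m x \<alpha> *\<^sub>R (if \<alpha> \<in> ?B then d \<alpha> else 0))" for x
    unfolding d[rule_format] by (rule monomial_sum_extend[OF fin]) auto
  ultimately have "q x = (\<Sum>\<alpha>\<in>?C. ?m x \<alpha> *\<^sub>R ((if \<alpha> \<in> ?A then c \<alpha> else 0) + (if \<alpha> \<in> ?B then d \<alpha> else 0)))" for x
    by (simp only: q scaleR_add_right sum.distrib)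
  then show "q \<in> poly_le k"
    unfolding poly_le_def mem_Collect_eq by (intro exI allI)
qed

lemma continuous_poly_le:
  assumes "q \<in> poly_le k"
  shows "continuous_on S q"
proof -
  obtain c where "\<forall>x. q x = (\<Sum>\<alpha> | (\<Sum>i\<in>UNIV. \<alpha> i) \<le> k. (\<Prod>i\<in>UNIV. x $ i ^ \<alpha> i) *\<^sub>R c \<alpha>)"
    using assms unfolding poly_le_def by blast
  then have "q = (\<lambda>x. \<Sum>\<alpha> | (\<Sum>i\<in>UNIV. \<alpha> i) \<le> k. (\<Prod>i\<in>UNIV. x $ i ^ \<alpha> i) *\<^sub>R c \<alpha>)"
    by blast
  then show ?thesis
    by (simp only:) (intro continuous_on_sum continuous_on_scaleR continuous_on_prod continuous_on_power
        continuous_on_component continuous_on_id continuous_on_const)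
qed

lemma fun_subspace_nedelec: "fun_subspace (nedelec k)"
proof (rule fun_subspaceI)
  have "(\<lambda>x. 0) \<in> poly_le (k - 1)" "(\<lambda>x. 0) \<in> poly_hom k"
    unfolding poly_le_def poly_hom_def by (auto intro!: exI[of _ "\<lambda>_. 0"])
  then show "(\<lambda>x. 0) \<in> nedelec k"
    unfolding nedelec_def mem_Collect_eq by (intro exI[of _ "\<lambda>x. 0"]) simp
next
  fix s t :: real and f g assume "f \<in> nedelec k" "g \<in> nedelec k"
  then obtain a b a' b' where f: "f = (\<lambda>x. a x + b x)" and ab: "a \<in> poly_le (k - 1)" "b \<in> poly_hom k" "\<forall>x. b x \<bullet> x = 0"
    and g: "g = (\<lambda>x. a' x + b' x)" and ab': "a' \<in> poly_le (k - 1)" "b' \<in> poly_hom k" "\<forall>x. b' x \<bullet> x = 0"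
    unfolding nedelec_def by blast
  obtain c c' d d' where "\<forall>x. a x = (\<Sum>\<alpha> | (\<Sum>i\<in>UNIV. \<alpha> i) \<le> k - 1. (\<Prod>i\<in>UNIV. x $ i ^ \<alpha> i) *\<^sub>R c \<alpha>)"
    "\<forall>x. a' x = (\<Sum>\<alpha> | (\<Sum>i\<in>UNIV. \<alpha> i) \<le> k - 1. (\<Prod>i\<in>UNIV. x $ i ^ \<alpha> i) *\<^sub>R c' \<alpha>)"
    "\<forall>x. b x = (\<Sum>\<alpha> | (\<Sum>i\<in>UNIV. \<alpha> i) = k. (\<Prod>i\<in>UNIV. x $ i ^ \<alpha> i) *\<^sub>R d \<alpha>)"
    "\<forall>x. b' x = (\<Sum>\<alpha> | (\<Sum>i\<in>UNIV. \<alpha> i) = k. (\<Prod>i\<in>UNIV. x $ i ^ \<alpha> i) *\<^sub>R d' \<alpha>)"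
    using ab(1,2) ab'(1,2) unfolding poly_le_def poly_hom_def by blast
  then have a: "\<forall>x. s *\<^sub>R a x + t *\<^sub>R a' x = (\<Sum>\<alpha> | (\<Sum>i\<in>UNIV. \<alpha> i) \<le> k - 1. (\<Prod>i\<in>UNIV. x $ i ^ \<alpha> i) *\<^sub>R (s *\<^sub>R c \<alpha> + t *\<^sub>R c' \<alpha>))"
    and b: "\<forall>x. s *\<^sub>R b x + t *\<^sub>R b' x = (\<Sum>\<alpha> | (\<Sum>i\<in>UNIV. \<alpha> i) = k. (\<Prod>i\<in>UNIV. x $ i ^ \<alpha> i) *\<^sub>R (s *\<^sub>R d \<alpha> + t *\<^sub>R d' \<alpha>))"
    by (simp_all add: scaleR_sum_right scaleR_add_right sum.distrib mult.commute)
  have "(\<lambda>x. s *\<^sub>R a x + t *\<^sub>R a' x) \<in> poly_le (k - 1)"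
    unfolding poly_le_def mem_Collect_eq by (rule exI, rule a)
  moreover have "(\<lambda>x. s *\<^sub>R b x + t *\<^sub>R b' x) \<in> poly_hom k"
    unfolding poly_hom_def mem_Collect_eq by (rule exI, rule b)
  moreover have "\<forall>x. (s *\<^sub>R b x + t *\<^sub>R b' x) \<bullet> x = 0"
    using ab(3) ab'(3) by (simp add: inner_add_left)
  moreover have "(\<lambda>x. s *\<^sub>R f x + t *\<^sub>R g x) = (\<lambda>x. (s *\<^sub>R a x + t *\<^sub>R a' x) + (s *\<^sub>R b x + t *\<^sub>R b' x))"
    by (simp add: f g scaleR_add_right algebra_simps)
  ultimately show "(\<lambda>x. s *\<^sub>R f x + t *\<^sub>R g x) \<in> nedelec k"
    unfolding nedelec_def mem_Collect_eq
    by (intro exI[of _ "\<lambda>x. s *\<^sub>R a x + t *\<^sub>R a' x"] exI[of _ "\<lambda>x. s *\<^sub>R b x + t *\<^sub>R b' x"] conjI)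
qed

lemma piecewise_lincomb:
  assumes "fun_subspace P" "v \<in> piecewise \<T> P" "w \<in> piecewise \<T> P"
  shows "(\<lambda>x. a *\<^sub>R v x + b *\<^sub>R w x) \<in> piecewise \<T> P"
  unfolding piecewise_def mem_Collect_eq
proof
  fix K assume "K \<in> \<T>"
  then obtain q r where q: "q \<in> P" "AE x in lebesgue_on K. v x = q x" and r: "r \<in> P" "AE x in lebesgue_on K. w x = r x"
    using assms(2,3) unfolding piecewise_def by blast
  have "AE x in lebesgue_on K. a *\<^sub>R v x + b *\<^sub>R w x = a *\<^sub>R q x + b *\<^sub>R r x"
    using q(2) r(2) by eventually_elim simp
  then show "\<exists>q\<in>P. AE x in lebesgue_on K. a *\<^sub>R v x + b *\<^sub>R w x = q x"
    using fun_subspace_lincomb[OF assms(1) q(1) r(1)] by (intro bexI)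
qed

lemma piecewise_mono: "P \<subseteq> P' \<Longrightarrow> piecewise \<T> P \<subseteq> piecewise \<T> P'"
  unfolding piecewise_def by blast

lemma piecewise_bounded:
  assumes "finite \<T>" "\<And>K. K \<in> \<T> \<Longrightarrow> compact K" "D \<in> sets lebesgue" "D \<subseteq> \<Union>\<T>"
    and v: "v \<in> piecewise \<T> (poly_le k)"
  shows "\<exists>m. AE x in lebesgue_on D. norm (v x) \<le> m"
proof -
  have "\<forall>K\<in>\<T>. \<exists>m. AE x in lebesgue_on K. norm (v x) \<le> m"
  proof
    fix K assume K: "K \<in> \<T>"
    then obtain q where q: "q \<in> poly_le k" "AE x in lebesgue_on K. v x = q x"
      using v unfolding piecewise_def by blast
    obtain m where m: "\<And>x. x \<in> K \<Longrightarrow> norm (q x) \<le> m"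
      using compact_imp_bounded[OF compact_continuous_image[OF continuous_poly_le[OF q(1)] assms(2)[OF K]]]
      unfolding bounded_iff by auto
    have "AE x in lebesgue_on K. norm (v x) \<le> m"
      using q(2) AE_space[of "lebesgue_on K"] by eventually_elim (use m in auto)
    then show "\<exists>m. AE x in lebesgue_on K. norm (v x) \<le> m" by blast
  qed
  then obtain m where m: "\<And>K. K \<in> \<T> \<Longrightarrow> AE x in lebesgue_on K. norm (v x) \<le> m K"
    unfolding bchoice_iff by blast
  have "AE x in lebesgue_on D. \<forall>K\<in>\<T>. x \<in> K \<longrightarrow> norm (v x) \<le> m K"
    using assms(1-3) m by (intro lebesgue_AE_on_cells) (auto intro: fmeasurableD lmeasurable_compact)
  then have "AE x in lebesgue_on D. norm (v x) \<le> (\<Sum>K\<in>\<T>. \<bar>m K\<bar>)"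
    using AE_space[of "lebesgue_on D"]
  proof eventually_elim
    case (elim x)
    then obtain K where K: "K \<in> \<T>" "x \<in> K" using assms(4) by auto
    have "norm (v x) \<le> \<bar>m K\<bar>"
      using elim(1) K by fastforce
    also have "\<dots> \<le> (\<Sum>K\<in>\<T>. \<bar>m K\<bar>)"
      using assms(1) K(1) by (intro member_le_sum) auto
    finally show ?case .
  qed
  then show ?thesis by blast
qed

text \<open>At almost every point the identities of all finitely many cells hold together, so only
  the cell assigned to the point matters. The assignment need not be measurable, which
  \<open>ex_orthonormal_basis\<close> tolerates.\<close>

lemma piecewise_ae_spanned:
  fixes D :: "(real^3) set"
  assumes "finite \<T>" "\<And>K. K \<in> \<T> \<Longrightarrow> compact K" "D \<in> sets lebesgue" "D \<subseteq> \<Union>\<T>"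
  shows "\<exists>e. ae_spanned D (piecewise \<T> (poly_le k) :: (real^3 \<Rightarrow> 'b::euclidean_space) set)
    (\<T> \<times> {\<alpha> :: 3 \<Rightarrow> nat. (\<Sum>i\<in>UNIV. \<alpha> i) \<le> k} \<times> (Basis :: 'b set)) e"
proof -
  \<comment> \<open>Cells share faces, so each point has to be assigned to one cell.\<close>
  define \<kappa> where "\<kappa> x = (SOME K. K \<in> \<T> \<and> x \<in> K)" for x
  have \<kappa>: "\<kappa> x \<in> \<T>" "x \<in> \<kappa> x" if "x \<in> D" for x
    using someI_ex[of "\<lambda>K. K \<in> \<T> \<and> x \<in> K"] that assms(4) unfolding \<kappa>_def by blast+
  let ?A = "{\<alpha> :: 3 \<Rightarrow> nat. (\<Sum>i\<in>UNIV. \<alpha> i) \<le> k}"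
  let ?m = "\<lambda>x \<alpha>. \<Prod>i\<in>UNIV. (x::real^3) $ i ^ \<alpha> i"
  define e :: "(real^3) set \<times> (3 \<Rightarrow> nat) \<times> 'b \<Rightarrow> real^3 \<Rightarrow> 'b" where
    "e = (\<lambda>(K, \<alpha>, b) x. if \<kappa> x = K then ?m x \<alpha> *\<^sub>R b else 0)"
  have spanned: "\<exists>c. AE x in lebesgue_on D. v x = (\<Sum>i\<in>\<T> \<times> ?A \<times> Basis. c i *\<^sub>R e i x)"
    if v: "v \<in> piecewise \<T> (poly_le k)" for v :: "real^3 \<Rightarrow> 'b"
  proof -
    have "\<forall>K\<in>\<T>. \<exists>c. AE x in lebesgue_on K. v x = (\<Sum>\<alpha>\<in>?A. ?m x \<alpha> *\<^sub>R c \<alpha>)"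
    proof
      fix K assume "K \<in> \<T>"
      then obtain q where q: "q \<in> poly_le k" "AE x in lebesgue_on K. v x = q x"
        using v unfolding piecewise_def by blast
      obtain c where c: "\<forall>x. q x = (\<Sum>\<alpha>\<in>?A. ?m x \<alpha> *\<^sub>R c \<alpha>)"
        using q(1) unfolding poly_le_def by blast
      have "AE x in lebesgue_on K. v x = (\<Sum>\<alpha>\<in>?A. ?m x \<alpha> *\<^sub>R c \<alpha>)"
        using q(2) by (simp only: c)
      then show "\<exists>c. AE x in lebesgue_on K. v x = (\<Sum>\<alpha>\<in>?A. ?m x \<alpha> *\<^sub>R c \<alpha>)" by blast
    qed
    then obtain c where c: "\<And>K. K \<in> \<T> \<Longrightarrow> AE x in lebesgue_on K. v x = (\<Sum>\<alpha>\<in>?A. ?m x \<alpha> *\<^sub>R c K \<alpha>)"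
      unfolding bchoice_iff by blast
    let ?c = "\<lambda>(K, \<alpha>, b). c K \<alpha> \<bullet> b"
    have "AE x in lebesgue_on D. \<forall>K\<in>\<T>. x \<in> K \<longrightarrow> v x = (\<Sum>\<alpha>\<in>?A. ?m x \<alpha> *\<^sub>R c K \<alpha>)"
      using assms(1-3) c by (intro lebesgue_AE_on_cells) (auto intro: fmeasurableD lmeasurable_compact)
    then have "AE x in lebesgue_on D. v x = (\<Sum>i\<in>\<T> \<times> ?A \<times> Basis. ?c i *\<^sub>R e i x)"
      using AE_space[of "lebesgue_on D"]
    proof eventually_elim
      case (elim x)
      then have x: "x \<in> D" by simp
      have "(\<Sum>i\<in>\<T> \<times> ?A \<times> Basis. ?c i *\<^sub>R e i x) =
          (\<Sum>K\<in>\<T>. \<Sum>\<alpha>\<in>?A. \<Sum>b\<in>Basis. (c K \<alpha> \<bullet> b) *\<^sub>R (if \<kappa> x = K then ?m x \<alpha> *\<^sub>R b else 0))"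
        by (simp add: sum.cartesian_product e_def case_prod_unfold)
      also have "\<dots> = (\<Sum>K\<in>\<T>. if \<kappa> x = K then \<Sum>\<alpha>\<in>?A. ?m x \<alpha> *\<^sub>R c K \<alpha> else 0)"
      proof (rule sum.cong[OF refl])
        fix K assume "K \<in> \<T>"
        have "(\<Sum>b\<in>Basis. (c K \<alpha> \<bullet> b) *\<^sub>R ?m x \<alpha> *\<^sub>R b) = ?m x \<alpha> *\<^sub>R c K \<alpha>" for \<alpha>
        proof -
          have "(\<Sum>b\<in>Basis. (c K \<alpha> \<bullet> b) *\<^sub>R ?m x \<alpha> *\<^sub>R b) = ?m x \<alpha> *\<^sub>R (\<Sum>b\<in>Basis. (c K \<alpha> \<bullet> b) *\<^sub>R b)"
            by (simp add: scaleR_sum_right mult.commute)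
          then show ?thesis
            by (simp only: euclidean_representation)
        qed
        then show "(\<Sum>\<alpha>\<in>?A. \<Sum>b\<in>Basis. (c K \<alpha> \<bullet> b) *\<^sub>R (if \<kappa> x = K then ?m x \<alpha> *\<^sub>R b else 0)) =
            (if \<kappa> x = K then \<Sum>\<alpha>\<in>?A. ?m x \<alpha> *\<^sub>R c K \<alpha> else 0)"
          by simp
      qed
      also have "\<dots> = (\<Sum>\<alpha>\<in>?A. ?m x \<alpha> *\<^sub>R c (\<kappa> x) \<alpha>)"
        using assms(1) \<kappa>[OF x] by simp
      also have "\<dots> = v x"
        using elim(1) \<kappa>[OF x] by simp
      finally show ?case by simp
    qed
    then show ?thesis by blast
  qed
  show ?thesis
    unfolding ae_spanned_def by (intro exI[of _ e] ballI spanned)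
qed

lemma tetrahedral_mesh_cells:
  assumes "tetrahedral_mesh D \<T>"
  shows "finite \<T>" "\<And>K. K \<in> \<T> \<Longrightarrow> compact K" "D \<subseteq> \<Union>\<T>"
proof -
  show "finite \<T>"
    using assms unfolding tetrahedral_mesh_def triangulation_def by blast
  show "compact K" if "K \<in> \<T>" for K
    using assms that unfolding tetrahedral_mesh_def
    by (meson polytope_imp_compact simplex_imp_polytope)
  show "D \<subseteq> \<Union>\<T>"
    using assms closure_subset unfolding tetrahedral_mesh_def by blast
qed

section \<open>The power-law stress\<close>

text \<open>Puts velocities and their gradients into the L2 framework of the other terms; the finite
  measure of \<open>D\<close> makes the constant in \<open>t^2 <= 1 + t^p\<close>
  integrable.\<close>

lemma Lp_subset_Lp_2:
  fixes f :: "real^3 \<Rightarrow> 'b::euclidean_space"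
  assumes "D \<in> lmeasurable" "p \<ge> 2" "f \<in> Lp D p"
  shows "f \<in> Lp D 2"
  unfolding Lp_2_iff
proof
  show f: "f \<in> borel_measurable (lebesgue_on D)"
    using assms(3) by (simp add: Lp_def)
  interpret finite_measure "lebesgue_on D"
    using assms(1) by (rule finite_measure_lebesgue_on)
  show "integrable (lebesgue_on D) (\<lambda>x. (norm (f x))\<^sup>2)"
  proof (rule Bochner_Integration.integrable_bound)
    show "integrable (lebesgue_on D) (\<lambda>x. 1 + norm (f x) powr p)"
      using assms(3) by (simp add: Lp_def)
    show "(\<lambda>x. (norm (f x))\<^sup>2) \<in> borel_measurable (lebesgue_on D)"
      using f by measurable
    have "(norm (f x))\<^sup>2 \<le> 1 + norm (f x) powr p" for x
    proof (cases "norm (f x) \<le> 1")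
      case True
      then have "(norm (f x))\<^sup>2 \<le> 1"
        by (simp add: power_le_one)
      then show ?thesis
        by (rule order_trans) simp
    next
      case False
      then have "norm (f x) powr 2 \<le> norm (f x) powr p"
        using assms(2) by (intro powr_mono) auto
      then show ?thesis by simp
    qed
    then show "AE x in lebesgue_on D. norm ((norm (f x))\<^sup>2) \<le> norm (1 + norm (f x) powr p)"
      by (intro AE_I2) (simp add: order_trans[OF _ abs_ge_self])
  qed
qed

lemma Lp_2_integrable:
  fixes f :: "real^3 \<Rightarrow> 'b::euclidean_space"
  assumes "D \<in> lmeasurable" "f \<in> Lp D 2"
  shows "integrable (lebesgue_on D) f"
proof (rule Bochner_Integration.integrable_bound)
  interpret finite_measure "lebesgue_on D"
    using assms(1) by (rule finite_measure_lebesgue_on)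
  show "integrable (lebesgue_on D) (\<lambda>x. 1 + (norm (f x))\<^sup>2)"
    using assms(2) by (simp add: Lp_2_iff)
  show "f \<in> borel_measurable (lebesgue_on D)"
    using assms(2) by (simp add: Lp_2_iff)
  have "norm (f x) \<le> 1 + (norm (f x))\<^sup>2" for x
    using sum_squares_bound[of 1 "norm (f x)", simplified] norm_ge_zero[of "f x"] by linarith
  then show "AE x in lebesgue_on D. norm (f x) \<le> norm (1 + (norm (f x))\<^sup>2)"
    by (intro AE_I2) (simp add: order_trans[OF _ abs_ge_self])
qed

lemma bilinear_matrix_vector: "bilinear (\<lambda>(A::real^'n^'m) x. A *v x)"
  unfolding bilinear_def by (auto intro!: linearI simp: algebra_simps scaleR_matrix_vector_assoc
      matrix_vector_mult_scaleR)

text \<open>One estimate for the convective, Lorentz and induction terms: \<open>h\<close> is a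
  matrix-vector or cross product, and the bounded factor is the field of the previous step.\<close>

lemma Lp_2_bilinear:
  fixes h :: "'a::euclidean_space \<Rightarrow> 'b::euclidean_space \<Rightarrow> 'c::euclidean_space"
  assumes "bilinear h" and f: "f \<in> borel_measurable (lebesgue_on D)" "AE x in lebesgue_on D. norm (f x) \<le> m"
    and g: "g \<in> Lp D 2"
  shows "(\<lambda>x. h (f x) (g x)) \<in> Lp D 2"
  unfolding Lp_2_iff
proof
  have h: "bounded_bilinear h"
    using assms(1) by (simp add: bilinear_conv_bounded_bilinear)
  obtain K where K: "\<And>a b. norm (h a b) \<le> norm a * norm b * K" "K \<ge> 0"
    using bounded_bilinear.nonneg_bounded[OF h] by blast
  have g': "g \<in> borel_measurable (lebesgue_on D)"
    using g by (simp add: Lp_2_iff)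
  show meas: "(\<lambda>x. h (f x) (g x)) \<in> borel_measurable (lebesgue_on D)"
    using f(1) g' by (rule borel_measurable_continuous_Pair)
      (intro bounded_bilinear.continuous_on[OF h] continuous_intros)
  show "integrable (lebesgue_on D) (\<lambda>x. (norm (h (f x) (g x)))\<^sup>2)"
  proof (rule Bochner_Integration.integrable_bound)
    show "integrable (lebesgue_on D) (\<lambda>x. (m * K)\<^sup>2 * (norm (g x))\<^sup>2)"
      using g by (intro integrable_mult_right) (simp add: Lp_2_iff)
    show "(\<lambda>x. (norm (h (f x) (g x)))\<^sup>2) \<in> borel_measurable (lebesgue_on D)"
      using meas by measurable
    show "AE x in lebesgue_on D. norm ((norm (h (f x) (g x)))\<^sup>2) \<le> norm ((m * K)\<^sup>2 * (norm (g x))\<^sup>2)"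
      using f(2)
    proof eventually_elim
      case (elim x)
      have "norm (h (f x) (g x)) \<le> norm (f x) * norm (g x) * K"
        by (rule K(1))
      also have "\<dots> \<le> m * norm (g x) * K"
        using elim K(2) by (intro mult_right_mono) auto
      finally have "(norm (h (f x) (g x)))\<^sup>2 \<le> (m * norm (g x) * K)\<^sup>2"
        by (intro power_mono) auto
      then show ?case
        by (simp add: power_mult_distrib mult_ac)
    qed
  qed
qed

section \<open>The stress map, which is the gradient of \<open>norm a powr p / p\<close>\<close>

definition p_stress :: "real \<Rightarrow> 'b::euclidean_space \<Rightarrow> 'b" where
  "p_stress p a = norm a powr (p - 2) *\<^sub>R a"

lemma norm_p_stress: "p \<ge> 2 \<Longrightarrow> norm (p_stress p a) = norm a powr (p - 1)"
  by (cases "a = 0") (simp_all add: p_stress_def powr_diff power2_eq_square)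

lemma p_stress_monotone:
  assumes "p \<ge> 2"
  shows "0 \<le> (p_stress p a - p_stress p b) \<bullet> (a - b)"
proof -
  let ?s = "norm a powr (p - 2)" and ?t = "norm b powr (p - 2)"
  have "0 \<le> (?s - ?t) * ((norm a)\<^sup>2 - (norm b)\<^sup>2)"
  proof (cases "norm a \<le> norm b")
    case True
    then have "?s \<le> ?t" "(norm a)\<^sup>2 \<le> (norm b)\<^sup>2"
      using assms by (auto intro: powr_mono2 power_mono)
    then show ?thesis by (simp add: mult_nonpos_nonpos)
  next
    case False
    then have "?t \<le> ?s" "(norm b)\<^sup>2 \<le> (norm a)\<^sup>2"
      using assms by (auto intro: powr_mono2 power_mono)
    then show ?thesis by simp
  qed
  moreover have "0 \<le> (?s + ?t) * (norm (a - b))\<^sup>2"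
    by simp
  \<comment> \<open>The mixed terms \<open>a \<bullet> b\<close> all come from \<open>norm (a - b)\<close> with the averaged coefficient.\<close>
  moreover have "2 * ((p_stress p a - p_stress p b) \<bullet> (a - b)) =
      (?s + ?t) * (norm (a - b))\<^sup>2 + (?s - ?t) * ((norm a)\<^sup>2 - (norm b)\<^sup>2)"
    unfolding p_stress_def power2_norm_eq_inner
    by (simp add: inner_diff_left inner_diff_right inner_commute algebra_simps)
  ultimately show ?thesis by linarith
qed

text \<open>The origin needs its own argument: for \<open>p = 2\<close> the scalar factor jumps
  there from \<open>0 powr 0 = 0\<close> to 1. The norm of the product is
  \<open>norm a powr (p - 1)\<close>, with positive exponent, and tends to 0.\<close>

lemma continuous_p_stress:
  assumes "p \<ge> 2"
  shows "continuous_on UNIV (p_stress p :: 'b::euclidean_space \<Rightarrow> 'b)"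
  unfolding continuous_on_eq_continuous_at[OF open_UNIV]
proof
  fix a :: 'b
  show "isCont (p_stress p) a"
  proof (cases "a = 0")
    case False
    then have "isCont (\<lambda>a. norm a powr (p - 2) *\<^sub>R a) a"
      by (intro continuous_intros) auto
    then show ?thesis
      by (simp add: p_stress_def[abs_def])
  next
    case True
    have "((\<lambda>x::'b. norm x powr (p - 1)) \<longlongrightarrow> 0 powr (p - 1)) (at 0)"
      using assms by (intro tendsto_powr' tendsto_norm_zero tendsto_const) auto
    then have "((\<lambda>x::'b. norm (p_stress p x)) \<longlongrightarrow> 0) (at 0)"
      using assms by (simp add: norm_p_stress)
    then have "((p_stress p :: 'b \<Rightarrow> 'b) \<longlongrightarrow> 0) (at 0)"
      by (rule tendsto_norm_zero_cancel)
    then show ?thesis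
      using True by (simp add: isCont_def p_stress_def)
  qed
qed

text \<open>Young's inequality without its sharp constants, obtained by replacing both factors with
  the larger one; only integrability depends on it.\<close>

lemma powr_young:
  fixes a b :: real
  assumes "p \<ge> 2" "a \<ge> 0" "b \<ge> 0"
  shows "a powr (p - 1) * b \<le> a powr p + b powr p"
proof -
  have *: "c powr (p - 1) * c = c powr p" if "c \<ge> 0" for c :: real
    using that assms(1) by (cases "c = 0") (simp_all add: powr_diff)
  show ?thesis
  proof (cases "a \<le> b")
    case True
    then have "a powr (p - 1) * b \<le> b powr (p - 1) * b"
      using assms by (intro mult_right_mono powr_mono2) auto
    then show ?thesis using *[of b] assms by (smt (verit) powr_ge_zero)
  next
    case False
    then have "a powr (p - 1) * b \<le> a powr (p - 1) * a"
      by (intro mult_left_mono) auto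
    then show ?thesis using *[of a] assms by (smt (verit) powr_ge_zero)
  qed
qed

text \<open>The separate bound \<open>r\<close> gives two uses: \<open>r = norm a\<close> shows
  integrability, and a majorant common to a whole sequence gives the dominating function in the
  continuity proof.\<close>

lemma p_stress_inner_bound:
  assumes "p \<ge> 2" "norm a \<le> r"
  shows "\<bar>p_stress p a \<bullet> b\<bar> \<le> r powr p + norm b powr p"
proof -
  have "\<bar>p_stress p a \<bullet> b\<bar> \<le> norm a powr (p - 1) * norm b"
    using Cauchy_Schwarz_ineq2[of "p_stress p a" b] assms(1) by (simp add: norm_p_stress)
  also have "\<dots> \<le> norm a powr p + norm b powr p"
    using assms(1) by (rule powr_young) auto
  also have "\<dots> \<le> r powr p + norm b powr p"
    using assms by (intro add_right_mono powr_mono2) auto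
  finally show ?thesis .
qed

lemma borel_measurable_p_stress_inner:
  fixes G H :: "real^3 \<Rightarrow> 'b::euclidean_space"
  assumes "p \<ge> 2" "G \<in> borel_measurable M" "H \<in> borel_measurable M"
  shows "(\<lambda>x. p_stress p (G x) \<bullet> H x) \<in> borel_measurable M"
  using borel_measurable_continuous_on[OF continuous_p_stress[OF assms(1)] assms(2)] assms(3)
  by (rule borel_measurable_inner)

lemma integrable_p_stress:
  fixes G H :: "real^3 \<Rightarrow> 'b::euclidean_space"
  assumes "p \<ge> 2" "G \<in> Lp D p" "H \<in> Lp D p"
  shows "integrable (lebesgue_on D) (\<lambda>x. p_stress p (G x) \<bullet> H x)"
proof (rule Bochner_Integration.integrable_bound)
  show "integrable (lebesgue_on D) (\<lambda>x. norm (G x) powr p + norm (H x) powr p)"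
    using assms by (simp add: Lp_def)
  show "(\<lambda>x. p_stress p (G x) \<bullet> H x) \<in> borel_measurable (lebesgue_on D)"
    using assms by (intro borel_measurable_p_stress_inner) (simp_all add: Lp_def)
  show "AE x in lebesgue_on D. norm (p_stress p (G x) \<bullet> H x) \<le> norm (norm (G x) powr p + norm (H x) powr p)"
    using p_stress_inner_bound[OF assms(1) order_refl] by (intro AE_I2) simp
qed

lemma L2_inner_p_stress_cong:
  assumes "p \<ge> 2" "G \<in> Lp D p" "G' \<in> Lp D p" "H \<in> Lp D p"
    and "AE x in lebesgue_on D. G x = G' x"
  shows "L2_inner D (\<lambda>x. p_stress p (G x)) H = L2_inner D (\<lambda>x. p_stress p (G' x)) H"
  unfolding L2_inner_def
proof (rule integral_cong_AE)
  show "AE x in lebesgue_on D. p_stress p (G x) \<bullet> H x = p_stress p (G' x) \<bullet> H x"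
    using assms(5) by eventually_elim simp
qed (use assms in \<open>auto intro!: borel_measurable_integrable integrable_p_stress\<close>)

lemma L2_inner_p_stress_lincomb:
  assumes "p \<ge> 2" "G \<in> Lp D p" "H \<in> Lp D p" "H' \<in> Lp D p" "K \<in> Lp D p"
    and "AE x in lebesgue_on D. K x = a *\<^sub>R H x + b *\<^sub>R H' x"
  shows "L2_inner D (\<lambda>x. p_stress p (G x)) K =
    a * L2_inner D (\<lambda>x. p_stress p (G x)) H + b * L2_inner D (\<lambda>x. p_stress p (G x)) H'"
proof -
  note int = integrable_p_stress[OF assms(1,2)]
  have "L2_inner D (\<lambda>x. p_stress p (G x)) K =
      (LINT x|lebesgue_on D. a * (p_stress p (G x) \<bullet> H x) + b * (p_stress p (G x) \<bullet> H' x))"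
    unfolding L2_inner_def
  proof (rule integral_cong_AE)
    show "AE x in lebesgue_on D. p_stress p (G x) \<bullet> K x = a * (p_stress p (G x) \<bullet> H x) + b * (p_stress p (G x) \<bullet> H' x)"
      using assms(6) by eventually_elim (simp add: inner_add_right)
  qed (use assms int in \<open>auto intro!: borel_measurable_integrable Bochner_Integration.integrable_add integrable_mult_right\<close>)
  then show ?thesis
    using int assms(3,4) by (simp add: L2_inner_def)
qed

text \<open>Sequential continuity by dominated convergence. Convergent coefficients are bounded, and
  their bounds \<open>M i\<close> turn the norms of the \<open>G i\<close> into the majorant
  \<open>\<gamma>\<close> in Lp, independent of the sequence index.\<close>

lemma continuous_L2_inner_p_stress:
  fixes G :: "nat \<Rightarrow> real^3 \<Rightarrow> 'b::euclidean_space"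
  assumes "p \<ge> 2" "\<And>i. i < n \<Longrightarrow> G i \<in> Lp D p" "H \<in> Lp D p"
  shows "continuous_on UNIV (\<lambda>x::nat \<Rightarrow> real. L2_inner D (\<lambda>y. p_stress p (\<Sum>i<n. x i *\<^sub>R G i y)) H)"
  unfolding continuous_on_sequentially
proof (intro allI ballI impI, elim conjE, unfold comp_def)
  fix s :: "nat \<Rightarrow> nat \<Rightarrow> real" and x assume s: "s \<longlonglongrightarrow> x"
  have s_lim: "(\<lambda>k. s k i) \<longlonglongrightarrow> x i" for i
    using s unfolding tendsto_fun_iff by blast
  have "\<forall>i. \<exists>M. \<forall>k. \<bar>s k i\<bar> \<le> M"
    using convergent_imp_Bseq[OF convergentI[OF s_lim]] unfolding Bseq_def by auto
  then obtain M where M: "\<And>i k. \<bar>s k i\<bar> \<le> M i"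
    unfolding choice_iff by blast
  define \<gamma> where "\<gamma> = (\<lambda>y. \<Sum>i<n. M i *\<^sub>R norm (G i y))"
  have "(\<lambda>y. norm (G i y)) \<in> Lp D p" if "i < n" for i
    using assms(2)[OF that] by (auto simp: Lp_def intro: borel_measurable_norm)
  then have \<gamma>: "\<gamma> \<in> Lp D p"
    unfolding \<gamma>_def using assms(1) by (intro Lp_sum) auto
  have comb: "(\<lambda>y. \<Sum>i<n. c i *\<^sub>R G i y) \<in> Lp D p" for c
    using assms(1,2) by (intro Lp_sum) auto
  show "(\<lambda>k. L2_inner D (\<lambda>y. p_stress p (\<Sum>i<n. s k i *\<^sub>R G i y)) H)
      \<longlonglongrightarrow> L2_inner D (\<lambda>y. p_stress p (\<Sum>i<n. x i *\<^sub>R G i y)) H"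
    unfolding L2_inner_def
  proof (rule integral_dominated_convergence)
    show "integrable (lebesgue_on D) (\<lambda>y. norm (\<gamma> y) powr p + norm (H y) powr p)"
      using \<gamma> assms(3) by (simp add: Lp_def)
    have "(\<lambda>k. p_stress p (\<Sum>i<n. s k i *\<^sub>R G i y)) \<longlonglongrightarrow> p_stress p (\<Sum>i<n. x i *\<^sub>R G i y)" for y
      using continuous_p_stress[OF assms(1), where 'b = 'b]
      by (intro isCont_tendsto_compose[of _ "p_stress p"] tendsto_sum tendsto_scaleR s_lim tendsto_const)
        (simp add: continuous_on_eq_continuous_at)
    then show "AE y in lebesgue_on D. (\<lambda>k. p_stress p (\<Sum>i<n. s k i *\<^sub>R G i y) \<bullet> H y)
        \<longlonglongrightarrow> p_stress p (\<Sum>i<n. x i *\<^sub>R G i y) \<bullet> H y"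
      by (intro AE_I2 tendsto_inner tendsto_const)
    have "norm (\<Sum>i<n. s k i *\<^sub>R G i y) \<le> norm (\<gamma> y)" for k y
    proof -
      have "norm (\<Sum>i<n. s k i *\<^sub>R G i y) \<le> (\<Sum>i<n. M i * norm (G i y))"
        by (rule sum_norm_le) (simp add: M mult_right_mono)
      then show ?thesis by (simp add: \<gamma>_def)
    qed
    from p_stress_inner_bound[OF assms(1) this]
    show "AE y in lebesgue_on D. norm (p_stress p (\<Sum>i<n. s k i *\<^sub>R G i y) \<bullet> H y) \<le> norm (\<gamma> y) powr p + norm (H y) powr p" for k
      by (intro AE_I2) simp
  qed (use comb assms in \<open>auto intro!: borel_measurable_integrable integrable_p_stress\<close>)
qed

section \<open>One time step\<close>

text \<open>Keeps of the finite element setting only what the argument uses: linear spaces spanned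
  up to null sets by finitely many functions, integrable derivatives, and bounded previous fields.
  Neither the mesh nor its size appears, and \<open>dt\<close> is an arbitrary positive number, so
  no coupling between them can arise.\<close>

locale mhd_step =
  fixes D :: "(real^3) set" and p \<nu> \<rho> \<mu> \<sigma> dt :: real
    and X0 Y :: "(real^3 \<Rightarrow> real^3) set"
    and u' B' g f :: "real^3 \<Rightarrow> real^3"
    and I J e e'
  assumes D: "open D" "D \<in> lmeasurable"
    and pos: "\<nu> > 0" "\<rho> > 0" "\<mu> > 0" "\<sigma> > 0" "dt > 0" and p: "p \<ge> 2"
    and subX: "fun_subspace X0" and subY: "fun_subspace Y"
    and spanX: "finite I" "ae_spanned D X0 I e" and spanY: "finite J" "ae_spanned D Y J e'"
    and X_L2: "u \<in> X0 \<Longrightarrow> u \<in> Lp D 2" and Y_L2: "B \<in> Y \<Longrightarrow> B \<in> Lp D 2"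
    and X_grad: "u \<in> X0 \<Longrightarrow> \<exists>G. has_weak_grad D u G" and X_grad_Lp: "u \<in> X0 \<Longrightarrow> weak_grad D u \<in> Lp D p"
    and Y_curl: "B \<in> Y \<Longrightarrow> \<exists>C. has_weak_curl D B C" and Y_curl_L2: "B \<in> Y \<Longrightarrow> weak_curl D B \<in> Lp D 2"
    and prev: "u' \<in> X0" "B' \<in> Y"
    and u'_bounded: "\<exists>m. AE x in lebesgue_on D. norm (u' x) \<le> m"
    and B'_bounded: "\<exists>m. AE x in lebesgue_on D. norm (B' x) \<le> m"
    and data: "g \<in> Lp D 2" "f \<in> Lp D 2"
begin

abbreviation "grad u \<equiv> weak_grad D u"
abbreviation "curl B \<equiv> weak_curl D B"

lemma D_sets: "D \<in> sets lebesgue"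
  using D(2) by (rule fmeasurableD)

lemma X_grad_L2: "u \<in> X0 \<Longrightarrow> grad u \<in> Lp D 2"
  using Lp_subset_Lp_2[OF D(2) p X_grad_Lp] .

lemma grad_lincomb:
  assumes "u \<in> X0" "v \<in> X0" "w \<in> X0" "AE x in lebesgue_on D. w x = a *\<^sub>R u x + b *\<^sub>R v x"
  shows "AE x in lebesgue_on D. grad w x = a *\<^sub>R grad u x + b *\<^sub>R grad v x"
  using X_grad[OF assms(1)] X_grad[OF assms(2)] X_grad[OF assms(3)] weak_grad_lincomb[OF D(1) _ _ _ assms(4)]
  by blast

lemma curl_lincomb:
  assumes "u \<in> Y" "v \<in> Y" "w \<in> Y" "AE x in lebesgue_on D. w x = a *\<^sub>R u x + b *\<^sub>R v x"
  shows "AE x in lebesgue_on D. curl w x = a *\<^sub>R curl u x + b *\<^sub>R curl v x"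
  using Y_curl[OF assms(1)] Y_curl[OF assms(2)] Y_curl[OF assms(3)] weak_curl_lincomb[OF D(1) _ _ _ assms(4)]
  by blast

text \<open>\<open>Lp_2_bilinear\<close> expects the bounded factor first, while the induction term
  has \<open>B'\<close> second; the matrix-vector product is flipped below for the same
  reason.\<close>

lemma bilinear_cross_flip: "bilinear (\<lambda>x y. cross3 y x)"
  using bilinear_cross unfolding bilinear_def by blast

lemma bilinear_matrix_vector_flip: "bilinear (\<lambda>x (A::real^3^3). A *v x)"
  using bilinear_matrix_vector unfolding bilinear_def by blast

lemma convection_L2:
  assumes "u \<in> X0"
  shows "(\<lambda>x. grad u x *v u' x) \<in> Lp D 2"
proof -
  obtain m where "AE x in lebesgue_on D. norm (u' x) \<le> m"
    using u'_bounded by blast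
  then show ?thesis
    using X_L2[OF prev(1)] by (intro Lp_2_bilinear[OF bilinear_matrix_vector_flip _ _ X_grad_L2[OF assms]])
      (simp add: Lp_2_iff)
qed

lemma lorentz_L2:
  assumes "B \<in> Y"
  shows "(\<lambda>x. cross3 (B' x) (curl B x)) \<in> Lp D 2"
proof -
  obtain m where "AE x in lebesgue_on D. norm (B' x) \<le> m"
    using B'_bounded by blast
  then show ?thesis
    using Y_L2[OF prev(2)] by (intro Lp_2_bilinear[OF bilinear_cross _ _ Y_curl_L2[OF assms]])
      (simp add: Lp_2_iff)
qed

lemma induction_L2:
  assumes "u \<in> X0"
  shows "(\<lambda>x. cross3 (u x) (B' x)) \<in> Lp D 2"
proof -
  obtain m where "AE x in lebesgue_on D. norm (B' x) \<le> m"
    using B'_bounded by blast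
  then show ?thesis
    using Y_L2[OF prev(2)] by (intro Lp_2_bilinear[OF bilinear_cross_flip _ _ X_L2[OF assms]])
      (simp add: Lp_2_iff)
qed

text \<open>Both equations added, the second with weight \<open>1 / (\<mu> * \<rho>)\<close>.
  Because the coefficients are frozen at \<open>u'\<close> and \<open>B'\<close>, everything except
  the viscous term is linear in the new state.\<close>

definition linear_part where
  "linear_part u B v w =
    1 / dt * L2_inner D u v
    + 1/2 * (L2_inner D (\<lambda>x. grad u x *v u' x) v - L2_inner D (\<lambda>x. grad v x *v u' x) u)
    + 1 / (\<mu> * \<rho>) * L2_inner D (\<lambda>x. cross3 (B' x) (curl B x)) v
    + 1 / (\<mu> * \<rho>) * (1 / dt * L2_inner D B w + 1 / (\<mu> * \<sigma>) * L2_inner D (curl B) (curl w)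
        - L2_inner D (\<lambda>x. cross3 (u x) (B' x)) (curl w))"

definition load where
  "load v w = L2_inner D g v + 1 / dt * L2_inner D u' v
    + 1 / (\<mu> * \<rho>) * (L2_inner D f w + 1 / dt * L2_inner D B' w)"

definition viscous where
  "viscous u v = \<nu> / \<rho> * L2_inner D (\<lambda>x. p_stress p (grad u x)) (grad v)"

definition residual where
  "residual u B v w = linear_part u B v w + viscous u v - load v w"

lemma linear_part_left:
  assumes X: "u1 \<in> X0" "u2 \<in> X0" "u \<in> X0" "v \<in> X0" and Y: "B1 \<in> Y" "B2 \<in> Y" "B \<in> Y" "w \<in> Y"
    and u: "AE x in lebesgue_on D. u x = a *\<^sub>R u1 x + b *\<^sub>R u2 x"
    and B: "AE x in lebesgue_on D. B x = a *\<^sub>R B1 x + b *\<^sub>R B2 x"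
  shows "linear_part u B v w = a * linear_part u1 B1 v w + b * linear_part u2 B2 v w"
proof -
  have 1: "L2_inner D u h = a * L2_inner D u1 h + b * L2_inner D u2 h" if "h \<in> Lp D 2" for h
    using X that u by (intro L2_inner_AE_lincomb_left) (simp_all add: X_L2)
  \<comment> \<open>In the second half of the convective form the unknown stands in the right slot
    of the inner product.\<close>
  have flip: "L2_inner D h u = a * L2_inner D h u1 + b * L2_inner D h u2" if "h \<in> Lp D 2" for h
    using 1[OF that] by (simp add: L2_inner_commute)
  have 2: "L2_inner D (\<lambda>x. grad u x *v u' x) v =
      a * L2_inner D (\<lambda>x. grad u1 x *v u' x) v + b * L2_inner D (\<lambda>x. grad u2 x *v u' x) v"
  proof (intro L2_inner_AE_lincomb_left convection_L2 X_L2 X)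
    show "AE x in lebesgue_on D. grad u x *v u' x = a *\<^sub>R (grad u1 x *v u' x) + b *\<^sub>R (grad u2 x *v u' x)"
      using grad_lincomb[OF X(1-3) u]
      by eventually_elim (simp add: matrix_vector_mult_add_rdistrib scaleR_matrix_vector_assoc)
  qed
  have 3: "L2_inner D (\<lambda>x. cross3 (B' x) (curl B x)) v =
      a * L2_inner D (\<lambda>x. cross3 (B' x) (curl B1 x)) v + b * L2_inner D (\<lambda>x. cross3 (B' x) (curl B2 x)) v"
  proof (intro L2_inner_AE_lincomb_left lorentz_L2 X_L2 X Y)
    show "AE x in lebesgue_on D. cross3 (B' x) (curl B x) = a *\<^sub>R cross3 (B' x) (curl B1 x) + b *\<^sub>R cross3 (B' x) (curl B2 x)"
      using curl_lincomb[OF Y(1-3) B] by eventually_elim (simp add: cross_add_right cross_mult_right)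
  qed
  have 4: "L2_inner D B w = a * L2_inner D B1 w + b * L2_inner D B2 w"
    by (intro L2_inner_AE_lincomb_left Y_L2 Y B)
  have 5: "L2_inner D (curl B) (curl w) = a * L2_inner D (curl B1) (curl w) + b * L2_inner D (curl B2) (curl w)"
    by (intro L2_inner_AE_lincomb_left Y_curl_L2 Y curl_lincomb B)
  have 6: "L2_inner D (\<lambda>x. cross3 (u x) (B' x)) (curl w) =
      a * L2_inner D (\<lambda>x. cross3 (u1 x) (B' x)) (curl w) + b * L2_inner D (\<lambda>x. cross3 (u2 x) (B' x)) (curl w)"
  proof (intro L2_inner_AE_lincomb_left induction_L2 Y_curl_L2 X Y)
    show "AE x in lebesgue_on D. cross3 (u x) (B' x) = a *\<^sub>R cross3 (u1 x) (B' x) + b *\<^sub>R cross3 (u2 x) (B' x)"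
      using u by eventually_elim (simp add: cross_add_left cross_mult_left)
  qed
  show ?thesis
    unfolding linear_part_def 1[OF X_L2[OF X(4)]] flip[OF convection_L2[OF X(4)]] 2 3 4 5 6
    by (simp add: algebra_simps)
qed

lemma linear_part_right:
  assumes X: "v1 \<in> X0" "v2 \<in> X0" "v \<in> X0" "u \<in> X0" and Y: "w1 \<in> Y" "w2 \<in> Y" "w \<in> Y" "B \<in> Y"
    and v: "AE x in lebesgue_on D. v x = a *\<^sub>R v1 x + b *\<^sub>R v2 x"
    and w: "AE x in lebesgue_on D. w x = a *\<^sub>R w1 x + b *\<^sub>R w2 x"
  shows "linear_part u B v w = a * linear_part u B v1 w1 + b * linear_part u B v2 w2"
proof -
  have 1: "L2_inner D h v = a * L2_inner D h v1 + b * L2_inner D h v2" if "h \<in> Lp D 2" for h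
    using X that v by (intro L2_inner_AE_lincomb_right) (simp_all add: X_L2)
  have 2: "L2_inner D (\<lambda>x. grad v x *v u' x) u =
      a * L2_inner D (\<lambda>x. grad v1 x *v u' x) u + b * L2_inner D (\<lambda>x. grad v2 x *v u' x) u"
  proof (intro L2_inner_AE_lincomb_left convection_L2 X_L2 X)
    show "AE x in lebesgue_on D. grad v x *v u' x = a *\<^sub>R (grad v1 x *v u' x) + b *\<^sub>R (grad v2 x *v u' x)"
      using grad_lincomb[OF X(1-3) v]
      by eventually_elim (simp add: matrix_vector_mult_add_rdistrib scaleR_matrix_vector_assoc)
  qed
  have 3: "L2_inner D B w = a * L2_inner D B w1 + b * L2_inner D B w2"
    by (intro L2_inner_AE_lincomb_right Y_L2 Y w)
  have 4: "L2_inner D h (curl w) = a * L2_inner D h (curl w1) + b * L2_inner D h (curl w2)" if "h \<in> Lp D 2" for h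
    using that by (intro L2_inner_AE_lincomb_right Y_curl_L2 Y curl_lincomb w)
  show ?thesis
    unfolding linear_part_def 1[OF X_L2[OF X(4)]] 1[OF convection_L2[OF X(4)]] 1[OF lorentz_L2[OF Y(4)]]
      2 3 4[OF Y_curl_L2[OF Y(4)]] 4[OF induction_L2[OF X(4)]]
    by (simp add: algebra_simps)
qed

lemma load_lincomb:
  assumes "v1 \<in> X0" "v2 \<in> X0" "v \<in> X0" "w1 \<in> Y" "w2 \<in> Y" "w \<in> Y"
    and v: "AE x in lebesgue_on D. v x = a *\<^sub>R v1 x + b *\<^sub>R v2 x"
    and w: "AE x in lebesgue_on D. w x = a *\<^sub>R w1 x + b *\<^sub>R w2 x"
  shows "load v w = a * load v1 w1 + b * load v2 w2"
proof -
  have 1: "L2_inner D h v = a * L2_inner D h v1 + b * L2_inner D h v2" if "h \<in> Lp D 2" for h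
    using assms that by (intro L2_inner_AE_lincomb_right) (simp_all add: X_L2)
  have 2: "L2_inner D h w = a * L2_inner D h w1 + b * L2_inner D h w2" if "h \<in> Lp D 2" for h
    using assms that by (intro L2_inner_AE_lincomb_right) (simp_all add: Y_L2)
  show ?thesis
    unfolding load_def 1[OF data(1)] 1[OF X_L2[OF prev(1)]] 2[OF data(2)] 2[OF Y_L2[OF prev(2)]]
    by (simp add: algebra_simps)
qed

lemma viscous_lincomb:
  assumes "v1 \<in> X0" "v2 \<in> X0" "v \<in> X0" "u \<in> X0" "AE x in lebesgue_on D. v x = a *\<^sub>R v1 x + b *\<^sub>R v2 x"
  shows "viscous u v = a * viscous u v1 + b * viscous u v2"
  unfolding viscous_def
  using L2_inner_p_stress_lincomb[OF p X_grad_Lp[OF assms(4)] X_grad_Lp[OF assms(1)] X_grad_Lp[OF assms(2)]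
      X_grad_Lp[OF assms(3)] grad_lincomb[OF assms(1-3,5)]]
  by (simp add: algebra_simps)

lemma residual_lincomb:
  assumes "v1 \<in> X0" "v2 \<in> X0" "v \<in> X0" "w1 \<in> Y" "w2 \<in> Y" "w \<in> Y" "u \<in> X0" "B \<in> Y"
    and "AE x in lebesgue_on D. v x = a *\<^sub>R v1 x + b *\<^sub>R v2 x"
    and "AE x in lebesgue_on D. w x = a *\<^sub>R w1 x + b *\<^sub>R w2 x"
  shows "residual u B v w = a * residual u B v1 w1 + b * residual u B v2 w2"
  using assms linear_part_right[OF assms(1-3,7,4-6,8-10)] load_lincomb[OF assms(1-6,9,10)]
    viscous_lincomb[OF assms(1-3,7,9)]
  by (simp add: residual_def algebra_simps)

text \<open>On the diagonal the two halves of the convective form coincide and cancel, and the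
  coupling terms cancel by the cyclic triple product. What the estimate drops is only the resistive
  energy of \<open>curl B\<close>.\<close>

lemma linear_part_coercive:
  assumes u: "u \<in> X0" and B: "B \<in> Y"
  shows "1 / dt * L2_inner D u u + 1 / (\<mu> * \<rho>) * (1 / dt * L2_inner D B B) \<le> linear_part u B u B"
proof -
  have "cross3 (B' x) (curl B x) \<bullet> u x = cross3 (u x) (B' x) \<bullet> curl B x" for x
    by (simp add: cross3_simps)
  then have "L2_inner D (\<lambda>x. cross3 (B' x) (curl B x)) u = L2_inner D (\<lambda>x. cross3 (u x) (B' x)) (curl B)"
    by (simp add: L2_inner_def)
  moreover have "0 \<le> 1 / (\<mu> * \<rho>) * (1 / (\<mu> * \<sigma>) * L2_inner D (curl B) (curl B))"
    using pos L2_inner_self_nonneg[of D "curl B"] by (intro mult_nonneg_nonneg) auto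
  ultimately show ?thesis
    unfolding linear_part_def by (simp add: algebra_simps)
qed

lemma viscous_monotone:
  assumes "u \<in> X0" "v \<in> X0" "d \<in> X0" "AE x in lebesgue_on D. d x = 1 *\<^sub>R u x + (- 1) *\<^sub>R v x"
  shows "0 \<le> viscous u d - viscous v d"
proof -
  note int = integrable_p_stress[OF p X_grad_Lp X_grad_Lp]
  have "0 \<le> (LINT x|lebesgue_on D. p_stress p (grad u x) \<bullet> grad d x - p_stress p (grad v x) \<bullet> grad d x)"
  proof (rule integral_nonneg_AE)
    show "AE x in lebesgue_on D. 0 \<le> p_stress p (grad u x) \<bullet> grad d x - p_stress p (grad v x) \<bullet> grad d x"
      using grad_lincomb[OF assms]
    proof eventually_elim
      case (elim x)
      then show ?case
        using p_stress_monotone[OF p, of "grad u x" "grad v x"] by (simp add: inner_diff_left)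
    qed
  qed
  also have "\<dots> = L2_inner D (\<lambda>x. p_stress p (grad u x)) (grad d) - L2_inner D (\<lambda>x. p_stress p (grad v x)) (grad d)"
    unfolding L2_inner_def using assms int by (intro Bochner_Integration.integral_diff) auto
  finally have "0 \<le> \<nu> / \<rho> * (L2_inner D (\<lambda>x. p_stress p (grad u x)) (grad d) - L2_inner D (\<lambda>x. p_stress p (grad v x)) (grad d))"
    using pos by (intro mult_nonneg_nonneg) auto
  then show ?thesis
    by (simp add: viscous_def algebra_simps)
qed

text \<open>The load cancels in the difference, the linear part becomes \<open>linear_part\<close>
  of the difference tested with itself, and the viscous part adds a nonnegative amount. The
  equations for \<open>d\<close> and \<open>E\<close> have the shape used in
  \<open>galerkin_existence\<close>.\<close>

lemma residual_monotone:
  assumes u: "u \<in> X0" "v \<in> X0" and B: "B \<in> Y" "C \<in> Y"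
    and d: "d = (\<lambda>x. 1 *\<^sub>R u x + (- 1) *\<^sub>R v x)" and E: "E = (\<lambda>x. 1 *\<^sub>R B x + (- 1) *\<^sub>R C x)"
  shows "1 / dt * L2_inner D d d + 1 / (\<mu> * \<rho>) * (1 / dt * L2_inner D E E) \<le> residual u B d E - residual v C d E"
proof -
  have dX: "d \<in> X0" unfolding d by (rule fun_subspace_lincomb[OF subX u])
  have EY: "E \<in> Y" unfolding E by (rule fun_subspace_lincomb[OF subY B])
  have "linear_part d E d E = 1 * linear_part u B d E + (- 1) * linear_part v C d E"
    using u B dX EY by (intro linear_part_left) (simp_all add: d E)
  moreover have "0 \<le> viscous u d - viscous v d"
    using u dX by (intro viscous_monotone) (simp_all add: d)
  ultimately show ?thesis
    using linear_part_coercive[OF dX EY] by (simp add: residual_def)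
qed

text \<open>The two equations are recovered from their weighted sum by testing with pairs in which
  one component is zero, the weight being nonzero.\<close>

lemma scheme_step_iff:
  "scheme_step D p \<nu> \<rho> \<mu> \<sigma> dt X0 Y g f u' B' u B \<longleftrightarrow>
    u \<in> X0 \<and> B \<in> Y \<and> (\<forall>v\<in>X0. \<forall>w\<in>Y. residual u B v w = 0)"
proof (cases "u \<in> X0 \<and> B \<in> Y")
  case True
  then have u: "u \<in> X0" and B: "B \<in> Y" by auto
  have zeroX: "(\<lambda>x. 0) \<in> X0" and zeroY: "(\<lambda>x. 0) \<in> Y"
    using subX subY by (auto simp: fun_subspace_def)
  define e1 where "e1 v = L2_inner D (\<lambda>x. (1 / dt) *\<^sub>R (u x - u' x)) v + a1 D u' u v + viscous u v
    + 1 / (\<mu> * \<rho>) * L2_inner D (\<lambda>x. cross3 (B' x) (curl B x)) v - L2_inner D g v" for v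
  define e2 where "e2 w = L2_inner D (\<lambda>x. (1 / dt) *\<^sub>R (B x - B' x)) w
    + 1 / (\<mu> * \<sigma>) * L2_inner D (curl B) (curl w) - L2_inner D (\<lambda>x. cross3 (u x) (B' x)) (curl w)
    - L2_inner D f w" for w
  have residual: "residual u B v w = e1 v + 1 / (\<mu> * \<rho>) * e2 w" if v: "v \<in> X0" and w: "w \<in> Y" for v w
  proof -
    have "L2_inner D (\<lambda>x. (1 / dt) *\<^sub>R (u x - u' x)) v = 1 / dt * L2_inner D u v + (- (1 / dt)) * L2_inner D u' v"
      using L2_inner_lincomb_left[OF X_L2[OF u] X_L2[OF prev(1)] X_L2[OF v], of "1 / dt" "- (1 / dt)"]
      by (simp add: scaleR_diff_right)
    moreover have "L2_inner D (\<lambda>x. (1 / dt) *\<^sub>R (B x - B' x)) w = 1 / dt * L2_inner D B w + (- (1 / dt)) * L2_inner D B' w"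
      using L2_inner_lincomb_left[OF Y_L2[OF B] Y_L2[OF prev(2)] Y_L2[OF w], of "1 / dt" "- (1 / dt)"]
      by (simp add: scaleR_diff_right)
    ultimately show ?thesis
      by (simp only: residual_def linear_part_def load_def e1_def e2_def a1_def L2_inner_def[symmetric])
        (simp add: algebra_simps)
  qed
  \<comment> \<open>Not a simplification: the curl of the zero field is a chosen representative and
    vanishes only almost everywhere, as linearity with both coefficients 0 shows.\<close>
  have "e2 (\<lambda>x. 0) = 0"
  proof -
    have "L2_inner D h (curl (\<lambda>x. 0)) = 0" if "h \<in> Lp D 2" for h
      using L2_inner_AE_lincomb_right[OF Y_curl_L2 Y_curl_L2 Y_curl_L2 that
          curl_lincomb[OF zeroY zeroY zeroY, of 0 0], OF zeroY zeroY zeroY] by simp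
    then show ?thesis
      using u B by (simp add: e2_def Y_curl_L2 induction_L2)
  qed
  then have "(\<forall>v\<in>X0. \<forall>w\<in>Y. residual u B v w = 0) \<longleftrightarrow> (\<forall>v\<in>X0. \<forall>w\<in>Y. e1 v = 0 \<and> e2 w = 0)"
    using residual zeroX zeroY pos by (metis add.right_neutral add_0 divide_eq_0_iff less_numeral_extra(3)
        mult_eq_0_iff mult_zero_right zero_neq_one)
  moreover have "scheme_step D p \<nu> \<rho> \<mu> \<sigma> dt X0 Y g f u' B' u B \<longleftrightarrow> (\<forall>v\<in>X0. \<forall>w\<in>Y. e1 v = 0 \<and> e2 w = 0)"
    using True by (simp add: scheme_step_def e1_def e2_def viscous_def p_stress_def)
  ultimately show ?thesis
    using True by simp
qed (auto simp: scheme_step_def)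

lemma scheme_step_unique:
  assumes "scheme_step D p \<nu> \<rho> \<mu> \<sigma> dt X0 Y g f u' B' u B" "scheme_step D p \<nu> \<rho> \<mu> \<sigma> dt X0 Y g f u' B' v C"
  shows "AE x in lebesgue_on D. v x = u x \<and> C x = B x"
proof -
  have mem: "u \<in> X0" "v \<in> X0" "B \<in> Y" "C \<in> Y"
    using assms unfolding scheme_step_iff by auto
  define d where "d = (\<lambda>x. 1 *\<^sub>R u x + (- 1) *\<^sub>R v x)"
  define E where "E = (\<lambda>x. 1 *\<^sub>R B x + (- 1) *\<^sub>R C x)"
  have dX: "d \<in> X0" unfolding d_def by (rule fun_subspace_lincomb[OF subX mem(1,2)])
  have EY: "E \<in> Y" unfolding E_def by (rule fun_subspace_lincomb[OF subY mem(3,4)])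
  have "1 / dt * L2_inner D d d + 1 / (\<mu> * \<rho>) * (1 / dt * L2_inner D E E) \<le> 0"
    using residual_monotone[OF mem d_def E_def] assms dX EY unfolding scheme_step_iff by simp
  moreover have "0 \<le> 1 / dt * L2_inner D d d" "0 \<le> 1 / (\<mu> * \<rho>) * (1 / dt * L2_inner D E E)"
    using pos L2_inner_self_nonneg[of D d] L2_inner_self_nonneg[of D E] by (auto intro!: mult_nonneg_nonneg)
  ultimately have "1 / dt * L2_inner D d d = 0" "1 / (\<mu> * \<rho>) * (1 / dt * L2_inner D E E) = 0"
    by linarith+
  then have "L2_inner D d d = 0" "L2_inner D E E = 0"
    using pos by auto
  then have "AE x in lebesgue_on D. d x = 0" "AE x in lebesgue_on D. E x = 0"
    using L2_inner_self_eq_0[OF X_L2[OF dX]] L2_inner_self_eq_0[OF Y_L2[OF EY]] by simp_all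
  then show ?thesis
    by eventually_elim (simp add: d_def E_def)
qed

text \<open>\<open>galerkin_existence\<close> has a single unknown field, so velocity and magnetic
  field are merged into one field with values in the product; its squared L2 norm is the sum of the
  two.\<close>

definition pairs :: "(real^3 \<Rightarrow> (real^3) \<times> (real^3)) set" where
  "pairs = {z. (\<lambda>x. fst (z x)) \<in> X0 \<and> (\<lambda>x. snd (z x)) \<in> Y}"

lemma fun_subspace_pairs: "fun_subspace pairs"
proof (rule fun_subspaceI)
  show "(\<lambda>x. 0) \<in> pairs"
    using subX subY by (simp add: pairs_def fun_subspace_def)
  show "(\<lambda>x. a *\<^sub>R z x + b *\<^sub>R z' x) \<in> pairs" if "z \<in> pairs" "z' \<in> pairs" for a b z z'
    using that fun_subspace_lincomb[OF subX, of "\<lambda>x. fst (z x)" "\<lambda>x. fst (z' x)" a b]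
      fun_subspace_lincomb[OF subY, of "\<lambda>x. snd (z x)" "\<lambda>x. snd (z' x)" a b]
    by (simp add: pairs_def)
qed

lemma pairs_L2: "pairs \<subseteq> Lp D 2"
proof
  fix z assume z: "z \<in> pairs"
  then have L2: "(\<lambda>x. fst (z x)) \<in> Lp D 2" "(\<lambda>x. snd (z x)) \<in> Lp D 2"
    by (auto simp: pairs_def X_L2 Y_L2)
  then have "(\<lambda>x. (fst (z x), snd (z x))) \<in> borel_measurable (lebesgue_on D)"
    by (intro borel_measurable_Pair) (simp_all add: Lp_2_iff)
  moreover have "(norm (z x))\<^sup>2 = (norm (fst (z x)))\<^sup>2 + (norm (snd (z x)))\<^sup>2" for x
    by (simp add: norm_prod_def)
  ultimately show "z \<in> Lp D 2"
    using L2 by (simp add: Lp_2_iff)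
qed

lemma L2_inner_pairs:
  assumes "z \<in> pairs"
  shows "L2_inner D z z = L2_inner D (\<lambda>x. fst (z x)) (\<lambda>x. fst (z x)) + L2_inner D (\<lambda>x. snd (z x)) (\<lambda>x. snd (z x))"
  using assms integrable_L2_inner[OF X_L2 X_L2, of "\<lambda>x. fst (z x)" "\<lambda>x. fst (z x)"]
    integrable_L2_inner[OF Y_L2 Y_L2, of "\<lambda>x. snd (z x)" "\<lambda>x. snd (z x)"]
  by (simp add: L2_inner_def inner_prod_def pairs_def)

lemma pairs_spanned:
  "ae_spanned D pairs (I <+> J) (case_sum (\<lambda>i x. (e i x, 0)) (\<lambda>j x. (0, e' j x)))"
  unfolding ae_spanned_def
proof
  fix z assume "z \<in> pairs"
  then obtain c d where
    c: "AE x in lebesgue_on D. fst (z x) = (\<Sum>i\<in>I. c i *\<^sub>R e i x)" and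
    d: "AE x in lebesgue_on D. snd (z x) = (\<Sum>j\<in>J. d j *\<^sub>R e' j x)"
    using bspec[OF spanX(2)[unfolded ae_spanned_def], of "\<lambda>x. fst (z x)"]
      bspec[OF spanY(2)[unfolded ae_spanned_def], of "\<lambda>x. snd (z x)"]
    unfolding pairs_def by blast
  have "AE x in lebesgue_on D. z x =
      (\<Sum>i\<in>I <+> J. case_sum c d i *\<^sub>R case_sum (\<lambda>i x. (e i x, 0)) (\<lambda>j x. (0, e' j x)) i x)"
    using c d
  proof eventually_elim
    case (elim x)
    have "(\<Sum>i\<in>I <+> J. case_sum c d i *\<^sub>R case_sum (\<lambda>i x. (e i x, 0)) (\<lambda>j x. (0, e' j x)) i x) =
        (\<Sum>i\<in>I. (c i *\<^sub>R e i x, 0)) + (\<Sum>j\<in>J. (0, d j *\<^sub>R e' j x))"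
      using spanX(1) spanY(1) by (simp add: sum.Plus)
    also have "\<dots> = (fst (z x), snd (z x))"
      unfolding elim by (simp add: prod_eq_iff fst_sum snd_sum)
    finally show ?case by simp
  qed
  then show "\<exists>c. AE x in lebesgue_on D. z x =
      (\<Sum>i\<in>I <+> J. c i *\<^sub>R case_sum (\<lambda>i x. (e i x, 0)) (\<lambda>j x. (0, e' j x)) i x)"
    by blast
qed

text \<open>Extends two-term linearity up to null sets to finite sums, with \<open>weak_grad\<close>
  as the intended \<open>L\<close>: the gradient of a basis expansion may be replaced by the
  expansion of the gradients.\<close>

lemma AE_sum_of_lincomb:
  fixes L :: "(real^3 \<Rightarrow> real^3) \<Rightarrow> real^3 \<Rightarrow> 'c::real_vector"
  assumes V: "fun_subspace V"
    and L: "\<And>u v w a b. u \<in> V \<Longrightarrow> v \<in> V \<Longrightarrow> w \<in> V \<Longrightarrow>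
        (AE x in lebesgue_on D. w x = a *\<^sub>R u x + b *\<^sub>R v x) \<Longrightarrow> AE x in lebesgue_on D. L w x = a *\<^sub>R L u x + b *\<^sub>R L v x"
    and b: "\<forall>i<n. b i \<in> V"
  shows "AE y in lebesgue_on D. L (\<lambda>y. \<Sum>i<n. x i *\<^sub>R b i y) y = (\<Sum>i<(n::nat). x i *\<^sub>R L (b i) y)"
  using b
proof (induction n)
  case 0
  have "(\<lambda>x. 0) \<in> V" using V by (simp add: fun_subspace_def)
  from L[OF this this this, of 0 0] show ?case by simp
next
  case (Suc n)
  have sums: "(\<lambda>y. \<Sum>i<k. x i *\<^sub>R b i y) \<in> V" if "k \<le> Suc n" for k
    using Suc.prems that by (intro fun_subspace_sum V) auto
  have "AE y in lebesgue_on D. L (\<lambda>y. \<Sum>i<Suc n. x i *\<^sub>R b i y) y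
      = 1 *\<^sub>R L (\<lambda>y. \<Sum>i<n. x i *\<^sub>R b i y) y + x n *\<^sub>R L (b n) y"
    using Suc.prems by (intro L[OF sums _ sums]) auto
  moreover have "AE y in lebesgue_on D. L (\<lambda>y. \<Sum>i<n. x i *\<^sub>R b i y) y = (\<Sum>i<n. x i *\<^sub>R L (b i) y)"
    using Suc by simp
  ultimately show ?case
    by eventually_elim simp
qed

lemma linear_part_sum:
  assumes b: "\<forall>i<n. b i \<in> X0" "\<forall>i<n. c i \<in> Y" and vw: "v \<in> X0" "w \<in> Y"
  shows "linear_part (\<lambda>y. \<Sum>i<n. x i *\<^sub>R b i y) (\<lambda>y. \<Sum>i<n. x i *\<^sub>R c i y) v w
    = (\<Sum>i<(n::nat). x i * linear_part (b i) (c i) v w)"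
  using b
proof (induction n)
  case 0
  have "(\<lambda>x. 0) \<in> X0" "(\<lambda>x. 0) \<in> Y" using subX subY by (simp_all add: fun_subspace_def)
  from linear_part_left[OF this(1,1,1) vw(1) this(2,2,2) vw(2), of 0 0] show ?case by simp
next
  case (Suc n)
  have sums: "(\<lambda>y. \<Sum>i<k. x i *\<^sub>R b i y) \<in> X0" "(\<lambda>y. \<Sum>i<k. x i *\<^sub>R c i y) \<in> Y" if "k \<le> Suc n" for k
    using Suc.prems that by (auto intro!: fun_subspace_sum subX subY)
  have "linear_part (\<lambda>y. \<Sum>i<Suc n. x i *\<^sub>R b i y) (\<lambda>y. \<Sum>i<Suc n. x i *\<^sub>R c i y) v w
      = 1 * linear_part (\<lambda>y. \<Sum>i<n. x i *\<^sub>R b i y) (\<lambda>y. \<Sum>i<n. x i *\<^sub>R c i y) v w + x n * linear_part (b n) (c n) v w"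
    using Suc.prems vw by (intro linear_part_left sums) auto
  then show ?case
    using Suc by simp
qed

text \<open>The linear part is a finite linear form in the coefficients and the load is constant.
  Dominated convergence is required only for the viscous term, once gradient and sum have been
  exchanged.\<close>

lemma residual_continuous:
  assumes b: "\<forall>i<n. b i \<in> X0" "\<forall>i<n. c i \<in> Y" and vw: "v \<in> X0" "w \<in> Y"
  shows "continuous_on UNIV (\<lambda>x::nat \<Rightarrow> real. residual (\<lambda>y. \<Sum>i<n. x i *\<^sub>R b i y) (\<lambda>y. \<Sum>i<n. x i *\<^sub>R c i y) v w)"
proof -
  have sumX: "(\<lambda>y. \<Sum>i<n. x i *\<^sub>R b i y) \<in> X0" for x
    using b by (auto intro!: fun_subspace_sum subX)
  have viscous: "viscous (\<lambda>y. \<Sum>i<n. x i *\<^sub>R b i y) v =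
      \<nu> / \<rho> * L2_inner D (\<lambda>y. p_stress p (\<Sum>i<n. x i *\<^sub>R grad (b i) y)) (grad v)" for x
  proof -
    have "(\<lambda>y. \<Sum>i<n. x i *\<^sub>R grad (b i) y) \<in> Lp D p"
      using b p by (intro Lp_sum X_grad_Lp) auto
    then show ?thesis
      unfolding viscous_def
      using L2_inner_p_stress_cong[OF p X_grad_Lp[OF sumX] _ X_grad_Lp[OF vw(1)] AE_sum_of_lincomb[OF subX _ b(1), of grad x]]
        grad_lincomb by simp
  qed
  have "continuous_on UNIV (\<lambda>x::nat \<Rightarrow> real. L2_inner D (\<lambda>y. p_stress p (\<Sum>i<n. x i *\<^sub>R grad (b i) y)) (grad v))"
    using b vw by (intro continuous_L2_inner_p_stress p X_grad_Lp) auto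
  then have "continuous_on UNIV (\<lambda>x::nat \<Rightarrow> real. viscous (\<lambda>y. \<Sum>i<n. x i *\<^sub>R b i y) v)"
    unfolding viscous by (rule continuous_on_mult_left)
  then show ?thesis
    unfolding residual_def linear_part_sum[OF assms]
    by (intro continuous_on_add continuous_on_diff continuous_on_sum continuous_on_mult_right continuous_on_const
        continuous_on_product_coordinates)
qed

lemma scheme_step_exists: "\<exists>u B. scheme_step D p \<nu> \<rho> \<mu> \<sigma> dt X0 Y g f u' B' u B"
proof -
  define \<Phi> where "\<Phi> z \<zeta> = residual (\<lambda>x. fst (z x)) (\<lambda>x. snd (z x)) (\<lambda>x. fst (\<zeta> x)) (\<lambda>x. snd (\<zeta> x))"
    for z \<zeta> :: "real^3 \<Rightarrow> (real^3) \<times> (real^3)"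
  \<comment> \<open>The two components have different monotonicity constants; the smaller one serves
    for the norm of the pair.\<close>
  define c where "c = min (1 / dt) (1 / (\<mu> * \<rho>) * (1 / dt))"
  have "\<exists>z\<in>pairs. \<forall>v\<in>pairs. \<Phi> z v = 0"
  proof (rule galerkin_existence[OF fun_subspace_pairs pairs_L2 _ pairs_spanned])
    show "finite (I <+> J)"
      using spanX(1) spanY(1) by (rule finite_Plus)
    show "c > 0"
      using pos by (simp add: c_def)
  next
    fix z v w y :: "real^3 \<Rightarrow> (real^3) \<times> (real^3)" and a b :: real
    assume mem: "z \<in> pairs" "v \<in> pairs" "w \<in> pairs" "y \<in> pairs"
      and y: "AE x in lebesgue_on D. y x = a *\<^sub>R v x + b *\<^sub>R w x"
    have "AE x in lebesgue_on D. fst (y x) = a *\<^sub>R fst (v x) + b *\<^sub>R fst (w x)"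
      "AE x in lebesgue_on D. snd (y x) = a *\<^sub>R snd (v x) + b *\<^sub>R snd (w x)"
      using y by (auto elim!: eventually_mono)
    then show "\<Phi> z y = a * \<Phi> z v + b * \<Phi> z w"
      unfolding \<Phi>_def using mem by (intro residual_lincomb) (auto simp: pairs_def)
  next
    fix z z' :: "real^3 \<Rightarrow> (real^3) \<times> (real^3)"
    assume z: "z \<in> pairs" "z' \<in> pairs"
    let ?d = "\<lambda>x. 1 *\<^sub>R z x + (- 1) *\<^sub>R z' x"
    let ?u = "\<lambda>x. fst (?d x)" and ?B = "\<lambda>x. snd (?d x)"
    have "c * L2_inner D ?d ?d = c * L2_inner D ?u ?u + c * L2_inner D ?B ?B"
      using L2_inner_pairs[OF fun_subspace_lincomb[OF fun_subspace_pairs z, of 1 "- 1"]]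
      by (simp only: distrib_left)
    also have "\<dots> \<le> 1 / dt * L2_inner D ?u ?u + 1 / (\<mu> * \<rho>) * (1 / dt) * L2_inner D ?B ?B"
      by (intro add_mono mult_right_mono L2_inner_self_nonneg) (simp_all add: c_def)
    also have "\<dots> \<le> \<Phi> z ?d - \<Phi> z' ?d"
      unfolding \<Phi>_def mult.assoc[of _ "1 / dt"]
      using z by (intro residual_monotone) (auto simp: pairs_def)
    finally show "c * L2_inner D ?d ?d \<le> \<Phi> z ?d - \<Phi> z' ?d" .
  next
    fix n :: nat and b v assume "\<forall>i<n. b i \<in> pairs" "v \<in> pairs"
    then have "continuous_on UNIV (\<lambda>x::nat \<Rightarrow> real. residual (\<lambda>y. \<Sum>i<n. x i *\<^sub>R fst (b i y))
        (\<lambda>y. \<Sum>i<n. x i *\<^sub>R snd (b i y)) (\<lambda>y. fst (v y)) (\<lambda>y. snd (v y)))"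
      by (intro residual_continuous) (auto simp: pairs_def)
    then show "continuous_on UNIV (\<lambda>x::nat \<Rightarrow> real. \<Phi> (\<lambda>y. \<Sum>i<n. x i *\<^sub>R b i y) v)"
      by (simp add: \<Phi>_def fst_sum snd_sum)
  qed
  then obtain z where z: "z \<in> pairs" "\<And>\<zeta>. \<zeta> \<in> pairs \<Longrightarrow> \<Phi> z \<zeta> = 0"
    by blast
  have "residual (\<lambda>x. fst (z x)) (\<lambda>x. snd (z x)) v w = 0" if "v \<in> X0" "w \<in> Y" for v w
    using z(2)[of "\<lambda>x. (v x, w x)"] that by (simp add: \<Phi>_def pairs_def)
  then show ?thesis
    using z(1) unfolding scheme_step_iff pairs_def by blast
qed

end

section \<open>The finite element spaces\<close>

text \<open>Membership in the Sobolev space provides some weak gradient in Lp, perhaps not the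
  chosen one. Uniqueness makes them equal almost everywhere, which carries integrability over to
  \<open>weak_grad\<close>.\<close>

lemma W1p_0_weak_grad:
  assumes "open D" "u \<in> W1p_0 D p"
  shows "u \<in> Lp D p" "\<exists>G. has_weak_grad D u G" "weak_grad D u \<in> Lp D p"
proof -
  obtain G where G: "G \<in> Lp D p" "has_weak_grad D u G"
    using assms(2) unfolding W1p_0_def W1p_def by blast
  show "u \<in> Lp D p" "\<exists>G. has_weak_grad D u G"
    using assms(2) G(2) unfolding W1p_0_def W1p_def by blast+
  show "weak_grad D u \<in> Lp D p"
    using has_weak_grad_unique[OF assms(1) G(2) has_weak_grad_weak_grad[OF G(2)]] assms(1) G(1)
    by (intro Lp_cong_AE[OF _ G(1)]) auto
qed

lemma Hcurl_weak_curl: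
  assumes "open D" "B \<in> Hcurl D"
  shows "B \<in> Lp D 2" "\<exists>C. has_weak_curl D B C" "weak_curl D B \<in> Lp D 2"
proof -
  obtain C where C: "C \<in> Lp D 2" "has_weak_curl D B C"
    using assms(2) unfolding Hcurl_def by blast
  show "B \<in> Lp D 2" "\<exists>C. has_weak_curl D B C"
    using assms(2) C(2) unfolding Hcurl_def by blast+
  show "weak_curl D B \<in> Lp D 2"
    using has_weak_curl_unique[OF assms(1) C(2) has_weak_curl_weak_curl[OF C(2)]] assms(1) C(1)
    by (intro Lp_cong_AE[OF _ C(1)]) auto
qed

section \<open>Linearity of the discrete spaces and the final assembly\<close>

lemma fun_subspace_Hcurl:
  assumes "open D" "D \<in> lmeasurable"
  shows "fun_subspace (Hcurl D)"
proof (rule fun_subspaceI)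
  have "has_weak_curl D (\<lambda>x. 0) (\<lambda>x. 0)"
    by (simp add: has_weak_curl_def locally_integrable_def set_integrable_def L2_inner_def)
  then show "(\<lambda>x. 0) \<in> Hcurl D"
    unfolding Hcurl_def using Lp_zero by blast
  fix a b :: real and A B assume "A \<in> Hcurl D" "B \<in> Hcurl D"
  then obtain C E where C: "A \<in> Lp D 2" "C \<in> Lp D 2" "has_weak_curl D A C"
    and E: "B \<in> Lp D 2" "E \<in> Lp D 2" "has_weak_curl D B E"
    unfolding Hcurl_def by blast
  have AB: "(\<lambda>x. a *\<^sub>R A x + b *\<^sub>R B x) \<in> Lp D 2" and CE: "(\<lambda>x. a *\<^sub>R C x + b *\<^sub>R E x) \<in> Lp D 2"
    using C E by (simp_all add: Lp_lincomb)
  have "has_weak_curl D (\<lambda>x. a *\<^sub>R A x + b *\<^sub>R B x) (\<lambda>x. a *\<^sub>R C x + b *\<^sub>R E x)"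
    using assms AB by (intro has_weak_curl_lincomb[OF assms(1) C(3) E(3)] integrable_imp_locally_integrable
        Lp_2_integrable) auto
  with AB CE show "(\<lambda>x. a *\<^sub>R A x + b *\<^sub>R B x) \<in> Hcurl D"
    unfolding Hcurl_def by blast
qed

lemma trace_Lp_2:
  fixes G :: "real^3 \<Rightarrow> real^'n^'n"
  assumes "G \<in> Lp D 2"
  shows "(\<lambda>x. trace (G x)) \<in> Lp D 2"
proof -
  have "(\<lambda>x. G x $ i $ i) \<in> Lp D 2" for i
    unfolding Lp_2_iff
  proof
    have "continuous_on UNIV (\<lambda>A::real^'n^'n. A $ i $ i)"
      by (intro continuous_on_component continuous_on_id)
    then show meas: "(\<lambda>x. G x $ i $ i) \<in> borel_measurable (lebesgue_on D)"
      using assms by (intro borel_measurable_continuous_on[of "\<lambda>A. A $ i $ i"]) (simp_all add: Lp_2_iff)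
    show "integrable (lebesgue_on D) (\<lambda>x. (norm (G x $ i $ i))\<^sup>2)"
    proof (rule Bochner_Integration.integrable_bound)
      show "integrable (lebesgue_on D) (\<lambda>x. (norm (G x))\<^sup>2)"
        using assms by (simp add: Lp_2_iff)
      show "(\<lambda>x. (norm (G x $ i $ i))\<^sup>2) \<in> borel_measurable (lebesgue_on D)"
        using meas by measurable
      have "norm (G x $ i $ i) \<le> norm (G x)" for x
        by (rule order_trans[OF Finite_Cartesian_Product.norm_nth_le Finite_Cartesian_Product.norm_nth_le])
      then have "(norm (G x $ i $ i))\<^sup>2 \<le> (norm (G x))\<^sup>2" for x
        by (intro power_mono norm_ge_zero)
      then show "AE x in lebesgue_on D. norm ((norm (G x $ i $ i))\<^sup>2) \<le> norm ((norm (G x))\<^sup>2)"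
        by (intro AE_I2) simp
    qed
  qed
  then have "(\<lambda>x. \<Sum>i\<in>UNIV. 1 *\<^sub>R (G x $ i $ i)) \<in> Lp D 2"
    by (intro Lp_sum) auto
  then show ?thesis
    by (simp add: trace_def)
qed

text \<open>The constraint is written with \<open>weak_div\<close>, the trace of a chosen gradient,
  so its linearity holds only after integration against \<open>q\<close>. That step needs the
  divergence in L2, which \<open>p \<ge> 2\<close> and the finite measure of \<open>D\<close>
  provide.\<close>

lemma fun_subspace_discretely_div_free:
  assumes D: "open D" "D \<in> lmeasurable" and "p \<ge> 2"
    and X: "fun_subspace Xh" "Xh \<subseteq> W1p_0 D p" and Q: "Qh \<subseteq> Lp D 2"
  shows "fun_subspace (discretely_div_free D Xh Qh)"
proof (rule fun_subspaceI)
  have grad: "\<exists>G. has_weak_grad D v G" if "v \<in> Xh" for v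
    using W1p_0_weak_grad(2)[OF D(1)] that X(2) by blast
  have div_L2: "weak_div D v \<in> Lp D 2" if "v \<in> Xh" for v
    unfolding weak_div_def
    using W1p_0_weak_grad(3)[OF D(1), of v p] that X(2) assms(2,3)
    by (intro trace_Lp_2 Lp_subset_Lp_2[of D p]) auto
  have lincomb: "L2_inner D (weak_div D y) q = a * L2_inner D (weak_div D v) q + b * L2_inner D (weak_div D w) q"
    if mem: "v \<in> Xh" "w \<in> Xh" "y \<in> Xh" "q \<in> Qh" and y: "y = (\<lambda>x. a *\<^sub>R v x + b *\<^sub>R w x)" for v w y q a b
  proof -
    have "AE x in lebesgue_on D. weak_grad D y x = a *\<^sub>R weak_grad D v x + b *\<^sub>R weak_grad D w x"
      using grad[OF mem(1)] grad[OF mem(2)] grad[OF mem(3)] weak_grad_lincomb[OF D(1)] y by blast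
    then have "AE x in lebesgue_on D. weak_div D y x = a *\<^sub>R weak_div D v x + b *\<^sub>R weak_div D w x"
      by eventually_elim (simp add: weak_div_def trace_def sum.distrib sum_distrib_left)
    then show ?thesis
      using mem Q by (intro L2_inner_AE_lincomb_left div_L2) auto
  qed
  have zero: "(\<lambda>x. 0) \<in> Xh"
    using X(1) by (simp add: fun_subspace_def)
  \<comment> \<open>The representative chosen as gradient of the zero field need not vanish
    everywhere; the zero combination settles the integral.\<close>
  have "L2_inner D (weak_div D (\<lambda>x. 0)) q = 0" if "q \<in> Qh" for q
    using lincomb[OF zero zero zero that, of 0 0] by simp
  then show "(\<lambda>x. 0) \<in> discretely_div_free D Xh Qh"
    using zero by (simp add: discretely_div_free_def)
  fix a b :: real and v w assume "v \<in> discretely_div_free D Xh Qh" "w \<in> discretely_div_free D Xh Qh"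
  then have v: "v \<in> Xh" "\<And>q. q \<in> Qh \<Longrightarrow> L2_inner D (weak_div D v) q = 0"
    and w: "w \<in> Xh" "\<And>q. q \<in> Qh \<Longrightarrow> L2_inner D (weak_div D w) q = 0"
    unfolding discretely_div_free_def by auto
  have y: "(\<lambda>x. a *\<^sub>R v x + b *\<^sub>R w x) \<in> Xh"
    by (rule fun_subspace_lincomb[OF X(1) v(1) w(1)])
  then show "(\<lambda>x. a *\<^sub>R v x + b *\<^sub>R w x) \<in> discretely_div_free D Xh Qh"
    using lincomb[OF v(1) w(1) y _ refl] v(2) w(2) by (simp add: discretely_div_free_def)
qed

text \<open>The assumption on earlier steps places the previous pair in the discrete spaces, where
  it is bounded. The step \<open>T / real N\<close>, with \<open>T > 0\<close> and
  \<open>N \<ge> 1\<close> free, reaches every positive time step.\<close>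

theorem theorem4p1:
  fixes D :: "(real^3) set"
    and T p \<nu> \<rho> \<mu> \<sigma> h :: real
    and k N :: nat
    and H :: "real set"
    and \<T> :: "real \<Rightarrow> (real^3) set set"
    and X :: "real \<Rightarrow> (real^3 \<Rightarrow> real^3) set"
    and Q :: "real \<Rightarrow> (real^3 \<Rightarrow> real) set"
    and X0 Y :: "(real^3 \<Rightarrow> real^3) set"
    and u B g f :: "nat \<Rightarrow> real^3 \<Rightarrow> real^3"
  assumes "lipschitz_polyhedral_domain D"
    and "T > 0" "\<nu> > 0" "\<rho> > 0" "\<mu> > 0" "\<sigma> > 0"
    and "p \<ge> 2" "k \<ge> 1"
    and "regular_quasi_uniform_family D H \<T>"
    and "velocity_pressure_pair D p k H \<T> X Q"
    and "h \<in> H" "N \<ge> 1"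
  defines "X0 \<equiv> discretely_div_free D (X h) (Q h)"
    and "Y \<equiv> edge_space D (\<T> h) k"
  assumes "u 0 \<in> X0" "B 0 \<in> Y"
    and "\<forall>m \<in> {1..N}. g m \<in> Lp D 2 \<and> f m \<in> Lp D 2"
  shows "\<forall>m \<in> {1..N}.
    (\<forall>j \<in> {1..<m}. scheme_step D p \<nu> \<rho> \<mu> \<sigma> (T / real N) X0 Y (g j) (f j)
                      (u (j - 1)) (B (j - 1)) (u j) (B j)) \<longrightarrow>
    (\<exists>um Bm. scheme_step D p \<nu> \<rho> \<mu> \<sigma> (T / real N) X0 Y (g m) (f m) (u (m - 1)) (B (m - 1)) um Bm \<and>
       (\<forall>um' Bm'. scheme_step D p \<nu> \<rho> \<mu> \<sigma> (T / real N) X0 Y (g m) (f m) (u (m - 1)) (B (m - 1)) um' Bm'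
          \<longrightarrow> (AE x in lebesgue_on D. um' x = um x \<and> Bm' x = Bm x)))"
proof (intro ballI impI)
  fix m assume m: "m \<in> {1..N}"
    and steps: "\<forall>j \<in> {1..<m}. scheme_step D p \<nu> \<rho> \<mu> \<sigma> (T / real N) X0 Y (g j) (f j)
                      (u (j - 1)) (B (j - 1)) (u j) (B j)"
  have prev: "u (m - 1) \<in> X0" "B (m - 1) \<in> Y"
  proof -
    have "u (m - 1) \<in> X0 \<and> B (m - 1) \<in> Y"
    proof (cases "m = 1")
      case True
      then show ?thesis using \<open>u 0 \<in> X0\<close> \<open>B 0 \<in> Y\<close> by simp
    next
      case False
      then have "m - 1 \<in> {1..<m}" using m by auto
      then show ?thesis using steps unfolding scheme_step_def by blast
    qed
    then show "u (m - 1) \<in> X0" "B (m - 1) \<in> Y" by auto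
  qed
  have D: "open D" "D \<in> lmeasurable"
    using \<open>lipschitz_polyhedral_domain D\<close> lmeasurable_open unfolding lipschitz_polyhedral_domain_def by blast+
  have D_sets: "D \<in> sets lebesgue"
    using D(2) by (rule fmeasurableD)
  have mesh: "tetrahedral_mesh D (\<T> h)"
    using \<open>regular_quasi_uniform_family D H \<T>\<close> \<open>h \<in> H\<close> unfolding regular_quasi_uniform_family_def by blast
  note cells = tetrahedral_mesh_cells(1,2)[OF mesh] D_sets tetrahedral_mesh_cells(3)[OF mesh]
  have X: "fun_subspace (X h)" "X h \<subseteq> W1p_0 D p" "X h \<subseteq> piecewise (\<T> h) (poly_le k)" "Q h \<subseteq> Lp D 2"
    using \<open>velocity_pressure_pair D p k H \<T> X Q\<close> \<open>h \<in> H\<close>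
    unfolding velocity_pressure_pair_def L2_zero_mean_def by blast+
  have X0: "X0 \<subseteq> X h"
    unfolding X0_def discretely_div_free_def by blast
  have Y: "Y \<subseteq> Hcurl D" "Y \<subseteq> piecewise (\<T> h) (poly_le k)"
    unfolding Y_def edge_space_def using piecewise_mono[OF nedelec_subset_poly_le] by blast+
  have subY: "fun_subspace Y"
  proof (rule fun_subspaceI)
    have "(\<lambda>x. 0) \<in> piecewise (\<T> h) (nedelec k)"
      using fun_subspace_nedelec[of k] unfolding piecewise_def fun_subspace_def by auto
    then show "(\<lambda>x. 0) \<in> Y"
      using fun_subspace_Hcurl[OF D] unfolding Y_def edge_space_def fun_subspace_def by blast
    show "(\<lambda>x. a *\<^sub>R v x + b *\<^sub>R w x) \<in> Y" if "v \<in> Y" "w \<in> Y" for a b v w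
      using that fun_subspace_lincomb[OF fun_subspace_Hcurl[OF D]] piecewise_lincomb[OF fun_subspace_nedelec]
      unfolding Y_def edge_space_def by blast
  qed
  have spanned: "\<exists>e. ae_spanned D (piecewise (\<T> h) (poly_le k) :: (real^3 \<Rightarrow> real^3) set)
      (\<T> h \<times> {\<alpha> :: 3 \<Rightarrow> nat. (\<Sum>i\<in>UNIV. \<alpha> i) \<le> k} \<times> (Basis :: (real^3) set)) e"
    by (rule piecewise_ae_spanned) (use cells in auto)
  have bounded: "\<exists>M. AE x in lebesgue_on D. norm (v x) \<le> M"
    if "v \<in> piecewise (\<T> h) (poly_le k)" for v :: "real^3 \<Rightarrow> real^3"
    by (rule piecewise_bounded[OF _ _ _ _ that]) (use cells in auto)
  obtain e where e: "ae_spanned D (piecewise (\<T> h) (poly_le k) :: (real^3 \<Rightarrow> real^3) set)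
      (\<T> h \<times> {\<alpha> :: 3 \<Rightarrow> nat. (\<Sum>i\<in>UNIV. \<alpha> i) \<le> k} \<times> (Basis :: (real^3) set)) e"
    using spanned by blast
  have W: "X0 \<subseteq> W1p_0 D p" using X0 X(2) by blast
  interpret mhd_step D p \<nu> \<rho> \<mu> \<sigma> "T / real N" X0 Y "u (m - 1)" "B (m - 1)" "g m" "f m"
    "\<T> h \<times> {\<alpha> :: 3 \<Rightarrow> nat. (\<Sum>i\<in>UNIV. \<alpha> i) \<le> k} \<times> (Basis :: (real^3) set)"
    "\<T> h \<times> {\<alpha> :: 3 \<Rightarrow> nat. (\<Sum>i\<in>UNIV. \<alpha> i) \<le> k} \<times> (Basis :: (real^3) set)" e e
  proof
    show "T / real N > 0" using \<open>T > 0\<close> \<open>N \<ge> 1\<close> by simp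
    show "fun_subspace X0"
      unfolding X0_def by (rule fun_subspace_discretely_div_free[OF D \<open>p \<ge> 2\<close> X(1,2,4)])
    show "finite (\<T> h \<times> {\<alpha> :: 3 \<Rightarrow> nat. (\<Sum>i\<in>UNIV. \<alpha> i) \<le> k} \<times> (Basis :: (real^3) set))"
      using cells(1) finite_multi_indices by (intro finite_cartesian_product) auto
    show "ae_spanned D X0 (\<T> h \<times> {\<alpha> :: 3 \<Rightarrow> nat. (\<Sum>i\<in>UNIV. \<alpha> i) \<le> k} \<times> (Basis :: (real^3) set)) e"
      using e X0 X(3) unfolding ae_spanned_def by blast
    show "ae_spanned D Y (\<T> h \<times> {\<alpha> :: 3 \<Rightarrow> nat. (\<Sum>i\<in>UNIV. \<alpha> i) \<le> k} \<times> (Basis :: (real^3) set)) e"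
      using e Y(2) unfolding ae_spanned_def by blast
    show "v \<in> Lp D 2" if "v \<in> X0" for v
      using W1p_0_weak_grad(1)[OF D(1)] Lp_subset_Lp_2[OF D(2) \<open>p \<ge> 2\<close>] W that by blast
    show "\<exists>G. has_weak_grad D v G" "weak_grad D v \<in> Lp D p" if "v \<in> X0" for v
      using W1p_0_weak_grad(2,3)[OF D(1)] W that by blast+
    show "w \<in> Lp D 2" "\<exists>C. has_weak_curl D w C" "weak_curl D w \<in> Lp D 2" if "w \<in> Y" for w
      using Hcurl_weak_curl[OF D(1)] Y(1) that by blast+
    show "\<exists>M. AE x in lebesgue_on D. norm (u (m - 1) x) \<le> M"
      using X0 X(3) prev(1) by (intro bounded) blast
    show "\<exists>M. AE x in lebesgue_on D. norm (B (m - 1) x) \<le> M"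
      using Y(2) prev(2) by (intro bounded) blast
    show "g m \<in> Lp D 2" "f m \<in> Lp D 2"
      using \<open>\<forall>m \<in> {1..N}. g m \<in> Lp D 2 \<and> f m \<in> Lp D 2\<close> m by auto
  qed (use D subY prev assms(3-7) in auto)
  show "\<exists>um Bm. scheme_step D p \<nu> \<rho> \<mu> \<sigma> (T / real N) X0 Y (g m) (f m) (u (m - 1)) (B (m - 1)) um Bm \<and>
       (\<forall>um' Bm'. scheme_step D p \<nu> \<rho> \<mu> \<sigma> (T / real N) X0 Y (g m) (f m) (u (m - 1)) (B (m - 1)) um' Bm'
          \<longrightarrow> (AE x in lebesgue_on D. um' x = um x \<and> Bm' x = Bm x))"
    using scheme_step_exists scheme_step_unique by blast
qed

end
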